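(* Let $\hat f:Z\to Z$ be a twist map with a stochastic island, let $F$ be the Finsler metric on $T^2$ constructed from $\hat f$ as described in the context, let $V_0=\{(0,h,v)\in ST^2\mid h\in S^1,\ v_1>0\}$, and let $R:V_0\to V_0$ be the first return map of the geodesic flow of $F$ to $V_0$. Then $R$ has positive metric entropy, i.e. $h_\omega(R)>0$.
   Context: Notation. $S^1=\mathbb R/\mathbb Z$, $T^2=\mathbb R^2/\mathbb Z^2$ with coordinates $(t,x)$, $TT^2=T^2\times\mathbb R^2$, $Z=S^1\times\mathbb R$ with area form $dx\wedge dy$. A Finsler metric on $T^2$ is a map $F:TT^2\to[0,\infty)$ that is $C^\infty$ off the zero section, positively homogeneous of degree 1 in $v$, and such that the $v$-Hessian of $\tfrac12F^2$ is positive definite off the zero section. $ST^2=F^{-1}(\{1\})$; the geodesic flow is the restriction to $ST^2$ of the Euler-Lagrange flow of $L_F=\tfrac12F^2$. The map $\hat f$. Let $f_1:Z\to Z$, $f_1(x,y)=(x+y \bmod 1,\,y)$ be the shear map. $\hat f:Z\to Z$ is a $C^\infty$ area-preserving diffeomorphism, a small $C^\infty$-perturbation of $f_1$, with the following properties: it is a twist map (orientation- and end-preserving, area-preserving, of zero flux, and with twist $\partial_y(\text{first component})$ bounded below by a positive constant); $\hat f=f_1$ for $|y|>K$, for some $K>0$; and it has a stochastic island $I\subset Z$, that is, an $\hat f$-invariant domain of positive area, bounded by finitely many $C^0$-embedded circles lying in the union of stable and unstable manifolds of hyperbolic periodic points, such that every point of $I$ has positive maximal Lyapunov exponent. The Lagrangian.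 Let $H:S^1\times Z\to\mathbb R$ be a smooth time-1-periodic Hamiltonian $H(t,x,y)$ on $S^1$, strictly convex in $y$, whose time-1 map from time $0$ is $\hat f$, and which equals $\tfrac12y^2+D_+$ for large positive $y$ and $\tfrac12y^2+D_-$ for large negative $y$, with constants $D_\pm\in\mathbb R$. Let $\hat L(t,x,y)$ be the Lagrangian associated with $H$ by the Legendre transformation (periodic in $t$ and $x$). Let $D>0$ be such that $\hat L=\tfrac12y^2-D_+$ for $y>D$ and $\hat L=\tfrac12y^2-D_-$ for $y<-D$. Let $A,B>0$ be constants and $h_\pm:\mathbb R\to\mathbb R$ smooth functions with $h_\pm''>0$ such that $h_+(y)=\tfrac12y^2-D_+$ for $y<D+1$, $h_+(y)=\sqrt{A+By^2}$ for $y>D+2$, $h_-(y)=\tfrac12y^2-D_-$ for $y>-D-1$, $h_-(y)=\sqrt{A+By^2}$ for $y<-D-2$ ($H$ being such that $A,B,h_\pm$ can be so chosen). Define $L(t,x,y)=h_-(y)$ for $y<-D$, $L=\hat L$ for $-D\le y\le D$, $L=h_+(y)$ for $y>D$. The Finsler metric. Let $F_0(t,x,v_1,v_2)=\sqrt{Av_1^2+Bv_2^2}$ and define $F(t,x,v_1,v_2)=v_1\,L(t,x,v_2/v_1)$ if $v_1>0$ and $F=F_0$ if $v_1\le0$. This $F$ is a $C^\infty$ Finsler metric on $T^2$, and the first return map $R:V_0\to V_0$ of its geodesic flow is well-defined. Entropy. $\omega$ is the area form on $V_0$ obtained by restricting $d\lambda$, where $\lambda=\sum_i\partial_{v_i}L_F\,dx_i$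 is the standard Liouville form (with $(x_1,x_2)=(t,x)$); $R$ preserves $\omega$. For a diffeomorphism $f$ of a surface $M$ the maximal Lyapunov exponent is $\lambda(x)=\limsup_{n\to\infty}\frac1n\log\|Df^n(x)\|$ (norms from a Riemannian metric; on $V_0$, the restriction of a Riemannian metric on $ST^2$), and if $f$ preserves an area form $\omega$ then its metric entropy is $h_\omega(f)=\int_M\lambda(x)\,d\mu_\omega$. *)

theory Defs
  imports "HOL-Analysis.Analysis"
begin

text \<open>
  The torus and the cylinder are treated through their universal covers: functions on
  \<open>T\<^sup>2 = \<real>\<^sup>2/\<int>\<^sup>2\<close> are \<open>\<int>\<^sup>2\<close>-periodic functions on \<open>real \<times> real\<close>, and a map of
  \<open>Z = S\<^sup>1 \<times> \<real>\<close> is given by a lift \<open>real \<times> real \<Rightarrow> real \<times> real\<close>.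
  A tangent vector of \<open>T\<^sup>2\<close> is a pair \<open>((t, x), (v\<^sub>1, v\<^sub>2))\<close>.
\<close>


section \<open>Smooth functions\<close>

text \<open>Meant for open \<open>U\<close>.\<close>

primrec Ck_on :: "nat \<Rightarrow> 'a::euclidean_space set \<Rightarrow> ('a \<Rightarrow> 'b::real_normed_vector) \<Rightarrow> bool" where
  "Ck_on 0 U f \<longleftrightarrow> continuous_on U f"
| "Ck_on (Suc k) U f \<longleftrightarrow>
     (\<forall>x\<in>U. f differentiable (at x)) \<and> (\<forall>w. Ck_on k U (\<lambda>x. frechet_derivative f (at x) w))"

definition smooth_on :: "'a::euclidean_space set \<Rightarrow> ('a \<Rightarrow> 'b::real_normed_vector) \<Rightarrow> bool" where
  "smooth_on U f \<longleftrightarrow> (\<forall>k. Ck_on k U f)"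


section \<open>Derivative growth, area forms and metric entropy\<close>

definition tangent_space :: "'a::euclidean_space set \<Rightarrow> 'a \<Rightarrow> 'a set" where
  "tangent_space S p =
     {w. \<exists>c :: real \<Rightarrow> 'a. (\<forall>s. c s \<in> S) \<and> c 0 = p \<and> (c has_vector_derivative w) (at 0)}"

text \<open>
  The operator norm of \<open>Df(p) : T\<^sub>pS \<rightarrow> T\<^bsub>f p\<^esub>S\<close> for the metric \<open>g\<close>. The Frechet derivative within
  \<open>S\<close> is unique only on \<open>T\<^sub>pS\<close>, and it is only evaluated there.
\<close>

definition deriv_norm ::
  "('a \<Rightarrow> 'a \<Rightarrow> 'a \<Rightarrow> real) \<Rightarrow> 'a set \<Rightarrow> ('a \<Rightarrow> 'a) \<Rightarrow> 'a::euclidean_space \<Rightarrow> real" where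
  "deriv_norm g S f p =
     Sup {sqrt (g (f p) (frechet_derivative f (at p within S) w) (frechet_derivative f (at p within S) w))
            / sqrt (g p w w) | w. w \<in> tangent_space S p \<and> w \<noteq> 0}"

definition max_lyapunov ::
  "('a \<Rightarrow> 'a \<Rightarrow> 'a \<Rightarrow> real) \<Rightarrow> 'a set \<Rightarrow> ('a \<Rightarrow> 'a) \<Rightarrow> 'a::euclidean_space \<Rightarrow> ereal" where
  "max_lyapunov g S f p = limsup (\<lambda>n. ereal (ln (deriv_norm g S (f ^^ n) p) / real n))"

text \<open>
  The measure \<open>|\<omega>|\<close> of a surface with global parametrization \<open>\<phi>\<close>, restricted to \<open>\<phi> ` U\<close>. For a
  surface covered by \<open>\<phi>\<close>, the set \<open>U\<close> is a fundamental domain.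
\<close>

definition area_measure ::
  "(real \<times> real \<Rightarrow> 'a::euclidean_space) \<Rightarrow> (real \<times> real) set \<Rightarrow> ('a \<Rightarrow> 'a \<Rightarrow> 'a \<Rightarrow> real) \<Rightarrow> 'a measure"
where
  "area_measure \<phi> U \<omega> =
     distr (density (restrict_space lborel U)
              (\<lambda>u. ennreal \<bar>\<omega> (\<phi> u) (frechet_derivative \<phi> (at u) (1, 0)) (frechet_derivative \<phi> (at u) (0, 1))\<bar>))
       borel \<phi>"

text \<open>
  A Bochner integral: it is \<open>0\<close> unless the exponent is integrable, so positivity of the entropy
  includes integrability.
\<close>

definition metric_entropy ::
  "'a::euclidean_space measure \<Rightarrow> ('a \<Rightarrow> 'a \<Rightarrow> 'a \<Rightarrow> real) \<Rightarrow> 'a set \<Rightarrow> ('a \<Rightarrow> 'a) \<Rightarrow> real" where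
  "metric_entropy \<mu> g S f = (LINT p:S|\<mu>. real_of_ereal (max_lyapunov g S f p))"

definition ext_deriv :: "('a \<Rightarrow> 'a \<Rightarrow> real) \<Rightarrow> 'a::euclidean_space \<Rightarrow> 'a \<Rightarrow> 'a \<Rightarrow> real" where
  "ext_deriv \<alpha> p \<xi> \<eta> =
     frechet_derivative (\<lambda>q. \<alpha> q \<eta>) (at p) \<xi> - frechet_derivative (\<lambda>q. \<alpha> q \<xi>) (at p) \<eta>"


section \<open>Twist maps and stochastic islands\<close>

text \<open>
  The covering \<open>\<real>\<^sup>2 \<rightarrow> Z\<close>, with \<open>S\<^sup>1\<close> realized as the unit circle. Equality, distance and topology
  of \<open>Z\<close> are those of \<open>range cyl\<close>.
\<close>

definition cyl :: "real \<times> real \<Rightarrow> complex \<times> real" where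
  "cyl p = (cis (2 * pi * fst p), snd p)"

definition jacobian :: "(real \<times> real \<Rightarrow> real \<times> real) \<Rightarrow> real \<times> real \<Rightarrow> real" where
  "jacobian f p =
     (let D = frechet_derivative f (at p)
      in fst (D (1, 0)) * snd (D (0, 1)) - fst (D (0, 1)) * snd (D (1, 0)))"

text \<open>
  The lift of an orientation- and end-preserving map commutes with the deck translation. Jacobian
  \<open>1\<close> expresses that \<open>f\<close> preserves the form \<open>dx \<and> dy\<close>, hence also orientation. Zero flux:
  the form \<open>y dx\<close> has the same integral over \<open>f(S\<^sup>1 \<times> {c})\<close> as over \<open>S\<^sup>1 \<times> {c}\<close>.
\<close>

definition twist_map :: "(real \<times> real \<Rightarrow> real \<times> real) \<Rightarrow> bool" where
  "twist_map f \<longleftrightarrow>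
     (\<forall>x y. f (x + 1, y) = f (x, y) + (1, 0)) \<and>
     bij f \<and> smooth_on UNIV f \<and> smooth_on UNIV (inv f) \<and>
     (\<forall>p. jacobian f p = 1) \<and>
     filterlim (\<lambda>p. snd (f p)) at_top (filtercomap snd at_top) \<and>
     filterlim (\<lambda>p. snd (f p)) at_bot (filtercomap snd at_bot) \<and>
     (\<forall>c. integral {0..1} (\<lambda>x. snd (f (x, c)) * fst (frechet_derivative f (at (x, c)) (1, 0))) = c) \<and>
     (\<exists>\<epsilon>>0. \<forall>p. fst (frechet_derivative f (at p) (0, 1)) \<ge> \<epsilon>)"

text \<open>\<open>l\<close> is an eigenvalue of the complexification of \<open>D\<close>, with eigenvector \<open>u + \<i> w\<close>.\<close>

definition complex_eigenvalue :: "('a::real_vector \<Rightarrow> 'a) \<Rightarrow> complex \<Rightarrow> bool" where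
  "complex_eigenvalue D l \<longleftrightarrow>
     (\<exists>u w. (u, w) \<noteq> (0, 0) \<and>
        D u = Re l *\<^sub>R u - Im l *\<^sub>R w \<and> D w = Im l *\<^sub>R u + Re l *\<^sub>R w)"

definition hyperbolic_periodic :: "(real \<times> real \<Rightarrow> real \<times> real) \<Rightarrow> real \<times> real \<Rightarrow> bool" where
  "hyperbolic_periodic f p \<longleftrightarrow>
     (\<exists>n>0. cyl ((f ^^ n) p) = cyl p \<and>
        (\<forall>l. complex_eigenvalue (frechet_derivative (f ^^ n) (at p)) l \<longrightarrow> cmod l \<noteq> 1))"

definition stable_manifold :: "(real \<times> real \<Rightarrow> real \<times> real) \<Rightarrow> real \<times> real \<Rightarrow> (complex \<times> real) set" where
  "stable_manifold f p = cyl ` {q. (\<lambda>n. dist (cyl ((f ^^ n) q)) (cyl ((f ^^ n) p))) \<longlonglongrightarrow> 0}"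

definition unstable_manifold :: "(real \<times> real \<Rightarrow> real \<times> real) \<Rightarrow> real \<times> real \<Rightarrow> (complex \<times> real) set" where
  "unstable_manifold f p = stable_manifold (inv f) p"

text \<open>
  The Lyapunov exponent is taken for the flat metric of \<open>Z\<close>, and the area of \<open>I\<close> is measured in the
  fundamental domain \<open>[0,1) \<times> \<real>\<close>.
\<close>

definition stochastic_island :: "(real \<times> real \<Rightarrow> real \<times> real) \<Rightarrow> (complex \<times> real) set \<Rightarrow> bool" where
  "stochastic_island f I \<longleftrightarrow>
     I \<subseteq> range cyl \<and> openin (top_of_set (range cyl)) I \<and> connected I \<and>
     (\<forall>p. cyl (f p) \<in> I \<longleftrightarrow> cyl p \<in> I) \<and>
     emeasure lborel (cyl -` I \<inter> {0..<1} \<times> UNIV) > 0 \<and>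
     (\<exists>\<C>. finite \<C> \<and>
        (\<forall>C\<in>\<C>. C \<subseteq> range cyl \<and> C homeomorphic sphere (0::complex) 1 \<and>
           C \<subseteq> (\<Union>p\<in>Collect (hyperbolic_periodic f). stable_manifold f p \<union> unstable_manifold f p)) \<and>
        (top_of_set (range cyl)) frontier_of I = \<Union>\<C>) \<and>
     (\<forall>p. cyl p \<in> I \<longrightarrow> max_lyapunov (\<lambda>_. inner) UNIV f p > 0)"


section \<open>The Hamiltonian and the Lagrangian\<close>

definition hamiltonian_curve :: "(real \<Rightarrow> real \<Rightarrow> real \<Rightarrow> real) \<Rightarrow> (real \<Rightarrow> real \<times> real) \<Rightarrow> bool" where
  "hamiltonian_curve H c \<longleftrightarrow>
     (\<forall>t\<in>{0..1}. (c has_vector_derivative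
        (deriv (\<lambda>y. H t (fst (c t)) y) (snd (c t)), - deriv (\<lambda>x. H t x (snd (c t))) (fst (c t))))
        (at t within {0..1}))"

text \<open>The equality with \<open>f\<close> is one of maps of \<open>Z\<close>.\<close>

definition time_one_map :: "(real \<Rightarrow> real \<Rightarrow> real \<Rightarrow> real) \<Rightarrow> (real \<times> real \<Rightarrow> real \<times> real) \<Rightarrow> bool" where
  "time_one_map H f \<longleftrightarrow>
     (\<forall>p. (\<exists>c. hamiltonian_curve H c \<and> c 0 = p) \<and>
          (\<forall>c. hamiltonian_curve H c \<and> c 0 = p \<longrightarrow> cyl (c 1) = cyl (f p)))"

definition strictly_convex :: "(real \<Rightarrow> real) \<Rightarrow> bool" where
  "strictly_convex h \<longleftrightarrow>
     (\<forall>a b u. a \<noteq> b \<and> 0 < u \<and> u < 1 \<longrightarrow> h ((1 - u) * a + u * b) < (1 - u) * h a + u * h b)"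

definition legendre :: "(real \<Rightarrow> real \<Rightarrow> real \<Rightarrow> real) \<Rightarrow> real \<Rightarrow> real \<Rightarrow> real \<Rightarrow> real" where
  "legendre H t x v = (let y = (THE y. deriv (H t x) y = v) in v * y - H t x y)"

definition glued_lagrangian ::
  "real \<Rightarrow> (real \<Rightarrow> real \<Rightarrow> real \<Rightarrow> real) \<Rightarrow> (real \<Rightarrow> real) \<Rightarrow> (real \<Rightarrow> real) \<Rightarrow> real \<Rightarrow> real \<Rightarrow> real \<Rightarrow> real"
where
  "glued_lagrangian D Lhat hm hp t x y =
     (if y < - D then hm y else if y \<le> D then Lhat t x y else hp y)"


section \<open>Finsler metrics on the torus and their geodesic flow\<close>

definition finsler_metric :: "(real \<times> real \<Rightarrow> real \<times> real \<Rightarrow> real) \<Rightarrow> bool" where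
  "finsler_metric F \<longleftrightarrow>
     (\<forall>q v (m::int) (n::int). F (q + (of_int m, of_int n)) v = F q v) \<and>
     (\<forall>q v. 0 \<le> F q v) \<and>
     smooth_on {p. snd p \<noteq> 0} (\<lambda>p. F (fst p) (snd p)) \<and>
     (\<forall>q v a. 0 < a \<longrightarrow> F q (a *\<^sub>R v) = a * F q v) \<and>
     (\<forall>q v w. v \<noteq> 0 \<and> w \<noteq> 0 \<longrightarrow>
        frechet_derivative (\<lambda>u. frechet_derivative (\<lambda>u'. (F q u')\<^sup>2 / 2) (at u) w) (at v) w > 0)"

definition finsler_of ::
  "real \<Rightarrow> real \<Rightarrow> (real \<Rightarrow> real \<Rightarrow> real \<Rightarrow> real) \<Rightarrow> real \<times> real \<Rightarrow> real \<times> real \<Rightarrow> real" where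
  "finsler_of A B L q v =
     (if fst v > 0 then fst v * L (fst q) (snd q) (snd v / fst v)
      else sqrt (A * (fst v)\<^sup>2 + B * (snd v)\<^sup>2))"

definition energy :: "('q \<Rightarrow> 'v \<Rightarrow> real) \<Rightarrow> 'q \<Rightarrow> 'v \<Rightarrow> real" where
  "energy F q v = (F q v)\<^sup>2 / 2"

definition euler_lagrange ::
  "('a \<Rightarrow> 'a \<Rightarrow> real) \<Rightarrow> (real \<Rightarrow> 'a::euclidean_space) \<Rightarrow> (real \<Rightarrow> 'a) \<Rightarrow> bool" where
  "euler_lagrange L \<gamma> \<gamma>' \<longleftrightarrow>
     (\<forall>s. (\<gamma> has_vector_derivative \<gamma>' s) (at s) \<and>
       (\<forall>w. ((\<lambda>r. frechet_derivative (L (\<gamma> r)) (at (\<gamma>' r)) w) has_real_derivative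
               frechet_derivative (\<lambda>q. L q (\<gamma>' s)) (at (\<gamma> s)) w) (at s)))"

definition unit_tangent :: "('q \<Rightarrow> 'v \<Rightarrow> real) \<Rightarrow> ('q \<times> 'v) set" where
  "unit_tangent F = {(q, v). F q v = 1}"

definition geodesic_flow ::
  "('a \<Rightarrow> 'a \<Rightarrow> real) \<Rightarrow> real \<Rightarrow> 'a \<times> 'a \<Rightarrow> 'a \<times> 'a::euclidean_space" where
  "geodesic_flow F s p =
     (THE z. \<exists>\<gamma> \<gamma>'. euler_lagrange (energy F) \<gamma> \<gamma>' \<and> (\<forall>r. (\<gamma> r, \<gamma>' r) \<in> unit_tangent F) \<and>
               (\<gamma> 0, \<gamma>' 0) = p \<and> z = (\<gamma> s, \<gamma>' s))"

text \<open>
  \<open>V0\<close> is the section with \<open>h \<in> S\<^sup>1\<close> lifted to \<open>h \<in> \<real>\<close> and \<open>t\<close> fixed to \<open>0\<close>; \<open>V0_full\<close> is its full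
  preimage in \<open>\<real>\<^sup>2 \<times> \<real>\<^sup>2\<close>. A lifted geodesic returns to \<open>V0\<close> in \<open>TT\<^sup>2\<close> when it meets \<open>V0_full\<close>, and the
  deck translation in \<open>t\<close> takes the point back to \<open>t = 0\<close>.
\<close>

definition V0 :: "(real \<times> real \<Rightarrow> real \<times> real \<Rightarrow> real) \<Rightarrow> ((real \<times> real) \<times> (real \<times> real)) set" where
  "V0 F = {(q, v) \<in> unit_tangent F. fst q = 0 \<and> fst v > 0}"

definition V0_full :: "(real \<times> real \<Rightarrow> real \<times> real \<Rightarrow> real) \<Rightarrow> ((real \<times> real) \<times> (real \<times> real)) set" where
  "V0_full F = {(q, v) \<in> unit_tangent F. fst q \<in> \<int> \<and> fst v > 0}"

definition return_time ::
  "(real \<times> real \<Rightarrow> real \<times> real \<Rightarrow> real) \<Rightarrow> (real \<times> real) \<times> (real \<times> real) \<Rightarrow> real" where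
  "return_time F p = (LEAST s. 0 < s \<and> geodesic_flow F s p \<in> V0_full F)"

definition return_map ::
  "(real \<times> real \<Rightarrow> real \<times> real \<Rightarrow> real) \<Rightarrow> (real \<times> real) \<times> (real \<times> real) \<Rightarrow> (real \<times> real) \<times> (real \<times> real)"
where
  "return_map F p =
     (let z = geodesic_flow F (return_time F p) p in ((0, snd (fst z)), snd z))"

definition liouville :: "('a \<Rightarrow> 'a \<Rightarrow> real) \<Rightarrow> 'a \<times> 'a \<Rightarrow> 'a \<times> 'a::euclidean_space \<Rightarrow> real" where
  "liouville F p \<xi> = (\<Sum>b\<in>Basis. frechet_derivative (energy F (fst p)) (at (snd p)) b * (fst \<xi> \<bullet> b))"

text \<open>Parametrization of \<open>V0\<close> by base point and slope \<open>y = v\<^sub>2/v\<^sub>1\<close>.\<close>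

definition V0_chart ::
  "(real \<times> real \<Rightarrow> real \<times> real \<Rightarrow> real) \<Rightarrow> real \<times> real \<Rightarrow> (real \<times> real) \<times> (real \<times> real)" where
  "V0_chart F = (\<lambda>(h, y). ((0, h), (1 / F (0, h) (1, y)) *\<^sub>R (1, y)))"

definition V0_measure ::
  "(real \<times> real \<Rightarrow> real \<times> real \<Rightarrow> real) \<Rightarrow> ((real \<times> real) \<times> (real \<times> real)) measure" where
  "V0_measure F = area_measure (V0_chart F) ({0..<1} \<times> UNIV) (ext_deriv (liouville F))"

text \<open>
  Riemannian metrics on \<open>ST\<^sup>2\<close>. Each one is the restriction to the tangent spaces of the hypersurface
  \<open>ST\<^sup>2 \<subseteq> TT\<^sup>2\<close> of a field of inner products on the ambient space, and it is such a field
  that \<open>g\<close> denotes.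
\<close>

definition riemannian_metric_unit_tangent ::
  "(real \<times> real \<Rightarrow> real \<times> real \<Rightarrow> real) \<Rightarrow>
   ((real \<times> real) \<times> (real \<times> real) \<Rightarrow> (real \<times> real) \<times> (real \<times> real) \<Rightarrow> (real \<times> real) \<times> (real \<times> real) \<Rightarrow> real)
   \<Rightarrow> bool" where
  "riemannian_metric_unit_tangent F g \<longleftrightarrow>
     (\<exists>U. open U \<and> unit_tangent F \<subseteq> U \<and> (\<forall>\<xi> \<eta>. smooth_on U (\<lambda>p. g p \<xi> \<eta>))) \<and>
     (\<forall>p\<in>unit_tangent F. bilinear (g p) \<and> (\<forall>\<xi> \<eta>. g p \<xi> \<eta> = g p \<eta> \<xi>) \<and> (\<forall>\<xi>. \<xi> \<noteq> 0 \<longrightarrow> 0 < g p \<xi> \<xi>)) \<and>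
     (\<forall>q v (m::int) (n::int). (q, v) \<in> unit_tangent F \<longrightarrow> g (q + (of_int m, of_int n), v) = g (q, v))"

end

theory Submission
  imports Defs "HOL-Real_Asymp.Real_Asymp"
begin

text \<open>
  On the half of the unit tangent bundle where \<open>v\<^sub>1 > 0\<close>, the metric \<open>F\<close> is determined by the function
  \<open>L(t, x, y) = F((t, x), (1, y))\<close> of the slope \<open>y = v\<^sub>2/v\<^sub>1\<close>, and its unit speed geodesics are the graphs of the
  solutions of the Euler-Lagrange equation of \<open>L\<close>, parametrized by arc length. Along such a geodesic
  \<open>t\<close> increases without bound, so the first return to the section \<open>t = 0\<close> happens at \<open>t = 1\<close>,
  and \<open>R\<close> is the time-one map of \<open>L\<close> in the coordinates \<open>(x, y)\<close> (lemma \<open>return_map_curve\<close>).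

  For slopes in \<open>[-D, D]\<close> the Lagrangian \<open>L\<close> is the Legendre transform of \<open>H\<close>. Beyond slope \<open>D\<close> both
  \<open>L\<close> and the Legendre transform of \<open>H\<close> do not depend on \<open>(t, x)\<close>, and the trajectories of both are the same
  lines of constant slope. So the Legendre transformation \<open>(x, p) \<mapsto> (x, \<partial>\<^sub>pH(0, x, p))\<close>, followed by
  the chart of the section, conjugates the time-one map of \<open>H\<close> to \<open>R\<close> on the whole cylinder
  (\<open>return_map_conjugate\<close>). On the universal cover this time-one map differs from \<open>f\<close> by an integer
  translation, hence has the same derivatives.

  Along an orbit the derivative of the conjugacy distorts lengths by a bounded factor, because it is continuous,
  invertible and periodic in \<open>x\<close>, and the orbit stays in a bounded range of slopes. Corresponding points therefore have the same maximal
  Lyapunov exponent (\<open>max_lyapunov_return_map\<close>). The exponent of \<open>f\<close> is nonnegative since \<open>f\<close> preserves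
  area, vanishes on the part where \<open>f\<close> is a shear, and is bounded on the remaining compact part.
  As \<open>|\<omega>| = \<partial>\<^sub>y\<^sup>2L dx dy\<close> in the chart, with \<open>\<partial>\<^sub>y\<^sup>2L > 0\<close> by the Finsler condition (\<open>lag_yy_pos\<close>),
  the entropy is the integral of an integrable, nonnegative function which is positive on the image of the
  stochastic island, a set with nonempty interior (\<open>metric_entropy_pos\<close>).

  The geodesic flow is defined by unique description, so both existence and uniqueness of geodesics have to be
  shown. Existence for all times comes from concatenating the Hamiltonian trajectories over unit time
  intervals. Uniqueness is Gronwall's inequality for position and momentum (\<open>trajectory_stability\<close>);
  the same estimate gives the continuity that makes the integer translation constant.
\<close>

type_synonym plane = "real \<times> real"

section \<open>Smooth functions and Gronwall's inequality\<close>

lemma smooth_on_has_derivative: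
  assumes "smooth_on U f" "x \<in> U"
  shows "(f has_derivative frechet_derivative f (at x)) (at x)"
proof -
  have "Ck_on (Suc 0) U f" using assms(1) by (simp only: smooth_on_def)
  then show ?thesis using assms(2) by (simp add: frechet_derivative_works)
qed

lemma smooth_on_frechet_derivative:
  assumes "smooth_on U f"
  shows "smooth_on U (\<lambda>x. frechet_derivative f (at x) w)"
  unfolding smooth_on_def
proof
  fix k
  have "Ck_on (Suc k) U f" using assms by (simp only: smooth_on_def)
  then show "Ck_on k U (\<lambda>x. frechet_derivative f (at x) w)" by simp
qed

lemma smooth_on_imp_continuous_on: "smooth_on U f \<Longrightarrow> continuous_on U f"
  unfolding smooth_on_def by (metis Ck_on.simps(1))

lemma linear_apply_Basis:
  assumes "linear (T :: 'a::euclidean_space \<Rightarrow> 'b::real_normed_vector)"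
  shows "T w = (\<Sum>b\<in>Basis. (w \<bullet> b) *\<^sub>R T b)"
proof -
  have "T w = T (\<Sum>b\<in>Basis. (w \<bullet> b) *\<^sub>R b)" by (simp add: euclidean_representation)
  also have "\<dots> = (\<Sum>b\<in>Basis. (w \<bullet> b) *\<^sub>R T b)"
    using assms by (simp add: linear_sum linear_scale)
  finally show ?thesis .
qed

lemma continuous_on_linear_apply:
  fixes T :: "'c::topological_space \<Rightarrow> 'a::euclidean_space \<Rightarrow> 'b::real_normed_vector"
  assumes "\<And>p. p \<in> S \<Longrightarrow> linear (T p)" "\<And>b. continuous_on S (\<lambda>p. T p b)" "continuous_on S w"
  shows "continuous_on S (\<lambda>p. T p (w p))"
proof -
  have "continuous_on S (\<lambda>p. \<Sum>b\<in>Basis. (w p \<bullet> b) *\<^sub>R T p b)"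
    by (intro continuous_intros assms)
  then show ?thesis
    by (rule continuous_on_eq) (metis assms(1) linear_apply_Basis)
qed

lemma smooth_on_linear: "smooth_on U f \<Longrightarrow> x \<in> U \<Longrightarrow> linear (frechet_derivative f (at x))"
  using smooth_on_has_derivative has_derivative_linear by blast

lemma continuous_on_frechet_derivative_apply:
  assumes f: "smooth_on U f" and h: "continuous_on S h" "h ` S \<subseteq> U" and w: "continuous_on S w"
  shows "continuous_on S (\<lambda>p. frechet_derivative f (at (h p)) (w p))"
proof (rule continuous_on_linear_apply[OF _ _ w])
  fix b
  have "continuous_on U (\<lambda>x. frechet_derivative f (at x) b)"
    by (intro smooth_on_imp_continuous_on smooth_on_frechet_derivative f)
  then show "continuous_on S (\<lambda>p. frechet_derivative f (at (h p)) b)"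
    using continuous_on_compose2 h by blast
qed (use h f smooth_on_linear in blast)

text \<open>The weight \<open>exp (- C s)\<close> turns the differential inequality into monotonicity.\<close>

lemma gronwall:
  fixes e :: "real \<Rightarrow> real"
  assumes "a \<le> b"
    and "\<And>s. a \<le> s \<Longrightarrow> s \<le> b \<Longrightarrow> (e has_real_derivative e' s) (at s)"
    and "\<And>s. a \<le> s \<Longrightarrow> s \<le> b \<Longrightarrow> e' s \<le> C * e s"
  shows "e b \<le> exp (C * (b - a)) * e a"
proof -
  have "e b * exp (- (C * b)) \<le> e a * exp (- (C * a))"
  proof (rule DERIV_nonpos_imp_nonincreasing[OF assms(1), of "\<lambda>s. e s * exp (- (C * s))"])
    fix s assume s: "a \<le> s" "s \<le> b"
    have "((\<lambda>s. e s * exp (- (C * s))) has_real_derivative (e' s - C * e s) * exp (- (C * s))) (at s)"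
      by (auto intro!: derivative_eq_intros assms(2) s simp: algebra_simps)
    moreover have "(e' s - C * e s) * exp (- (C * s)) \<le> 0"
      using assms(3)[OF s] by (simp add: mult_nonpos_nonneg)
    ultimately show "\<exists>y. ((\<lambda>s. e s * exp (- (C * s))) has_real_derivative y) (at s) \<and> y \<le> 0" by blast
  qed
  then have "e b * exp (- (C * b)) * exp (C * b) \<le> e a * exp (- (C * a)) * exp (C * b)"
    by simp
  then show ?thesis
    by (simp add: mult.assoc flip: exp_add) (simp add: algebra_simps)
qed

section \<open>Growth of planar derivative cocycles\<close>

text \<open>
  A matrix norm that depends continuously on the entries. This makes exponents defined with it
  visibly measurable, unlike those defined with a supremum over a tangent space.
\<close>

definition colsum :: "(plane \<Rightarrow> 'b::real_normed_vector) \<Rightarrow> real" where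
  "colsum T = norm (T (1, 0)) + norm (T (0, 1))"

definition det2 :: "(plane \<Rightarrow> plane) \<Rightarrow> real" where
  "det2 T = fst (T (1, 0)) * snd (T (0, 1)) - fst (T (0, 1)) * snd (T (1, 0))"

lemma plane_linear_expand:
  assumes "linear (T :: plane \<Rightarrow> 'b::real_normed_vector)"
  shows "T u = fst u *\<^sub>R T (1, 0) + snd u *\<^sub>R T (0, 1)"
proof -
  have "T u = T (fst u *\<^sub>R (1, 0) + snd u *\<^sub>R (0, 1))" by (simp add: prod_eq_iff)
  then show ?thesis using assms by (simp only: linear_add linear_scale)
qed

lemma norm_le_colsum:
  assumes "linear T"
  shows "norm (T u) \<le> colsum T * norm u"
proof -
  have "norm (T u) \<le> \<bar>fst u\<bar> * norm (T (1, 0)) + \<bar>snd u\<bar> * norm (T (0, 1))"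
    by (subst plane_linear_expand[OF assms]) (metis norm_scaleR norm_triangle_ineq)
  also have "\<dots> \<le> norm u * norm (T (1, 0)) + norm u * norm (T (0, 1))"
    using norm_fst_le[of "fst u" "snd u"] norm_snd_le[of "snd u" "fst u"]
    by (intro add_mono mult_right_mono) auto
  finally show ?thesis by (simp add: colsum_def algebra_simps)
qed

lemma det2_comp:
  assumes "linear S" "linear T"
  shows "det2 (S \<circ> T) = det2 S * det2 T"
proof -
  obtain a b c d where T: "T (1, 0) = (a, b)" "T (0, 1) = (c, d)" by (meson surj_pair)
  obtain a' b' c' d' where S: "S (1, 0) = (a', b')" "S (0, 1) = (c', d')" by (meson surj_pair)
  have "S (a, b) = (a * a' + b * c', a * b' + b * d')" "S (c, d) = (c * a' + d * c', c * b' + d * d')"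
    using plane_linear_expand[OF assms(1)] S by (simp_all add: scaleR_prod_def)
  then show ?thesis using T S by (simp add: det2_def algebra_simps)
qed

text \<open>A parallelogram of area \<open>1\<close> cannot have two short sides.\<close>

lemma one_le_colsum:
  assumes "det2 T = 1"
  shows "1 \<le> colsum T"
proof -
  obtain a b c d where T: "T (1, 0) = (a, b)" "T (0, 1) = (c, d)" by (meson surj_pair)
  define m n where "m = norm (a, b)" and "n = norm (c, d)"
  have bds: "\<bar>a\<bar> \<le> m" "\<bar>b\<bar> \<le> m" "\<bar>c\<bar> \<le> n" "\<bar>d\<bar> \<le> n"
    using norm_fst_le[of a b] norm_snd_le[of b a] norm_fst_le[of c d] norm_snd_le[of d c]
    by (auto simp: m_def n_def)
  have "1 = a * d - c * b" using assms T by (simp add: det2_def)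
  also have "\<dots> \<le> \<bar>a\<bar> * \<bar>d\<bar> + \<bar>c\<bar> * \<bar>b\<bar>"
    unfolding abs_mult[symmetric] by linarith
  also have "\<dots> \<le> m * n + n * m"
    using bds by (intro add_mono mult_mono) auto
  also have "\<dots> \<le> (m + n) * (m + n)" by (simp add: algebra_simps)
  finally have "1 \<le> (m + n)\<^sup>2" by (simp add: power2_eq_square)
  moreover have "0 \<le> m + n" using bds by linarith
  ultimately have "1 \<le> m + n" by (metis abs_le_square_iff abs_of_nonneg abs_one one_power2)
  then show ?thesis using T by (simp add: colsum_def m_def n_def)
qed

definition growth_exponent :: "(plane \<Rightarrow> plane) \<Rightarrow> plane \<Rightarrow> ereal" where
  "growth_exponent f p = limsup (\<lambda>n. ereal (ln (colsum (frechet_derivative (f ^^ n) (at p))) / real n))"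

text \<open>
  Here \<open>A\<close> and \<open>B\<close> are frames of the tangent planes at \<open>p\<close> and \<open>f p\<close>, and \<open>T\<close> is the matrix of the
  derivative in these frames. The constants only measure how far the frames are from orthonormal.
\<close>

lemma deriv_norm_bounds:
  fixes A B :: "plane \<Rightarrow> 'a::euclidean_space" and T :: "plane \<Rightarrow> plane"
  assumes tan: "tangent_space S p = range A" and lin: "linear A" "linear T"
    and DA: "\<And>u. frechet_derivative f (at p within S) (A u) = B (T u)"
    and c: "0 < c"
    and gA: "\<And>u. c * norm u \<le> sqrt (g p (A u) (A u))" "\<And>u. sqrt (g p (A u) (A u)) \<le> C * norm u"
    and gB: "\<And>u. c * norm u \<le> sqrt (g (f p) (B u) (B u))" "\<And>u. sqrt (g (f p) (B u) (B u)) \<le> C * norm u"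
  shows "c / (2 * C) * colsum T \<le> deriv_norm g S f p" "deriv_norm g S f p \<le> C / c * colsum T"
proof -
  have "c * norm (1::real, 0::real) \<le> C * norm (1::real, 0::real)"
    by (rule order_trans[OF gA])
  then have C: "c \<le> C" "0 < C" using c by auto
  define q where "q u = sqrt (g (f p) (B (T u)) (B (T u))) / sqrt (g p (A u) (A u))" for u
  have A0: "A u \<noteq> 0" if "u \<noteq> 0" for u
  proof
    assume "A u = 0"
    have "A 0 = 0" using lin(1) linear_0 by blast
    then have "A u = A 0" using \<open>A u = 0\<close> by simp
    have "c * norm u \<le> sqrt (g p (A u) (A u))" by (rule gA(1))
    also have "\<dots> = sqrt (g p (A 0) (A 0))" using \<open>A u = A 0\<close> by presburger
    also have "\<dots> \<le> C * norm (0 :: plane)" by (rule gA(2))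
    finally have "c * norm u \<le> C * norm (0 :: plane)" .
    then show False using that c by (simp add: mult_le_0_iff)
  qed
  have A00: "A 0 = 0" using lin(1) linear_0 by blast
  have eq: "{sqrt (g (f p) (frechet_derivative f (at p within S) w) (frechet_derivative f (at p within S) w))
            / sqrt (g p w w) | w. w \<in> tangent_space S p \<and> w \<noteq> 0} = q ` {u. u \<noteq> 0}"
  proof -
    define h where "h w = sqrt (g (f p) (frechet_derivative f (at p within S) w) (frechet_derivative f (at p within S) w))
            / sqrt (g p w w)" for w
    have "h (A u) = q u" for u
      by (simp only: DA q_def h_def)
    moreover have "A u \<noteq> 0 \<longleftrightarrow> u \<noteq> 0" for u using A0 A00 by blast
    then have "{h w | w. w \<in> range A \<and> w \<noteq> 0} = (\<lambda>u. h (A u)) ` {u. u \<noteq> 0}" by blast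
    ultimately show ?thesis unfolding tan h_def by simp
  qed
  have up: "q u \<le> C / c * colsum T" if "u \<noteq> 0" for u
  proof -
    have pos: "0 < c * norm u" using that c by simp
    have "sqrt (g (f p) (B (T u)) (B (T u))) \<le> C * (colsum T * norm u)"
      by (rule order_trans[OF gB(2) mult_left_mono[OF norm_le_colsum[OF lin(2)] less_imp_le[OF C(2)]]])
    moreover have "0 \<le> C * (colsum T * norm u)" using C by (simp add: colsum_def)
    ultimately have "q u \<le> (C * (colsum T * norm u)) / (c * norm u)"
      unfolding q_def using gA(1)[of u] pos by (intro frac_le) auto
    also have "\<dots> = C / c * colsum T" using that c by simp
    finally show ?thesis .
  qed
  have low: "c / C * norm (T u) \<le> q u" if "norm u = 1" for u
  proof -
    have A1: "0 < sqrt (g p (A u) (A u))" "sqrt (g p (A u) (A u)) \<le> C"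
      using gA[of u] that c unfolding that mult_1_right by linarith+
    have "0 \<le> sqrt (g (f p) (B (T u)) (B (T u)))"
      by (rule order_trans[OF _ gB(1)]) (use c in simp)
    then have "c * norm (T u) / C \<le> q u"
      unfolding q_def by (rule frac_le[OF _ gB(1) A1])
    then show ?thesis by simp
  qed
  have bdd: "bdd_above (q ` {u. u \<noteq> 0})" using up by (intro bdd_aboveI2) auto
  show "deriv_norm g S f p \<le> C / c * colsum T"
    unfolding deriv_norm_def eq
  proof (rule cSup_least)
    have "(1, 0) \<in> {u :: plane. u \<noteq> 0}" by (simp add: zero_prod_def)
    then show "q ` {u. u \<noteq> 0} \<noteq> {}" by blast
  qed (use up in auto)
  have le: "q u \<le> deriv_norm g S f p" if "u \<noteq> 0" for u
    unfolding deriv_norm_def eq using bdd that by (intro cSup_upper) auto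
  have "c / C * norm (T (1, 0)) \<le> deriv_norm g S f p" "c / C * norm (T (0, 1)) \<le> deriv_norm g S f p"
    by (intro order_trans[OF low le]; simp add: zero_prod_def)+
  then have "c / C * norm (T (1, 0)) + c / C * norm (T (0, 1)) \<le> 2 * deriv_norm g S f p" by linarith
  moreover have "c / (2 * C) * colsum T = (c / C * norm (T (1, 0)) + c / C * norm (T (0, 1))) / 2"
    using C by (simp add: colsum_def field_simps)
  moreover have "s / 2 \<le> d" if "s \<le> 2 * d" for s d :: real using that by simp
  ultimately show "c / (2 * C) * colsum T \<le> deriv_norm g S f p" by metis
qed

text \<open>A bounded factor changes the exponential rate by \<open>O(1/n)\<close>.\<close>

lemma limsup_ln_rate_cong:
  fixes a b :: "nat \<Rightarrow> real"
  assumes c: "0 < c" and a: "\<And>n. 0 < a n"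
    and b: "\<And>n. c * a n \<le> b n" "\<And>n. b n \<le> C * a n"
  shows "limsup (\<lambda>n. ereal (ln (b n) / real n)) = limsup (\<lambda>n. ereal (ln (a n) / real n))"
proof -
  have bpos: "0 < b n" for n using b(1)[of n] a[of n] c by (smt (verit) mult_pos_pos)
  have C: "0 < C" using bpos[of 0] b(2)[of 0] a[of 0] by (smt (verit) mult_nonpos_nonneg)
  define K where "K = \<bar>ln c\<bar> + \<bar>ln C\<bar>"
  have K: "\<bar>ln (b n) - ln (a n)\<bar> \<le> K" for n
  proof -
    have "ln (c * a n) \<le> ln (b n)" "ln (b n) \<le> ln (C * a n)"
      using b[of n] bpos[of n] a[of n] c C by simp_all
    then show ?thesis using a[of n] c C by (simp add: ln_mult K_def)
  qed
  have "(\<lambda>n. (ln (b n) - ln (a n)) / real n) \<longlonglongrightarrow> 0"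
  proof (rule Lim_null_comparison)
    show "\<forall>\<^sub>F n in sequentially. norm ((ln (b n) - ln (a n)) / real n) \<le> K * (1 / real n)"
      using K by (auto simp: divide_right_mono)
    show "(\<lambda>n. K * (1 / real n)) \<longlonglongrightarrow> 0"
      using tendsto_mult_right_zero[OF lim_1_over_n] by simp
  qed
  then have "(\<lambda>n. ereal ((ln (b n) - ln (a n)) / real n)) \<longlonglongrightarrow> 0"
    by (simp add: zero_ereal_def)
  then have "limsup (\<lambda>n. ereal ((ln (b n) - ln (a n)) / real n) + ereal (ln (a n) / real n))
      = 0 + limsup (\<lambda>n. ereal (ln (a n) / real n))"
    by (intro ereal_limsup_lim_add) auto
  moreover have "ereal ((ln (b n) - ln (a n)) / real n) + ereal (ln (a n) / real n) = ereal (ln (b n) / real n)" for n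
    by (simp add: diff_divide_distrib)
  ultimately show ?thesis by simp
qed

lemma frechet_derivative_worksI:
  "(f has_derivative f') (at p) \<Longrightarrow> (f has_derivative frechet_derivative f (at p)) (at p)"
  unfolding frechet_derivative_works[symmetric] differentiable_def by blast

text \<open>Lifts to the universal cover of area-preserving maps of the cylinder.\<close>

locale periodic_area_map =
  fixes f :: "plane \<Rightarrow> plane"
  assumes periodic: "\<And>x y. f (x + 1, y) = f (x, y) + (1, 0)"
    and smooth: "smooth_on UNIV f"
    and jac: "\<And>p. jacobian f p = 1"
begin

abbreviation Df where "Df n p \<equiv> frechet_derivative (f ^^ n) (at p)"

lemma periodic_int: "f (x + of_int k, y) = f (x, y) + (of_int k, 0)"
proof (induction k rule: int_induct[of _ 0])
  case (step1 i)
  then show ?case using periodic[of "x + of_int i" y] by (simp add: algebra_simps prod_eq_iff)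
next
  case (step2 i)
  then show ?case using periodic[of "x + of_int (i - 1)" y] by (simp add: algebra_simps prod_eq_iff)
qed (simp add: prod_eq_iff)

lemma iterate_has_derivative:
  "(f ^^ n has_derivative Df n p) (at p)"
  and frechet_iterate_Suc: "Df (Suc n) p
     = frechet_derivative f (at ((f ^^ n) p)) \<circ> Df n p"
proof -
  have fd: "(f has_derivative frechet_derivative f (at q)) (at q)" for q
    using smooth_on_has_derivative[OF smooth] by simp
  have main: "(f ^^ n has_derivative Df n p) (at p)" for n
  proof (induction n)
    case 0
    show ?case unfolding funpow.simps(1) frechet_derivative_at[OF has_derivative_id, symmetric]
      by (rule has_derivative_id)
  next
    case (Suc n)
    have "(f \<circ> f ^^ n has_derivative frechet_derivative f (at ((f ^^ n) p)) \<circ> Df n p) (at p)"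
      by (rule diff_chain_at[OF Suc fd])
    then show ?case unfolding funpow.simps(2) by (rule frechet_derivative_worksI)
  qed
  show "(f ^^ n has_derivative Df n p) (at p)" by (rule main)
  have "(f \<circ> f ^^ n has_derivative frechet_derivative f (at ((f ^^ n) p)) \<circ> Df n p) (at p)"
    by (rule diff_chain_at[OF main fd])
  then show "Df (Suc n) p
     = frechet_derivative f (at ((f ^^ n) p)) \<circ> Df n p"
    unfolding funpow.simps(2) by (rule frechet_derivative_at[symmetric])
qed

lemma linear_frechet_iterate: "linear (Df n p)"
  by (rule has_derivative_linear[OF iterate_has_derivative])

lemma frechet_iterate_0: "Df 0 p = id"
  unfolding funpow.simps(1) by (rule frechet_derivative_at[OF has_derivative_id, symmetric])

lemma continuous_on_iterate: "continuous_on UNIV (f ^^ n)"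
  by (intro continuous_at_imp_continuous_on ballI has_derivative_continuous[OF iterate_has_derivative])

lemma continuous_on_frechet_iterate:
  "continuous_on UNIV (\<lambda>p. Df n p w)"
proof (induction n)
  case 0
  then show ?case unfolding frechet_iterate_0 by simp
next
  case (Suc n)
  show ?case unfolding frechet_iterate_Suc comp_def
    by (rule continuous_on_frechet_derivative_apply[OF smooth continuous_on_iterate _ Suc]) simp
qed

lemma det2_iterate: "det2 (Df n p) = 1"
proof (induction n)
  case 0
  then show ?case unfolding frechet_iterate_0 by (simp add: det2_def)
next
  case (Suc n)
  have "det2 (frechet_derivative f (at q)) = 1" for q
    using jac[of q] by (simp add: jacobian_def det2_def Let_def)
  then show ?case unfolding frechet_iterate_Suc
    by (subst det2_comp[OF smooth_on_linear[OF smooth UNIV_I] linear_frechet_iterate])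
      (simp add: Suc \<open>\<And>q. det2 (frechet_derivative f (at q)) = 1\<close>)
qed

lemma colsum_iterate_ge_1: "1 \<le> colsum (Df n p)"
  by (rule one_le_colsum[OF det2_iterate])

lemma growth_exponent_nonneg: "0 \<le> growth_exponent f p"
proof -
  have "0 \<le> ln (colsum (Df n p)) / real n" for n
    by (intro divide_nonneg_nonneg ln_ge_zero colsum_iterate_ge_1 of_nat_0_le_iff)
  then have "limsup (\<lambda>n. ereal 0) \<le> growth_exponent f p" unfolding growth_exponent_def
    by (intro Limsup_mono always_eventually allI) (simp only: ereal_less_eq)
  then show ?thesis by (simp add: Limsup_const zero_ereal_def)
qed

lemma borel_measurable_growth_exponent: "growth_exponent f \<in> borel_measurable borel"
proof -
  define c where "c n p = colsum (Df n p)" for n p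
  have "continuous_on UNIV (c n)" for n
    unfolding c_def colsum_def by (intro continuous_intros continuous_on_frechet_iterate)
  then have c: "c n \<in> borel_measurable borel" for n
    by (rule borel_measurable_continuous_onI)
  have "growth_exponent f = (\<lambda>p. limsup (\<lambda>n. ereal (ln (c n p) / real n)))"
    by (simp add: fun_eq_iff growth_exponent_def c_def)
  also have "\<dots> \<in> borel_measurable borel"
    by (intro borel_measurable_limsup borel_measurable_ereal borel_measurable_divide
        borel_measurable_const borel_measurable_ln c)
  finally show ?thesis .
qed

lemma frechet_derivative_periodic:
  "frechet_derivative f (at (x + of_int k, y)) = frechet_derivative f (at (x, y))"
proof -
  have "(f has_derivative frechet_derivative f (at (x + of_int k, y))) (at ((x, y) + (of_int k, 0)))"
    using smooth_on_has_derivative[OF smooth] by simp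
  then have "((\<lambda>p. f (p + (of_int k, 0)) - (of_int k, 0)) has_derivative frechet_derivative f (at (x + of_int k, y))) (at (x, y))"
    by (auto intro!: derivative_eq_intros has_derivative_compose[of "\<lambda>p. p + (of_int k, 0)" _ _ _ f])
  moreover have "(\<lambda>p. f (p + (of_int k, 0)) - (of_int k, 0)) = f"
    using periodic_int by (auto simp: fun_eq_iff)
  ultimately show ?thesis using frechet_derivative_at by metis
qed

text \<open>The chain rule bounds the growth by the maximum of \<open>Df\<close> over the region that contains the orbit,
  which is compact modulo the translation.\<close>

lemma growth_exponent_le:
  "\<exists>C\<ge>0. \<forall>p. (\<forall>n. \<bar>snd ((f ^^ n) p)\<bar> \<le> R) \<longrightarrow> growth_exponent f p \<le> ereal C"
proof -
  define c where "c p = colsum (frechet_derivative f (at p))" for p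
  have "continuous_on UNIV c" unfolding c_def colsum_def
    using continuous_on_frechet_iterate[of 1] by (intro continuous_intros) simp_all
  then have "compact (c ` ({0..1} \<times> {-R..R}))"
    by (intro compact_continuous_image compact_Times) (auto intro: continuous_on_subset)
  then obtain b where b: "\<And>p. p \<in> {0..1} \<times> {-R..R} \<Longrightarrow> \<bar>c p\<bar> \<le> b"
    using compact_imp_bounded bounded_real by (metis image_eqI)
  have cb: "c p \<le> max 1 b" if "\<bar>snd p\<bar> \<le> R" for p
  proof -
    have "c p = c (frac (fst p), snd p)"
      using frechet_derivative_periodic[of "frac (fst p)" "\<lfloor>fst p\<rfloor>" "snd p"]
      by (simp add: c_def frac_def)
    also have "\<dots> \<le> b" using b[of "(frac (fst p), snd p)"] that frac_lt_1[of "fst p"] frac_ge_0[of "fst p"]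
      by (auto simp: abs_le_iff)
    finally show ?thesis by simp
  qed
  define m where "m = max 1 b"
  have "1 \<le> m" by (simp add: m_def)
  have "growth_exponent f p \<le> ereal (ln 2 + ln m)" if p: "\<And>n. \<bar>snd ((f ^^ n) p)\<bar> \<le> R" for p
  proof -
    have it: "norm (Df n p w) \<le> m ^ n * norm w" for n w
    proof (induction n)
      case 0
      then show ?case unfolding frechet_iterate_0 by simp
    next
      case (Suc n)
      have "norm (Df (Suc n) p w)
          \<le> c ((f ^^ n) p) * norm (Df n p w)"
        unfolding frechet_iterate_Suc comp_def c_def
        by (rule norm_le_colsum[OF smooth_on_linear[OF smooth]]) simp
      also have "\<dots> \<le> m * (m ^ n * norm w)"
        using Suc cb[OF p] \<open>1 \<le> m\<close> by (intro mult_mono) (auto simp: m_def)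
      finally show ?case by (simp only: power_Suc mult.assoc)
    qed
    have cs: "colsum (Df n p) \<le> 2 * m ^ n" for n
      using it[of n "(1, 0)"] it[of n "(0, 1)"] by (simp add: colsum_def)
    have "ln (colsum (Df n p)) / real n \<le> ln 2 + ln m" if "n > 0" for n
    proof -
      have "ln (colsum (Df n p)) \<le> ln (2 * m ^ n)"
        using cs[of n] colsum_iterate_ge_1[of n p] \<open>1 \<le> m\<close> by (intro ln_mono) auto
      also have "\<dots> = ln 2 + real n * ln m" using \<open>1 \<le> m\<close> by (simp add: ln_mult ln_realpow)
      also have "\<dots> \<le> real n * (ln 2 + ln m)" using that by (simp add: algebra_simps)
      finally show ?thesis using that by (simp add: divide_le_eq mult.commute)
    qed
    then have "growth_exponent f p \<le> limsup (\<lambda>n. ereal (ln 2 + ln m))"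
      unfolding growth_exponent_def
      by (intro Limsup_mono eventually_mono[OF eventually_gt_at_top[of 0]]) auto
    then show ?thesis by (simp add: Limsup_const)
  qed
  then show ?thesis using \<open>1 \<le> m\<close> by (intro exI[of _ "ln 2 + ln m"]) auto
qed

text \<open>The derivatives of the iterates of a shear grow only linearly.\<close>

lemma growth_exponent_shear:
  assumes "open U" "p \<in> U" "f ` U \<subseteq> U" and shear: "\<And>q. q \<in> U \<Longrightarrow> f q = (fst q + snd q + k, snd q)"
  shows "growth_exponent f p = 0"
proof (rule antisym[OF _ growth_exponent_nonneg])
  have it: "(f ^^ n) q = (fst q + real n * (snd q + k), snd q) \<and> (f ^^ n) q \<in> U" if "q \<in> U" for n q
  proof (induction n)
    case (Suc n)
    then show ?case using shear[of "(f ^^ n) q"] assms(3) by (auto simp: algebra_simps)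
  qed (use that in auto)
  have "Df n p = (\<lambda>w. (fst w + real n * snd w, snd w))" for n
  proof -
    have "((\<lambda>q. (fst q + real n * (snd q + k), snd q)) has_derivative (\<lambda>w. (fst w + real n * snd w, snd w))) (at p)"
      by (auto intro!: derivative_eq_intros)
    then have "(f ^^ n has_derivative (\<lambda>w. (fst w + real n * snd w, snd w))) (at p)"
      by (rule has_derivative_transform_within_open[OF _ assms(1,2)]) (use it in auto)
    then show ?thesis using frechet_derivative_at by metis
  qed
  then have cs: "colsum (Df n p) \<le> real n + 2" for n
    using norm_Pair_le[of "real n" "1::real"] by (simp add: colsum_def)
  have "growth_exponent f p \<le> limsup (\<lambda>n. ereal (ln (real n + 2) / real n))"
    unfolding growth_exponent_def
  proof (intro Limsup_mono always_eventually allI)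
    fix n show "ereal (ln (colsum (Df n p)) / real n) \<le> ereal (ln (real n + 2) / real n)"
      using cs[of n] colsum_iterate_ge_1[of n p] by (auto intro!: divide_right_mono)
  qed
  also have "(\<lambda>n. ereal (ln (real n + 2) / real n)) \<longlonglongrightarrow> ereal 0"
    unfolding lim_ereal by real_asymp
  then have "limsup (\<lambda>n. ereal (ln (real n + 2) / real n)) = 0"
    by (simp add: lim_imp_Limsup zero_ereal_def)
  finally show "growth_exponent f p \<le> 0" .
qed

lemma max_lyapunov_eq_growth_exponent:
  fixes S :: "'a::euclidean_space set"
  assumes c: "0 < c"
    and bd: "\<And>n. c / (2 * C) * colsum (Df n p) \<le> deriv_norm g S (R ^^ n) q"
      "\<And>n. deriv_norm g S (R ^^ n) q \<le> C / c * colsum (Df n p)" "0 < C"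
  shows "max_lyapunov g S R q = growth_exponent f p"
  unfolding max_lyapunov_def growth_exponent_def
  using c bd order_less_le_trans[OF zero_less_one colsum_iterate_ge_1]
  by (intro limsup_ln_rate_cong[of "c / (2 * C)" _ _ "C / c"]) auto

lemma max_lyapunov_flat: "max_lyapunov (\<lambda>_. inner) UNIV f p = growth_exponent f p"
proof -
  have "w \<in> tangent_space UNIV p" for w :: "plane"
    unfolding tangent_space_def
    by (auto intro!: exI[of _ "\<lambda>s. p + s *\<^sub>R w"] derivative_eq_intros simp: has_vector_derivative_def)
  then have tan: "tangent_space UNIV p = range (\<lambda>u :: plane. u)" by auto
  note b = deriv_norm_bounds[OF tan, where B = "\<lambda>u. u" and c = 1 and C = 1 and g = "\<lambda>_. inner"
      and f = "f ^^ n" and T = "Df n p" for n]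
  have *: "sqrt (u \<bullet> u) = norm u" for u :: "plane" by (simp add: norm_eq_sqrt_inner)
  show ?thesis
    by (rule max_lyapunov_eq_growth_exponent[of 1 1])
      (use b linear_frechet_iterate in \<open>auto simp: * linear_ident\<close>)
qed

end

section \<open>Calculus of a Finsler metric on the torus\<close>

lemma frac_shift: "\<exists>k::int. x = frac x + of_int k \<and> 0 \<le> frac x \<and> frac x \<le> (1::real)"
  by (rule exI[of _ "\<lfloor>x\<rfloor>"]) (auto simp: frac_def less_imp_le frac_lt_1[unfolded frac_def])

lemma periodic_bounded:
  fixes \<phi> :: "real \<Rightarrow> real \<Rightarrow> real \<Rightarrow> real"
  assumes cont: "continuous_on UNIV (\<lambda>(t, x, y). \<phi> t x y)"
    and per: "\<And>t x y (m::int) (n::int). \<phi> (t + of_int m) (x + of_int n) y = \<phi> t x y"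
  shows "\<exists>C\<ge>0. \<forall>t x y. \<bar>y\<bar> \<le> R \<longrightarrow> \<bar>\<phi> t x y\<bar> \<le> C"
proof -
  have "compact ((\<lambda>(t, x, y). \<phi> t x y) ` ({0..1} \<times> {0..1} \<times> {-R..R}))"
    by (intro compact_continuous_image compact_Times continuous_on_subset[OF cont]) auto
  then obtain b where b: "\<And>p. p \<in> {0..1} \<times> {0..1} \<times> {-R..R} \<Longrightarrow> \<bar>case p of (t, x, y) \<Rightarrow> \<phi> t x y\<bar> \<le> b"
    using compact_imp_bounded bounded_real by (metis image_eqI)
  have "\<bar>\<phi> t x y\<bar> \<le> max 0 b" if "\<bar>y\<bar> \<le> R" for t x y
  proof -
    obtain m n :: int where t: "t = frac t + of_int m" "0 \<le> frac t" "frac t \<le> 1"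
      and x: "x = frac x + of_int n" "0 \<le> frac x" "frac x \<le> 1"
      using frac_shift by metis
    have "\<phi> t x y = \<phi> (frac t) (frac x) y" using per[of "frac t" m "frac x" n y] t x by simp
    then show ?thesis using b[of "(frac t, frac x, y)"] t x that by (auto simp: abs_le_iff)
  qed
  then show ?thesis by (intro exI[of _ "max 0 b"]) auto
qed

locale finsler_torus =
  fixes F :: "plane \<Rightarrow> plane \<Rightarrow> real"
  assumes finsler: "finsler_metric F"
begin

abbreviation total :: "plane \<times> plane \<Rightarrow> real" where
  "total \<equiv> \<lambda>p. F (fst p) (snd p)"

text \<open>
  Derivatives are taken on the total space of the tangent bundle, in an arbitrary direction \<open>(w, u)\<close>:
  this gives the base, fibre and mixed derivatives of \<open>F\<close> as values of one smooth function.
\<close>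

definition dF where "dF p w = frechet_derivative total (at p) w"

definition ddF where "ddF p w w' = frechet_derivative (\<lambda>p. dF p w) (at p) w'"

lemma periodic: "F (q + (of_int m, of_int n)) v = F q v" for m n :: int
  using finsler unfolding finsler_metric_def by blast

lemma homogeneous: "0 < a \<Longrightarrow> F q (a *\<^sub>R v) = a * F q v"
  using finsler unfolding finsler_metric_def by blast

lemma smooth_total: "smooth_on {p. snd p \<noteq> 0} total"
  using finsler unfolding finsler_metric_def by blast

lemma smooth_dF: "smooth_on {p. snd p \<noteq> 0} (\<lambda>p. dF p w)"
  unfolding dF_def by (rule smooth_on_frechet_derivative[OF smooth_total])

lemma smooth_ddF: "smooth_on {p. snd p \<noteq> 0} (\<lambda>p. ddF p w w')"
  unfolding ddF_def by (rule smooth_on_frechet_derivative[OF smooth_dF])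

lemma total_has_derivative: "snd p \<noteq> 0 \<Longrightarrow> (total has_derivative dF p) (at p)"
  using smooth_on_has_derivative[OF smooth_total] unfolding dF_def[abs_def] by simp

lemma dF_has_derivative: "snd p \<noteq> 0 \<Longrightarrow> ((\<lambda>p. dF p w) has_derivative ddF p w) (at p)"
  using smooth_on_has_derivative[OF smooth_dF] unfolding ddF_def[abs_def] by simp

lemma linear_dF: "snd p \<noteq> 0 \<Longrightarrow> linear (dF p)"
  by (rule has_derivative_linear[OF total_has_derivative])

lemma linear_ddF: "snd p \<noteq> 0 \<Longrightarrow> linear (ddF p w)"
  by (rule has_derivative_linear[OF dF_has_derivative])

lemma F_has_derivative_fibre:
  assumes "v \<noteq> 0"
  shows "((F q) has_derivative (\<lambda>w. dF (q, v) (0, w))) (at v)"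
proof -
  have "((\<lambda>u. (q, u)) has_derivative (\<lambda>w. (0, w))) (at v)"
    by (auto intro!: derivative_eq_intros)
  then have "((\<lambda>u. total (q, u)) has_derivative (\<lambda>w. dF (q, v) (0, w))) (at v)"
    by (rule has_derivative_compose) (use total_has_derivative assms in simp)
  then show ?thesis by simp
qed

lemma F_has_derivative_base:
  assumes "v \<noteq> 0"
  shows "((\<lambda>q. F q v) has_derivative (\<lambda>w. dF (q, v) (w, 0))) (at q)"
proof -
  have "((\<lambda>q. (q, v)) has_derivative (\<lambda>w. (w, 0))) (at q)"
    by (auto intro!: derivative_eq_intros)
  then have "((\<lambda>q. total (q, v)) has_derivative (\<lambda>w. dF (q, v) (w, 0))) (at q)"
    by (rule has_derivative_compose) (use total_has_derivative assms in simp)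
  then show ?thesis by simp
qed

lemma euler_identity:
  assumes "v \<noteq> 0"
  shows "dF (q, v) (0, v) = F q v"
proof -
  have "((\<lambda>a::real. a *\<^sub>R v) has_derivative (\<lambda>a. a *\<^sub>R v)) (at 1)"
    by (auto intro!: derivative_eq_intros)
  then have "((\<lambda>a::real. F q (a *\<^sub>R v)) has_derivative (\<lambda>a. dF (q, v) (0, a *\<^sub>R v))) (at 1)"
    by (rule has_derivative_compose) (use F_has_derivative_fibre assms in simp)
  moreover have "((\<lambda>a::real. F q (a *\<^sub>R v)) has_derivative (\<lambda>a. a * F q v)) (at 1)"
  proof (rule has_derivative_transform_within_open[of "\<lambda>a. a * F q v" _ _ _ "{0<..}"])
    show "((\<lambda>a. a * F q v) has_derivative (\<lambda>a. a * F q v)) (at 1)"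
      by (auto intro!: derivative_eq_intros)
  qed (auto simp: homogeneous)
  ultimately have "(\<lambda>a::real. dF (q, v) (0, a *\<^sub>R v)) = (\<lambda>a. a * F q v)"
    by (rule has_derivative_unique)
  from fun_cong[OF this, of 1] show ?thesis by simp
qed

lemma dF_homogeneous:
  assumes "v \<noteq> 0" "0 < a"
  shows "dF (q, a *\<^sub>R v) (w, a *\<^sub>R u) = a * dF (q, v) (w, u)"
proof -
  have "((\<lambda>p. (fst p, a *\<^sub>R snd p)) has_derivative (\<lambda>w. (fst w, a *\<^sub>R snd w))) (at (q, v))"
    by (auto intro!: derivative_eq_intros)
  then have "((\<lambda>p. total (fst p, a *\<^sub>R snd p)) has_derivative (\<lambda>w. dF (q, a *\<^sub>R v) (fst w, a *\<^sub>R snd w))) (at (q, v))"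
    by (rule has_derivative_compose[where g = total]) (use total_has_derivative[of "(q, a *\<^sub>R v)"] assms in simp)
  moreover have "((\<lambda>p. a * total p) has_derivative (\<lambda>w. a * dF (q, v) w)) (at (q, v))"
    by (intro has_derivative_mult_right total_has_derivative) (use assms in simp)
  then have "((\<lambda>p. total (fst p, a *\<^sub>R snd p)) has_derivative (\<lambda>w. a * dF (q, v) w)) (at (q, v))"
    using assms by (simp add: homogeneous)
  ultimately have "(\<lambda>w. dF (q, a *\<^sub>R v) (fst w, a *\<^sub>R snd w)) = (\<lambda>w. a * dF (q, v) w)"
    by (rule has_derivative_unique)
  from fun_cong[OF this, of "(w, u)"] show ?thesis by simp
qed

lemma dF_fibre_homogeneous:
  assumes "v \<noteq> 0" "0 < a"
  shows "dF (q, a *\<^sub>R v) (0, w) = dF (q, v) (0, w)"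
proof -
  have lin: "linear (dF (q, v))" using linear_dF assms by simp
  have "dF (q, a *\<^sub>R v) (0, a *\<^sub>R ((1 / a) *\<^sub>R w)) = a * dF (q, v) (0, (1 / a) *\<^sub>R w)"
    by (rule dF_homogeneous[OF assms])
  also have "dF (q, v) (0, (1 / a) *\<^sub>R w) = dF (q, v) ((1 / a) *\<^sub>R (0, w))" by simp
  also have "\<dots> = (1 / a) * dF (q, v) (0, w)" by (subst linear_scale[OF lin]) simp
  finally show ?thesis using assms by simp
qed

lemma dF_base_homogeneous:
  assumes "v \<noteq> 0" "0 < a"
  shows "dF (q, a *\<^sub>R v) (w, 0) = a * dF (q, v) (w, 0)"
  using dF_homogeneous[OF assms, of q w 0] by simp

lemma dF_has_derivative_fibre:
  assumes "v \<noteq> 0"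
  shows "((\<lambda>u. dF (q, u) w) has_derivative (\<lambda>u. ddF (q, v) w (0, u))) (at v)"
proof -
  have "((\<lambda>u. (q, u)) has_derivative (\<lambda>w. (0, w))) (at v)"
    by (auto intro!: derivative_eq_intros)
  then show ?thesis
    by (rule has_derivative_compose) (use dF_has_derivative assms in simp)
qed

text \<open>The fibre derivative is constant along rays.\<close>

lemma ddF_radial:
  assumes "v \<noteq> 0"
  shows "ddF (q, v) (0, w) (0, v) = 0"
proof -
  have "((\<lambda>a::real. a *\<^sub>R v) has_derivative (\<lambda>a. a *\<^sub>R v)) (at 1)"
    by (auto intro!: derivative_eq_intros)
  then have "((\<lambda>a::real. dF (q, a *\<^sub>R v) (0, w)) has_derivative (\<lambda>a. ddF (q, v) (0, w) (0, a *\<^sub>R v))) (at 1)"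
    by (rule has_derivative_compose) (use dF_has_derivative_fibre assms in simp)
  moreover have "((\<lambda>a::real. dF (q, a *\<^sub>R v) (0, w)) has_derivative (\<lambda>a. 0)) (at 1)"
    by (rule has_derivative_transform_within_open[of "\<lambda>a. dF (q, v) (0, w)" _ _ _ "{0<..}"])
      (auto simp: dF_fibre_homogeneous assms)
  ultimately have "(\<lambda>a::real. ddF (q, v) (0, w) (0, a *\<^sub>R v)) = (\<lambda>a. 0)"
    by (rule has_derivative_unique)
  from fun_cong[OF this, of 1] show ?thesis by simp
qed

lemma dF_linear_fibre:
  assumes "v \<noteq> 0"
  shows "dF (q, v) (0, a *\<^sub>R u + b *\<^sub>R w) = a * dF (q, v) (0, u) + b * dF (q, v) (0, w)"
proof -
  have lin: "linear (dF (q, v))" using linear_dF assms by simp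
  have "(0, a *\<^sub>R u + b *\<^sub>R w) = a *\<^sub>R (0, u) + b *\<^sub>R (0 :: plane, w)" by simp
  then have "dF (q, v) (0, a *\<^sub>R u + b *\<^sub>R w) = dF (q, v) (a *\<^sub>R (0, u) + b *\<^sub>R (0, w))" by simp
  also have "\<dots> = a * dF (q, v) (0, u) + b * dF (q, v) (0, w)"
    by (subst linear_add[OF lin], subst (1 2) linear_scale[OF lin]) simp
  finally show ?thesis .
qed

lemma dF_fibre_coords:
  assumes "v \<noteq> 0"
  shows "dF (q, v) (0, w) = fst w * dF (q, v) (0, (1, 0)) + snd w * dF (q, v) (0, (0, 1))"
  using dF_linear_fibre[OF assms, of q "fst w" "(1, 0)" "snd w" "(0, 1)"] by (cases w) simp

lemma hessian_positive:
  assumes v: "v \<noteq> 0" and w: "w \<noteq> 0"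
  shows "0 < (dF (q, v) (0, w))\<^sup>2 + F q v * ddF (q, v) (0, w) (0, w)"
proof -
  have inner: "frechet_derivative (\<lambda>u'. (F q u')\<^sup>2 / 2) (at u) w = F q u * dF (q, u) (0, w)" if "u \<noteq> 0" for u
  proof -
    have "((\<lambda>u'. (F q u')\<^sup>2 / 2) has_derivative (\<lambda>w. F q u * dF (q, u) (0, w))) (at u)"
      by (auto intro!: derivative_eq_intros F_has_derivative_fibre that simp: field_simps)
    from fun_cong[OF frechet_derivative_at[OF this]] show ?thesis by simp
  qed
  have "((\<lambda>u. F q u * dF (q, u) (0, w)) has_derivative
      (\<lambda>h. F q v * ddF (q, v) (0, w) (0, h) + dF (q, v) (0, h) * dF (q, v) (0, w))) (at v)"
    by (intro has_derivative_mult F_has_derivative_fibre dF_has_derivative_fibre v)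
  then have "((\<lambda>u. frechet_derivative (\<lambda>u'. (F q u')\<^sup>2 / 2) (at u) w) has_derivative
      (\<lambda>h. F q v * ddF (q, v) (0, w) (0, h) + dF (q, v) (0, h) * dF (q, v) (0, w))) (at v)"
    by (rule has_derivative_transform_within_open[of _ _ _ _ "- {0}"]) (use v inner in auto)
  from fun_cong[OF frechet_derivative_at[OF this]] have "frechet_derivative (\<lambda>u. frechet_derivative (\<lambda>u'. (F q u')\<^sup>2 / 2) (at u) w) (at v) w
      = F q v * ddF (q, v) (0, w) (0, w) + dF (q, v) (0, w) * dF (q, v) (0, w)"
    by simp
  moreover have "0 < frechet_derivative (\<lambda>u. frechet_derivative (\<lambda>u'. (F q u')\<^sup>2 / 2) (at u) w) (at v) w"
    using finsler v w unfolding finsler_metric_def by blast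
  ultimately show ?thesis by (simp add: power2_eq_square)
qed

lemma F_pos:
  assumes "v \<noteq> 0"
  shows "0 < F q v"
proof -
  have "0 \<le> F q v" using finsler unfolding finsler_metric_def by blast
  moreover have "0 < (F q v)\<^sup>2"
    using hessian_positive[OF assms assms, of q] by (simp add: ddF_radial euler_identity assms)
  ultimately show ?thesis by (simp add: zero_less_power2)
qed

text \<open>
  The Hessian of \<open>F\<close> itself is degenerate along \<open>v\<close>. A vector is therefore first moved along \<open>v\<close>
  into the kernel of the fibre derivative, where the Hessians of \<open>F\<close> and of \<open>F\<^sup>2/2\<close> are
  proportional.
\<close>

lemma ddF_transversal_pos:
  assumes v: "v \<noteq> 0" and u: "\<And>a. u \<noteq> a *\<^sub>R v"
  shows "0 < ddF (q, v) (0, u) (0, u)"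
proof -
  define \<kappa> where "\<kappa> = dF (q, v) (0, u) / F q v"
  define w where "w = 1 *\<^sub>R u + (- \<kappa>) *\<^sub>R v"
  have "w \<noteq> 0" using u[of \<kappa>] by (auto simp: w_def)
  have "dF (q, v) (0, w) = 0"
    unfolding w_def dF_linear_fibre[OF v] using F_pos[OF v, of q] by (simp add: \<kappa>_def euler_identity v)
  then have "0 < F q v * ddF (q, v) (0, w) (0, w)"
    using hessian_positive[OF v \<open>w \<noteq> 0\<close>, of q] by simp
  then have pos: "0 < ddF (q, v) (0, w) (0, w)"
    using F_pos[OF v, of q] by (simp add: zero_less_mult_iff)
  have split_first: "ddF (q, v) (0, w) h = ddF (q, v) (0, u) h - \<kappa> * ddF (q, v) (0, v) h" for h
  proof -
    have "((\<lambda>p. dF p (0, u) - \<kappa> * dF p (0, v)) has_derivative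
        (\<lambda>h. ddF (q, v) (0, u) h - \<kappa> * ddF (q, v) (0, v) h)) (at (q, v))"
      by (intro has_derivative_diff has_derivative_mult_right dF_has_derivative) (use v in auto)
    then have "((\<lambda>p. dF p (0, w)) has_derivative
        (\<lambda>h. ddF (q, v) (0, u) h - \<kappa> * ddF (q, v) (0, v) h)) (at (q, v))"
    proof (rule has_derivative_transform_within_open[of _ _ _ _ "{p. snd p \<noteq> 0}"])
      show "open {p :: plane \<times> plane. snd p \<noteq> 0}"
        by (intro open_Collect_neq continuous_intros)
      fix p :: "plane \<times> plane" assume "p \<in> {p. snd p \<noteq> 0}"
      then show "dF p (0, u) - \<kappa> * dF p (0, v) = dF p (0, w)"
        using dF_linear_fibre[of "snd p" "fst p" 1 u "- \<kappa>" v] by (simp add: w_def)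
    qed (use v in auto)
    moreover have "((\<lambda>p. dF p (0, w)) has_derivative ddF (q, v) (0, w)) (at (q, v))"
      by (rule dF_has_derivative) (use v in auto)
    ultimately have "(\<lambda>h. ddF (q, v) (0, u) h - \<kappa> * ddF (q, v) (0, v) h) = ddF (q, v) (0, w)"
      by (rule has_derivative_unique)
    from fun_cong[OF this] show ?thesis by simp
  qed
  \<comment> \<open>by Euler's identity \<open>dF (q, u') (0, v)\<close> equals \<open>F q u' - dF (q, u') (0, u' - v)\<close>, which is stationary at \<open>u' = v\<close>\<close>
  have euler2: "ddF (q, v) (0, v) (0, h) = 0" for h
  proof -
    have "((\<lambda>u'. F q u' - dF (q, u') (0, u' - v)) has_derivative (\<lambda>h. ddF (q, v) (0, v) (0, h))) (at v)"
    proof (rule has_derivative_transform_within_open[of "\<lambda>u'. dF (q, u') (0, v)" _ _ _ "- {0}"])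
      show "dF (q, u') (0, v) = F q u' - dF (q, u') (0, u' - v)" if "u' \<in> - {0}" for u'
        using dF_linear_fibre[of u' q 1 u' "-1" v] euler_identity[of u' q] that by simp
    qed (use v dF_has_derivative_fibre in auto)
    moreover have "((\<lambda>u'. F q u' - dF (q, u') (0, u' - v)) has_derivative (\<lambda>h. 0)) (at v)"
    proof -
      have "((\<lambda>u'. F q u' - (fst (u' - v) * dF (q, u') (0, (1, 0)) + snd (u' - v) * dF (q, u') (0, (0, 1))))
         has_derivative (\<lambda>h. dF (q, v) (0, h) - (fst h * dF (q, v) (0, (1, 0)) + snd h * dF (q, v) (0, (0, 1))))) (at v)"
        by (auto intro!: derivative_eq_intros F_has_derivative_fibre dF_has_derivative_fibre v)
      moreover have "dF (q, v) (0, h) - (fst h * dF (q, v) (0, (1, 0)) + snd h * dF (q, v) (0, (0, 1))) = 0" for h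
        using dF_fibre_coords[OF v, of q h] by simp
      ultimately have "((\<lambda>u'. F q u' - (fst (u' - v) * dF (q, u') (0, (1, 0)) + snd (u' - v) * dF (q, u') (0, (0, 1))))
         has_derivative (\<lambda>h. 0)) (at v)" by simp
      then show ?thesis
      proof (rule has_derivative_transform_within_open[of _ _ _ _ "- {0}"])
        fix u' :: "plane" assume "u' \<in> - {0}"
        then have "u' \<noteq> 0" by simp
        from dF_fibre_coords[OF this, of q "u' - v"]
        show "F q u' - (fst (u' - v) * dF (q, u') (0, (1, 0)) + snd (u' - v) * dF (q, u') (0, (0, 1)))
            = F q u' - dF (q, u') (0, u' - v)" by simp
      qed (use v in auto)
    qed
    ultimately have "(\<lambda>h. ddF (q, v) (0, v) (0, h)) = (\<lambda>h. 0)"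
      by (rule has_derivative_unique)
    from fun_cong[OF this] show ?thesis by simp
  qed
  have lin2: "linear (ddF (q, v) (0, u))" using linear_ddF v by simp
  have "ddF (q, v) (0, w) (0, w) = ddF (q, v) (0, u) (0, w)"
    unfolding split_first euler2 by simp
  also have "\<dots> = ddF (q, v) (0, u) ((0, u) - \<kappa> *\<^sub>R (0, v))" by (simp add: w_def)
  also have "\<dots> = ddF (q, v) (0, u) (0, u)"
    by (subst linear_diff[OF lin2], subst linear_scale[OF lin2]) (simp add: ddF_radial v)
  finally show ?thesis using pos by simp
qed

end

section \<open>The Lagrangian of a Finsler metric in the slope coordinate\<close>

context finsler_torus
begin

text \<open>By homogeneity, \<open>F\<close> is determined on vectors with positive time component by its values on \<open>(1, y)\<close>.\<close>

definition lag where "lag t x y = F (t, x) (1, y)"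
definition lag_t where "lag_t t x y = dF ((t, x), (1, y)) ((1, 0), 0)"
definition lag_x where "lag_x t x y = dF ((t, x), (1, y)) ((0, 1), 0)"
definition lag_y where "lag_y t x y = dF ((t, x), (1, y)) (0, (0, 1))"
definition lag_yy where "lag_yy t x y = ddF ((t, x), (1, y)) (0, (0, 1)) (0, (0, 1))"

lemma lag_pos: "0 < lag t x y"
  unfolding lag_def by (rule F_pos) (simp add: zero_prod_def)

lemma slope_neq_0 [simp]: "(1 :: real, y :: real) \<noteq> 0"
  by (simp add: zero_prod_def)

text \<open>
  The vector \<open>(0, 1)\<close> is not a multiple of \<open>(1, y)\<close>, so it is a direction in which the fibre Hessian
  of \<open>F\<close> is nondegenerate.
\<close>

lemma lag_yy_pos: "0 < lag_yy t x y"
  unfolding lag_yy_def by (rule ddF_transversal_pos) (auto simp: prod_eq_iff)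

lemma dF_slope_coords:
  "dF ((t, x), (1, y)) ((a, b), (0, c)) = a * lag_t t x y + b * lag_x t x y + c * lag_y t x y"
proof -
  have lin: "linear (dF ((t, x), (1, y)))" by (rule linear_dF) simp
  have "((a, b), (0, c)) = a *\<^sub>R ((1, 0), 0) + b *\<^sub>R ((0, 1), 0) + c *\<^sub>R ((0, 0), (0, 1 :: real)) "
    by (simp add: zero_prod_def)
  then have "dF ((t, x), (1, y)) ((a, b), (0, c))
     = dF ((t, x), (1, y)) (a *\<^sub>R ((1, 0), 0) + b *\<^sub>R ((0, 1), 0) + c *\<^sub>R ((0, 0), (0, 1)))"
    by simp
  also have "\<dots> = a * lag_t t x y + b * lag_x t x y + c * lag_y t x y"
    unfolding linear_add[OF lin] linear_scale[OF lin] lag_t_def lag_x_def lag_y_def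
    by (simp add: zero_prod_def)
  finally show ?thesis .
qed

lemma slope_embedding_has_derivative:
  "((\<lambda>(t, x, y). ((t, x), (1 :: real, y))) has_derivative (\<lambda>(a, b, c). ((a, b), (0, c)))) (at (t :: real, x :: real, y :: real))"
  unfolding case_prod_unfold by (auto intro!: derivative_eq_intros)

lemma lag_has_derivative:
  "((\<lambda>(t, x, y). lag t x y) has_derivative
     (\<lambda>(a, b, c). a * lag_t t x y + b * lag_x t x y + c * lag_y t x y)) (at (t, x, y))"
proof -
  have "(total has_derivative dF ((t, x), (1, y))) (at (case (t, x, y) of (t, x, y) \<Rightarrow> ((t, x), (1, y))))"
    using total_has_derivative[of "((t, x), (1, y))"] by simp
  from has_derivative_compose[OF slope_embedding_has_derivative this]
  show ?thesis by (simp add: case_prod_unfold dF_slope_coords lag_def)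
qed

lemma dF_slope_has_real_derivative:
  "((\<lambda>y. dF ((t, x), (1, y)) w) has_real_derivative ddF ((t, x), (1, y)) w (0, (0, 1))) (at y)"
  "((\<lambda>x. dF ((t, x), (1, y)) w) has_real_derivative ddF ((t, x), (1, y)) w ((0, 1), 0)) (at x)"
proof -
  have D: "((\<lambda>p. dF p w) has_derivative ddF ((t, x), (1, y)) w) (at ((t, x), (1, y)))"
    by (rule dF_has_derivative) simp
  have lin: "linear (ddF ((t, x), (1, y)) w)" by (rule linear_ddF) simp
  have "((\<lambda>y. ((t, x), (1 :: real, y))) has_derivative (\<lambda>c. c *\<^sub>R (0, (0, 1)))) (at y)"
    by (auto intro!: derivative_eq_intros simp: zero_prod_def)
  from has_derivative_compose[OF this D]
  show "((\<lambda>y. dF ((t, x), (1, y)) w) has_real_derivative ddF ((t, x), (1, y)) w (0, (0, 1))) (at y)"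
    unfolding linear_scale[OF lin] by (rule has_derivative_imp_has_field_derivative) simp
  have "((\<lambda>x. ((t, x), (1 :: real, y))) has_derivative (\<lambda>c. c *\<^sub>R ((0, 1), 0))) (at x)"
    by (auto intro!: derivative_eq_intros simp: zero_prod_def)
  from has_derivative_compose[OF this D]
  show "((\<lambda>x. dF ((t, x), (1, y)) w) has_real_derivative ddF ((t, x), (1, y)) w ((0, 1), 0)) (at x)"
    unfolding linear_scale[OF lin] by (rule has_derivative_imp_has_field_derivative) simp
qed

lemma lag_y_has_derivative_y: "((\<lambda>y. lag_y t x y) has_real_derivative lag_yy t x y) (at y)"
  unfolding lag_y_def lag_yy_def by (rule dF_slope_has_real_derivative)

lemma continuous_on_slope_embedding: "continuous_on UNIV (\<lambda>(t :: real, x :: real, y :: real). ((t, x), (1 :: real, y)))"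
  unfolding case_prod_unfold by (intro continuous_intros)

lemma continuous_on_lag:
  "continuous_on UNIV (\<lambda>(t, x, y). lag t x y)"
  "continuous_on UNIV (\<lambda>(t, x, y). dF ((t, x), (1, y)) w)"
  "continuous_on UNIV (\<lambda>(t, x, y). ddF ((t, x), (1, y)) w w')"
proof -
  have img: "(\<lambda>(t, x, y). ((t, x), (1 :: real, y))) ` UNIV \<subseteq> {p :: plane \<times> plane. snd p \<noteq> 0}" by auto
  have *: "continuous_on UNIV (\<lambda>(t, x, y). \<psi> ((t, x), (1 :: real, y)))"
    if "smooth_on {p. snd p \<noteq> 0} \<psi>" for \<psi> :: "plane \<times> plane \<Rightarrow> real"
    using continuous_on_compose2[OF smooth_on_imp_continuous_on[OF that] continuous_on_slope_embedding img]
    by (simp add: case_prod_unfold)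
  show "continuous_on UNIV (\<lambda>(t, x, y). lag t x y)" using *[OF smooth_total] by (simp add: lag_def)
  show "continuous_on UNIV (\<lambda>(t, x, y). dF ((t, x), (1, y)) w)" by (rule *[OF smooth_dF])
  show "continuous_on UNIV (\<lambda>(t, x, y). ddF ((t, x), (1, y)) w w')" by (rule *[OF smooth_ddF])
qed

lemma shift_derivative:
  fixes m n :: int and g :: "plane \<times> plane \<Rightarrow> real"
  assumes g: "\<And>q v. v \<noteq> 0 \<Longrightarrow> g (q + (of_int m, of_int n), v) = g (q, v)"
    and D: "\<And>p. snd p \<noteq> 0 \<Longrightarrow> (g has_derivative G p) (at p)" and v: "v \<noteq> 0"
  shows "G (q + (of_int m, of_int n), v) = G (q, v)"
proof -
  define e :: "plane \<times> plane" where "e = ((of_int m, of_int n), 0)"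
  have "((\<lambda>p. p + e) has_derivative (\<lambda>h. h)) (at (q, v))"
    by (auto intro!: derivative_eq_intros)
  then have "((\<lambda>p. g (p + e)) has_derivative G ((q, v) + e)) (at (q, v))"
    by (rule has_derivative_compose) (use D[of "(q, v) + e"] v in \<open>simp add: e_def\<close>)
  then have "(g has_derivative G ((q, v) + e)) (at (q, v))"
  proof (rule has_derivative_transform_within_open[of _ _ _ _ "{p. snd p \<noteq> 0}"])
    show "open {p :: plane \<times> plane. snd p \<noteq> 0}"
      by (intro open_Collect_neq continuous_intros)
    fix p :: "plane \<times> plane" assume "p \<in> {p. snd p \<noteq> 0}"
    then show "g (p + e) = g p" using g[of "snd p" "fst p"] by (cases p) (simp add: e_def)
  qed (use v in auto)
  from has_derivative_unique[OF this D] v show ?thesis by (simp add: e_def)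
qed

lemma dF_periodic: "v \<noteq> 0 \<Longrightarrow> dF (q + (of_int m, of_int n), v) = dF (q, v)" for m n :: int
  by (rule shift_derivative[OF _ total_has_derivative]) (simp_all add: periodic)

lemma ddF_periodic: "v \<noteq> 0 \<Longrightarrow> ddF (q + (of_int m, of_int n), v) w = ddF (q, v) w" for m n :: int
  by (rule shift_derivative[where g = "\<lambda>p. dF p w" and G = "\<lambda>p. ddF p w"])
    (simp_all add: dF_periodic dF_has_derivative)

lemma lag_periodic:
  fixes m n :: int
  shows "lag (t + of_int m) (x + of_int n) y = lag t x y"
    "lag_yy (t + of_int m) (x + of_int n) y = lag_yy t x y"
  using periodic[of "(t, x)" m n] ddF_periodic[of "(1, y)" "(t, x)" m n]
  by (simp_all add: lag_def lag_yy_def)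

lemma positive_lower_bound:
  fixes \<phi> :: "real \<Rightarrow> real \<Rightarrow> real \<Rightarrow> real"
  assumes cont: "continuous_on UNIV (\<lambda>(t, x, y). \<phi> t x y)" and pos: "\<And>t x y. 0 < \<phi> t x y"
    and per: "\<And>t x y (m::int) (n::int). \<phi> (t + of_int m) (x + of_int n) y = \<phi> t x y"
  shows "\<exists>c>0. \<forall>t x y. \<bar>y\<bar> \<le> R \<longrightarrow> c \<le> \<phi> t x y"
proof -
  have "continuous_on UNIV (\<lambda>(t, x, y). 1 / \<phi> t x y)"
    using cont pos unfolding case_prod_unfold by (intro continuous_intros) (auto simp: less_imp_neq[symmetric])
  then obtain C where C: "0 \<le> C" "\<And>t x y. \<bar>y\<bar> \<le> R \<Longrightarrow> \<bar>1 / \<phi> t x y\<bar> \<le> C"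
    using periodic_bounded[of "\<lambda>t x y. 1 / \<phi> t x y" R] per by auto
  \<comment> \<open>adding \<open>1\<close> keeps the denominator positive\<close>
  have "1 / (C + 1) \<le> \<phi> t x y" if "\<bar>y\<bar> \<le> R" for t x y
    using C(2)[OF that, of t x] C(1) pos[of t x y] by (simp add: field_simps)
  then show ?thesis using C(1) by (intro exI[of _ "1 / (C + 1)"]) auto
qed

lemma real_MVT_bound:
  fixes f :: "real \<Rightarrow> real"
  assumes "\<And>z. \<bar>z - c\<bar> \<le> r \<Longrightarrow> (f has_real_derivative f' z) (at z)" "\<And>z. \<bar>z - c\<bar> \<le> r \<Longrightarrow> \<bar>f' z\<bar> \<le> B"
    "\<bar>a - c\<bar> \<le> r" "\<bar>b - c\<bar> \<le> r"
  shows "\<bar>f a - f b\<bar> \<le> B * \<bar>a - b\<bar>"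
proof -
  have "norm (f a - f b) \<le> B * norm (a - b)"
  proof (rule field_differentiable_bound[of "cball c r" f f'])
    show "(f has_field_derivative f' z) (at z within cball c r)" if "z \<in> cball c r" for z
      using assms(1)[of z] that by (simp add: dist_real_def abs_minus_commute has_field_derivative_at_within)
  qed (use assms in \<open>auto simp: dist_real_def abs_minus_commute\<close>)
  then show ?thesis by simp
qed

text \<open>
  Strict convexity in \<open>y\<close> lets the slope be recovered from the momentum with a Lipschitz bound. The
  equations of motion become Lipschitz in position and momentum, although the slope is not given
  as an explicit function of them.
\<close>

lemma slope_estimate:
  "\<exists>C\<ge>0. \<forall>t x1 x2 y1 y2. \<bar>y1\<bar> \<le> R \<and> \<bar>y2\<bar> \<le> R \<longrightarrow>
     \<bar>y1 - y2\<bar> \<le> C * (\<bar>x1 - x2\<bar> + \<bar>lag_y t x1 y1 - lag_y t x2 y2\<bar>) \<and>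
     \<bar>lag_x t x1 y1 - lag_x t x2 y2\<bar> \<le> C * (\<bar>x1 - x2\<bar> + \<bar>lag_y t x1 y1 - lag_y t x2 y2\<bar>)"
proof -
  note bd = periodic_bounded[OF continuous_on_lag(3), of _ _ R]
  have per: "ddF ((t + of_int m, x + of_int n), (1, y)) w w' = ddF ((t, x), (1, y)) w w'" for t x y w w' and m n :: int
    using ddF_periodic[of "(1, y)" "(t, x)" m n] by simp
  obtain Kyx where Kyx: "0 \<le> Kyx" "\<And>t x y. \<bar>y\<bar> \<le> R \<Longrightarrow> \<bar>ddF ((t, x), (1, y)) (0, (0, 1)) ((0, 1), 0)\<bar> \<le> Kyx"
    using bd[of "(0, (0, 1))" "((0, 1), 0)"] per by auto
  obtain Kxx where Kxx: "0 \<le> Kxx" "\<And>t x y. \<bar>y\<bar> \<le> R \<Longrightarrow> \<bar>ddF ((t, x), (1, y)) ((0, 1), 0) ((0, 1), 0)\<bar> \<le> Kxx"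
    using bd[of "((0, 1), 0)" "((0, 1), 0)"] per by auto
  obtain Kxy where Kxy: "0 \<le> Kxy" "\<And>t x y. \<bar>y\<bar> \<le> R \<Longrightarrow> \<bar>ddF ((t, x), (1, y)) ((0, 1), 0) (0, (0, 1))\<bar> \<le> Kxy"
    using bd[of "((0, 1), 0)" "(0, (0, 1))"] per by auto
  have "continuous_on UNIV (\<lambda>(t, x, y). lag_yy t x y)"
    using continuous_on_lag(3) by (simp add: lag_yy_def)
  then obtain m where m: "0 < m" "\<And>t x y. \<bar>y\<bar> \<le> R \<Longrightarrow> m \<le> lag_yy t x y"
    using positive_lower_bound[of lag_yy R] lag_yy_pos lag_periodic(2) by blast
  define C1 where "C1 = (1 + Kyx) / m"
  define C where "C = C1 + Kxx + Kxy * C1"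
  have C1: "0 \<le> C1" using m Kyx by (simp add: C1_def)
  have "\<bar>y1 - y2\<bar> \<le> C * (\<bar>x1 - x2\<bar> + \<bar>lag_y t x1 y1 - lag_y t x2 y2\<bar>) \<and>
     \<bar>lag_x t x1 y1 - lag_x t x2 y2\<bar> \<le> C * (\<bar>x1 - x2\<bar> + \<bar>lag_y t x1 y1 - lag_y t x2 y2\<bar>)"
    if R: "\<bar>y1\<bar> \<le> R" "\<bar>y2\<bar> \<le> R" for t x1 x2 y1 y2
  proof -
    define E where "E = \<bar>x1 - x2\<bar> + \<bar>lag_y t x1 y1 - lag_y t x2 y2\<bar>"
    have mono: "lag_y t x1 a - m * a \<le> lag_y t x1 b - m * b" if "a \<le> b" "\<bar>a\<bar> \<le> R" "\<bar>b\<bar> \<le> R" for a b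
    proof (rule DERIV_nonneg_imp_nondecreasing[OF that(1), of "\<lambda>y. lag_y t x1 y - m * y"])
      fix y assume "a \<le> y" "y \<le> b"
      then have "m \<le> lag_yy t x1 y" using m(2) that by auto
      moreover have "((\<lambda>y. lag_y t x1 y - m * y) has_real_derivative lag_yy t x1 y - m) (at y)"
        by (auto intro!: derivative_eq_intros lag_y_has_derivative_y)
      ultimately show "\<exists>z. ((\<lambda>y. lag_y t x1 y - m * y) has_real_derivative z) (at y) \<and> 0 \<le> z"
        by (intro exI[of _ "lag_yy t x1 y - m"]) auto
    qed
    have "m * \<bar>y1 - y2\<bar> \<le> \<bar>lag_y t x1 y1 - lag_y t x1 y2\<bar>"
    proof (cases "y1 \<le> y2")
      case True
      then have "m * (y2 - y1) \<le> lag_y t x1 y2 - lag_y t x1 y1"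
        using mono[of y1 y2] R by (simp add: algebra_simps)
      then show ?thesis using True by (simp add: abs_if)
    next
      case False
      then have "m * (y1 - y2) \<le> lag_y t x1 y1 - lag_y t x1 y2"
        using mono[of y2 y1] R by (simp add: algebra_simps)
      then show ?thesis using False by (simp add: abs_if)
    qed
    moreover have "\<bar>lag_y t x1 y2 - lag_y t x2 y2\<bar> \<le> Kyx * \<bar>x1 - x2\<bar>"
      unfolding lag_y_def
      by (rule real_MVT_bound[OF dF_slope_has_real_derivative(2), of 0 "max \<bar>x1\<bar> \<bar>x2\<bar>"]) (use Kyx R in auto)
    ultimately have "m * \<bar>y1 - y2\<bar> \<le> \<bar>lag_y t x1 y1 - lag_y t x2 y2\<bar> + Kyx * \<bar>x1 - x2\<bar>" by linarith
    also have "\<dots> \<le> (1 + Kyx) * E"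
      using Kyx(1) by (simp add: E_def algebra_simps)
    finally have y: "\<bar>y1 - y2\<bar> \<le> C1 * E" using m(1) by (simp add: C1_def field_simps)
    have "\<bar>lag_x t x1 y1 - lag_x t x2 y1\<bar> \<le> Kxx * \<bar>x1 - x2\<bar>"
      unfolding lag_x_def
      by (rule real_MVT_bound[OF dF_slope_has_real_derivative(2), of 0 "max \<bar>x1\<bar> \<bar>x2\<bar>"]) (use Kxx R in auto)
    moreover have "\<bar>lag_x t x2 y1 - lag_x t x2 y2\<bar> \<le> Kxy * \<bar>y1 - y2\<bar>"
      unfolding lag_x_def
      by (rule real_MVT_bound[OF dF_slope_has_real_derivative(1), of 0 R]) (use Kxy R in auto)
    moreover have "Kxx * \<bar>x1 - x2\<bar> \<le> Kxx * E" using Kxx(1) by (intro mult_left_mono) (auto simp: E_def)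
    moreover have "Kxy * \<bar>y1 - y2\<bar> \<le> Kxy * (C1 * E)" using Kxy(1) y by (rule mult_left_mono[rotated])
    ultimately have x: "\<bar>lag_x t x1 y1 - lag_x t x2 y2\<bar> \<le> (Kxx + Kxy * C1) * E"
      by (simp add: algebra_simps)
    have E: "0 \<le> E" by (simp add: E_def)
    have "C1 * E \<le> C * E" "(Kxx + Kxy * C1) * E \<le> C * E"
      unfolding C_def using E C1 Kxx Kxy by (auto intro!: mult_right_mono)
    then show ?thesis using x y unfolding E_def[symmetric] by linarith
  qed
  moreover have "0 \<le> C" using C1 Kxx Kxy by (simp add: C_def)
  ultimately show ?thesis by blast
qed

text \<open>
  The speed \<open>\<tau>\<close> of the time coordinate is left free, so that the notion covers both trajectories
  parametrized by time and geodesics parametrized by arc length.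
\<close>

definition trajectory_on ::
  "real \<Rightarrow> (real \<Rightarrow> real) \<Rightarrow> (real \<Rightarrow> real) \<Rightarrow> (real \<Rightarrow> real) \<Rightarrow> (real \<Rightarrow> real) \<Rightarrow> bool" where
  "trajectory_on a \<tau> t X Y \<longleftrightarrow> (\<forall>s\<in>{0..a}. (X has_real_derivative \<tau> s * Y s) (at s) \<and>
     ((\<lambda>s. lag_y (t s) (X s) (Y s)) has_real_derivative \<tau> s * lag_x (t s) (X s) (Y s)) (at s))"

definition separation where
  "separation t X1 Y1 X2 Y2 s =
     (X1 s - X2 s)\<^sup>2 + (lag_y (t s) (X1 s) (Y1 s) - lag_y (t s) (X2 s) (Y2 s))\<^sup>2"

text \<open>Gronwall's inequality for two trajectories with the same time coordinate.\<close>

lemma trajectory_stability: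
  obtains K where "\<And>a T \<tau> t X1 Y1 X2 Y2. \<lbrakk>0 \<le> a;
      \<forall>s\<in>{0..a}. 0 \<le> \<tau> s \<and> \<tau> s \<le> T \<and> \<bar>Y1 s\<bar> \<le> R \<and> \<bar>Y2 s\<bar> \<le> R;
      trajectory_on a \<tau> t X1 Y1; trajectory_on a \<tau> t X2 Y2\<rbrakk> \<Longrightarrow>
      separation t X1 Y1 X2 Y2 a \<le> exp (K * T * a) * separation t X1 Y1 X2 Y2 0"
proof -
  obtain C where C: "0 \<le> C" and est: "\<And>t x1 x2 y1 y2. \<bar>y1\<bar> \<le> R \<Longrightarrow> \<bar>y2\<bar> \<le> R \<Longrightarrow>
     \<bar>y1 - y2\<bar> \<le> C * (\<bar>x1 - x2\<bar> + \<bar>lag_y t x1 y1 - lag_y t x2 y2\<bar>) \<and>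
     \<bar>lag_x t x1 y1 - lag_x t x2 y2\<bar> \<le> C * (\<bar>x1 - x2\<bar> + \<bar>lag_y t x1 y1 - lag_y t x2 y2\<bar>)"
    using slope_estimate[of R] by blast
  show thesis
  \<comment> \<open>one factor \<open>2\<close> comes from differentiating the squares, the other from \<open>(a + b)\<^sup>2 \<le> 2 (a\<^sup>2 + b\<^sup>2)\<close>\<close>
  proof (rule that[of "4 * C"])
    fix a T :: real and \<tau> t X1 Y1 X2 Y2 :: "real \<Rightarrow> real"
    assume a: "0 \<le> a"
      and tau0: "\<forall>s\<in>{0..a}. 0 \<le> \<tau> s \<and> \<tau> s \<le> T \<and> \<bar>Y1 s\<bar> \<le> R \<and> \<bar>Y2 s\<bar> \<le> R"
      and tr: "trajectory_on a \<tau> t X1 Y1" "trajectory_on a \<tau> t X2 Y2"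
    note tau = bspec[OF tau0]
    have D: "(X1 has_real_derivative \<tau> s * Y1 s) (at s)" "(X2 has_real_derivative \<tau> s * Y2 s) (at s)"
        "((\<lambda>s. lag_y (t s) (X1 s) (Y1 s)) has_real_derivative \<tau> s * lag_x (t s) (X1 s) (Y1 s)) (at s)"
        "((\<lambda>s. lag_y (t s) (X2 s) (Y2 s)) has_real_derivative \<tau> s * lag_x (t s) (X2 s) (Y2 s)) (at s)"
      if "s \<in> {0..a}" for s
      using tr that unfolding trajectory_on_def by blast+
    define dx where "dx s = X1 s - X2 s" for s
    define dp where "dp s = lag_y (t s) (X1 s) (Y1 s) - lag_y (t s) (X2 s) (Y2 s)" for s
    define dy where "dy s = Y1 s - Y2 s" for s
    define dl where "dl s = lag_x (t s) (X1 s) (Y1 s) - lag_x (t s) (X2 s) (Y2 s)" for s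
    have "(dx a)\<^sup>2 + (dp a)\<^sup>2 \<le> exp ((4 * C * T) * (a - 0)) * ((dx 0)\<^sup>2 + (dp 0)\<^sup>2)"
    proof (rule gronwall[OF a, of "\<lambda>s. (dx s)\<^sup>2 + (dp s)\<^sup>2" "\<lambda>s. 2 * (\<tau> s * (dx s * dy s + dp s * dl s))"])
      fix s assume "0 \<le> s" "s \<le> a"
      then have s: "s \<in> {0..a}" by simp
      have "(dx has_real_derivative \<tau> s * dy s) (at s)"
        unfolding dx_def[abs_def] dy_def using D(1,2)[OF s] by (auto intro!: derivative_eq_intros simp: algebra_simps)
      moreover have "(dp has_real_derivative \<tau> s * dl s) (at s)"
        unfolding dp_def[abs_def] dl_def using D(3,4)[OF s] by (auto intro!: derivative_eq_intros simp: algebra_simps)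
      ultimately show "((\<lambda>s. (dx s)\<^sup>2 + (dp s)\<^sup>2) has_real_derivative 2 * (\<tau> s * (dx s * dy s + dp s * dl s))) (at s)"
        by (auto intro!: derivative_eq_intros simp: algebra_simps)
      define E where "E = \<bar>dx s\<bar> + \<bar>dp s\<bar>"
      have est': "\<bar>dy s\<bar> \<le> C * E" "\<bar>dl s\<bar> \<le> C * E"
        using est[of "Y1 s" "Y2 s" "X1 s" "X2 s" "t s"] tau[OF s] by (auto simp: E_def dx_def dp_def dy_def dl_def)
      have "dx s * dy s + dp s * dl s \<le> \<bar>dx s\<bar> * \<bar>dy s\<bar> + \<bar>dp s\<bar> * \<bar>dl s\<bar>"
        unfolding abs_mult[symmetric] by linarith
      also have "\<dots> \<le> \<bar>dx s\<bar> * (C * E) + \<bar>dp s\<bar> * (C * E)"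
        using est' by (intro add_mono mult_left_mono) auto
      also have "\<dots> = C * E\<^sup>2" by (simp add: E_def power2_eq_square algebra_simps)
      also have "\<dots> \<le> C * (2 * ((dx s)\<^sup>2 + (dp s)\<^sup>2))"
      proof (rule mult_left_mono[OF _ C])
        have "0 \<le> (\<bar>dx s\<bar> - \<bar>dp s\<bar>)\<^sup>2" by simp
        then show "E\<^sup>2 \<le> 2 * ((dx s)\<^sup>2 + (dp s)\<^sup>2)"
          unfolding E_def power2_sum power2_diff by simp
      qed
      finally have le: "dx s * dy s + dp s * dl s \<le> C * (2 * ((dx s)\<^sup>2 + (dp s)\<^sup>2))" .
      have "\<tau> s * (dx s * dy s + dp s * dl s) \<le> \<tau> s * (C * (2 * ((dx s)\<^sup>2 + (dp s)\<^sup>2)))"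
        using le tau[OF s] by (intro mult_left_mono) auto
      also have "\<dots> \<le> T * (C * (2 * ((dx s)\<^sup>2 + (dp s)\<^sup>2)))"
        using tau[OF s] C by (intro mult_right_mono) auto
      finally show "2 * (\<tau> s * (dx s * dy s + dp s * dl s)) \<le> 4 * C * T * ((dx s)\<^sup>2 + (dp s)\<^sup>2)"
        by (simp add: algebra_simps)
    qed
    then show "separation t X1 Y1 X2 Y2 a \<le> exp (4 * C * T * a) * separation t X1 Y1 X2 Y2 0"
      by (simp add: dx_def dp_def separation_def)
  qed
qed

end

section \<open>Geodesics as trajectories of the Lagrangian\<close>

context finsler_torus
begin

lemma F_0: "F q 0 = 0"
  using homogeneous[of 2 q 0] by simp

lemma energy_frechet_derivative:
  assumes "v \<noteq> 0"
  shows "frechet_derivative (energy F q) (at v) w = F q v * dF (q, v) (0, w)"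
    "frechet_derivative (\<lambda>q. energy F q v) (at q) w = F q v * dF (q, v) (w, 0)"
proof -
  have "(energy F q has_derivative (\<lambda>w. F q v * dF (q, v) (0, w))) (at v)"
    unfolding energy_def[abs_def]
    by (auto intro!: derivative_eq_intros F_has_derivative_fibre assms simp: field_simps)
  from fun_cong[OF frechet_derivative_at[OF this]]
  show "frechet_derivative (energy F q) (at v) w = F q v * dF (q, v) (0, w)" by simp
  have "((\<lambda>q. energy F q v) has_derivative (\<lambda>w. F q v * dF (q, v) (w, 0))) (at q)"
    unfolding energy_def[abs_def]
    by (auto intro!: derivative_eq_intros F_has_derivative_base assms simp: field_simps)
  from fun_cong[OF frechet_derivative_at[OF this]]
  show "frechet_derivative (\<lambda>q. energy F q v) (at q) w = F q v * dF (q, v) (w, 0)" by simp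
qed

text \<open>At unit speed the factor \<open>F\<close> in the derivatives of \<open>F\<^sup>2/2\<close> is \<open>1\<close>.\<close>

lemma unit_speed_euler_lagrange:
  assumes unit: "\<And>s. F (\<gamma> s) (\<gamma>' s) = 1"
  shows "euler_lagrange (energy F) \<gamma> \<gamma>' \<longleftrightarrow>
    (\<forall>s. (\<gamma> has_vector_derivative \<gamma>' s) (at s) \<and>
      (\<forall>w. ((\<lambda>r. dF (\<gamma> r, \<gamma>' r) (0, w)) has_real_derivative dF (\<gamma> s, \<gamma>' s) (w, 0)) (at s)))"
proof -
  have "\<gamma>' s \<noteq> 0" for s using unit[of s] F_0[of "\<gamma> s"] by auto
  then show ?thesis unfolding euler_lagrange_def by (simp add: energy_frechet_derivative unit)
qed

text \<open>
  If two unit vectors over the same point have the same momentum, then Euler's identity excludes that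
  they are distinct and parallel, and otherwise convexity along the segment between them separates
  their momenta.
\<close>

lemma momentum_injective:
  assumes F: "F q v = 1" "F q w = 1" and eq: "\<And>u. dF (q, v) (0, u) = dF (q, w) (0, u)"
  shows "v = w"
proof (rule ccontr)
  assume ne: "v \<noteq> w"
  have v: "v \<noteq> 0" and w: "w \<noteq> 0" using F F_0[of q] by fastforce+
  have par: "w \<noteq> a *\<^sub>R v" for a
  proof
    assume a: "w = a *\<^sub>R v"
    have "1 = dF (q, w) (0, w)" using euler_identity w F by simp
    also have "\<dots> = dF (q, v) (0, w)" by (simp add: eq)
    also have "\<dots> = a" using dF_linear_fibre[OF v, of q a v 0 0] a euler_identity v F by simp
    finally show False using a ne by simp
  qed
  define z where "z s = v + s *\<^sub>R (w - v)" for s :: real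
  have z: "z s \<noteq> 0" for s
  proof
    assume "z s = 0"
    then have e: "s *\<^sub>R w = (s - 1) *\<^sub>R v" by (simp add: z_def algebra_simps)
    then have "s \<noteq> 0" using v by auto
    then have "w = inverse s *\<^sub>R (s *\<^sub>R w)" by simp
    then have "w = (inverse s * (s - 1)) *\<^sub>R v" unfolding e by simp
    then show False using par by blast
  qed
  have tr: "w - v \<noteq> a *\<^sub>R z s" for a s
  proof
    assume "w - v = a *\<^sub>R z s"
    then have e: "(1 - a * s) *\<^sub>R w = (1 - a * s + a) *\<^sub>R v" by (simp add: z_def algebra_simps)
    show False
    proof (cases "1 - a * s = 0")
      case True
      then show False using e v by auto
    next
      case False
      then have "w = inverse (1 - a * s) *\<^sub>R ((1 - a * s) *\<^sub>R w)" by simp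
      then have "w = (inverse (1 - a * s) * (1 - a * s + a)) *\<^sub>R v" unfolding e by simp
      then show False using par by blast
    qed
  qed
  have "dF (q, z 0) (0, w - v) < dF (q, z 1) (0, w - v)"
  proof (rule DERIV_pos_imp_increasing[of 0 1 "\<lambda>s. dF (q, z s) (0, w - v)"])
    fix s :: real
    have "(z has_derivative (\<lambda>h. h *\<^sub>R (w - v))) (at s)"
      unfolding z_def[abs_def] by (auto intro!: derivative_eq_intros)
    from has_derivative_compose[OF this dF_has_derivative_fibre[OF z]]
    have "((\<lambda>s. dF (q, z s) (0, w - v)) has_derivative (\<lambda>h. ddF (q, z s) (0, w - v) (0, h *\<^sub>R (w - v)))) (at s)" .
    moreover have "ddF (q, z s) (0, w - v) (0, h *\<^sub>R (w - v)) = h * ddF (q, z s) (0, w - v) (0, w - v)" for h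
      using linear_scale[OF linear_ddF[of "(q, z s)" "(0, w - v)"], of h "(0, w - v)"] z by simp
    ultimately have "((\<lambda>s. dF (q, z s) (0, w - v)) has_real_derivative ddF (q, z s) (0, w - v) (0, w - v)) (at s)"
      by (intro has_derivative_imp_has_field_derivative) auto
    then show "\<exists>y. ((\<lambda>s. dF (q, z s) (0, w - v)) has_real_derivative y) (at s) \<and> 0 < y"
      using ddF_transversal_pos[OF z tr] by blast
  qed simp
  then show False using eq by (simp add: z_def)
qed

text \<open>By homogeneity, the bounds of \<open>F\<close> on Euclidean unit vectors over a compact set bound the length of
  \<open>F\<close>-unit vectors above and away from \<open>0\<close>.\<close>

lemma compact_unit_bundle:
  "compact {p. fst p \<in> cball 0 r \<and> F (fst p) (snd p) = 1}" (is "compact ?K")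
proof -
  have cont: "continuous_on {p. snd p \<noteq> 0} total"
    by (rule smooth_on_imp_continuous_on[OF smooth_total])
  define A where "A = cball (0 :: plane) r \<times> sphere (0 :: plane) 1"
  have A: "compact (total ` A)"
    by (intro compact_continuous_image continuous_on_subset[OF cont]) (auto simp: A_def intro!: compact_Times)
  obtain b where b: "\<And>p. p \<in> A \<Longrightarrow> \<bar>total p\<bar> \<le> b" using compact_imp_bounded[OF A] bounded_real by auto
  have "continuous_on A (\<lambda>p. 1 / total p)"
  proof (intro continuous_intros continuous_on_subset[OF cont] ballI)
    fix p assume "p \<in> A"
    then have "snd p \<noteq> 0" by (auto simp: A_def)
    from F_pos[OF this, of "fst p"] show "total p \<noteq> 0" by simp
  qed (auto simp: A_def)
  then have "compact ((\<lambda>p. 1 / total p) ` A)"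
    by (rule compact_continuous_image) (auto simp: A_def intro!: compact_Times)
  from compact_imp_bounded[OF this]
  obtain c where c: "\<And>p. p \<in> A \<Longrightarrow> \<bar>1 / total p\<bar> \<le> c" unfolding bounded_real by blast
  define J where "J = cball (0 :: plane) r \<times> (cball (0 :: plane) (max 0 c) - ball 0 (1 / (\<bar>b\<bar> + 1)))"
  have sub: "p \<in> J" if "p \<in> ?K" for p
  proof -
    obtain q v where p: "p = (q, v)" by (cases p)
    have F1: "F q v = 1" and q: "q \<in> cball 0 r" using that p by auto
    then have v: "v \<noteq> 0" using F_0[of q] by fastforce
    define u where "u = (1 / norm v) *\<^sub>R v"
    have "(q, u) \<in> A" using v q by (simp add: A_def u_def)
    moreover have "1 = norm v * F q u"
      using homogeneous[of "norm v" q u] v F1 by (simp add: u_def)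
    then have Fu: "F q u = 1 / norm v" using v by (simp add: field_simps)
    ultimately have "1 / norm v \<le> b" "norm v \<le> c" using b[of "(q, u)"] c[of "(q, u)"] by (auto simp: abs_le_iff)
    then have bc: "1 \<le> b * norm v" "norm v \<le> c" using v by (auto simp: field_simps)
    moreover have "b * norm v \<le> \<bar>b\<bar> * norm v" by (rule mult_right_mono) auto
    ultimately have "1 \<le> norm v * (\<bar>b\<bar> + 1)" using norm_ge_zero[of v] unfolding distrib_left mult_1_right
      by (simp only: mult.commute[of "norm v" "\<bar>b\<bar>"])
    then have "1 / (\<bar>b\<bar> + 1) \<le> norm v" "norm v \<le> max 0 c" using bc by (auto simp: divide_le_eq)
    then show ?thesis using q p by (simp add: J_def)
  qed
  have J: "compact J" unfolding J_def by (intro compact_Times compact_diff) auto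
  have "continuous_on J total"
    by (rule continuous_on_subset[OF cont]) (auto simp: J_def)
  then have "closed (J \<inter> total -` {1})"
    by (rule continuous_closed_preimage[OF _ compact_imp_closed[OF J]]) simp
  moreover have "?K = J \<inter> (J \<inter> total -` {1})" using sub by (auto simp: J_def)
  ultimately show ?thesis using compact_Int_closed[OF J] by metis
qed

text \<open>
  Only the momentum of a solution is differentiable by definition; compactness of the unit bundle
  transfers its continuity to the velocity.
\<close>

lemma geodesic_velocity_continuous:
  assumes unit: "\<And>s. F (\<gamma> s) (\<gamma>' s) = 1" and el: "euler_lagrange (energy F) \<gamma> \<gamma>'"
  shows "continuous_on UNIV \<gamma>'"
proof -
  have vd: "(\<gamma> has_vector_derivative \<gamma>' s) (at s)"
    and mom: "((\<lambda>r. dF (\<gamma> r, \<gamma>' r) (0, w)) has_real_derivative dF (\<gamma> s, \<gamma>' s) (w, 0)) (at s)" for s w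
    using el unfolding unit_speed_euler_lagrange[OF unit] by blast+
  have cg: "continuous_on UNIV \<gamma>"
    by (intro continuous_at_imp_continuous_on ballI has_vector_derivative_continuous[OF vd])
  have cm: "continuous_on UNIV (\<lambda>r. dF (\<gamma> r, \<gamma>' r) (0, w))" for w
    by (intro continuous_at_imp_continuous_on ballI DERIV_isCont[OF mom])
  have loc: "continuous_on {s - 1<..<s + 1} \<gamma>'" for s :: real
  proof -
    have "compact (\<gamma> ` {s - 1..s + 1})"
      by (intro compact_continuous_image continuous_on_subset[OF cg]) auto
    then obtain r where r: "\<And>x. x \<in> {s - 1..s + 1} \<Longrightarrow> norm (\<gamma> x) \<le> r"
      using compact_imp_bounded bounded_iff by (metis image_eqI)
    define K where "K = {p. fst p \<in> cball 0 r \<and> F (fst p) (snd p) = 1}"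
    have K0: "K \<subseteq> {p. snd p \<noteq> 0}" using F_0 by (auto simp: K_def)
    define \<Phi> where "\<Phi> p = (fst p, dF p (0, (1, 0)), dF p (0, (0, 1)))" for p
    have c: "continuous_on K \<Phi>" unfolding \<Phi>_def[abs_def]
      by (intro continuous_intros continuous_on_subset[OF smooth_on_imp_continuous_on[OF smooth_dF] K0])
    have inj: "inj_on \<Phi> K"
    proof (rule inj_onI)
      fix p p' assume p: "p \<in> K" "p' \<in> K" "\<Phi> p = \<Phi> p'"
      obtain q v where pq: "p = (q, v)" by (cases p)
      obtain v' where pq': "p' = (q, v')" using p(3) pq by (cases p') (auto simp: \<Phi>_def)
      have vv: "v \<noteq> 0" "v' \<noteq> 0" using p K0 pq pq' by auto
      have "dF (q, v) (0, u) = dF (q, v') (0, u)" for u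
        unfolding dF_fibre_coords[OF vv(1), of q u] dF_fibre_coords[OF vv(2), of q u]
        using p(3) pq pq' by (simp add: \<Phi>_def)
      then have "v = v'" using p pq pq' by (intro momentum_injective[of q]) (auto simp: K_def)
      then show "p = p'" using pq pq' by simp
    qed
    have ci: "continuous_on (\<Phi> ` K) (inv_into K \<Phi>)"
      using c compact_unit_bundle[of r] inj by (intro continuous_on_inv) (auto simp: K_def)
    have cp: "continuous_on {s - 1<..<s + 1} (\<lambda>x. \<Phi> (\<gamma> x, \<gamma>' x))"
      unfolding \<Phi>_def fst_conv
      by (intro continuous_on_Pair continuous_on_subset[OF cg] continuous_on_subset[OF cm]) auto
    have inK: "(\<gamma> x, \<gamma>' x) \<in> K" if "x \<in> {s - 1<..<s + 1}" for x
      using r[of x] that unit by (auto simp: K_def)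
    have "(\<lambda>x. \<Phi> (\<gamma> x, \<gamma>' x)) ` {s - 1<..<s + 1} \<subseteq> \<Phi> ` K" using inK by blast
    from continuous_on_snd[OF continuous_on_compose2[OF ci cp this]]
    have "continuous_on {s - 1<..<s + 1} (\<lambda>x. snd (inv_into K \<Phi> (\<Phi> (\<gamma> x, \<gamma>' x))))" .
    then show ?thesis
      by (rule continuous_on_eq) (use inK inj in simp)
  qed
  have "continuous (at s) \<gamma>'" for s
    using loc[of s] by (auto simp: continuous_on_eq_continuous_at)
  then show ?thesis by (intro continuous_at_imp_continuous_on) auto
qed

text \<open>
  The Euler-Lagrange equation together with the law \<open>d(L - v L\<^sub>y)/dt = L\<^sub>t\<close>. The latter follows from the former
  when \<open>v\<close> is differentiable; here it is part of the notion, because it is the time component of the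
  geodesic equation and \<open>v\<close> is only required to be continuous. The bound on the slope keeps the length element
  away from zero.
\<close>

definition lagrangian_curve :: "(real \<Rightarrow> real) \<Rightarrow> (real \<Rightarrow> real) \<Rightarrow> bool" where
  "lagrangian_curve x v \<longleftrightarrow>
     (\<forall>t. (x has_real_derivative v t) (at t) \<and>
          ((\<lambda>t. lag_y t (x t) (v t)) has_real_derivative lag_x t (x t) (v t)) (at t) \<and>
          ((\<lambda>t. lag t (x t) (v t) - v t * lag_y t (x t) (v t)) has_real_derivative lag_t t (x t) (v t)) (at t)) \<and>
     continuous_on UNIV v \<and> (\<exists>R. \<forall>t. \<bar>v t\<bar> \<le> R)"

text \<open>The momentum of a vector of slope \<open>y\<close> has the components \<open>L - y L\<^sub>y\<close> and \<open>L\<^sub>y\<close>, by Euler's identity.\<close>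

lemma dF_at_slope:
  assumes "0 < a"
  shows "dF (q, a *\<^sub>R (1, y)) (0, w) = fst w * (lag (fst q) (snd q) y - y * lag_y (fst q) (snd q) y) + snd w * lag_y (fst q) (snd q) y"
    "dF (q, a *\<^sub>R (1, y)) (w, 0) = a * (fst w * lag_t (fst q) (snd q) y + snd w * lag_x (fst q) (snd q) y)"
proof -
  have w: "w = fst w *\<^sub>R (1, y) + (snd w - fst w * y) *\<^sub>R (0, 1)" by (simp add: prod_eq_iff)
  have "dF (q, a *\<^sub>R (1, y)) (0, w) = dF (q, (1, y)) (0, w)"
    by (rule dF_fibre_homogeneous[OF slope_neq_0 assms])
  also have "\<dots> = dF (q, (1, y)) (0, fst w *\<^sub>R (1, y) + (snd w - fst w * y) *\<^sub>R (0, 1))"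
    by (rule arg_cong[OF w])
  also have "\<dots> = fst w * lag (fst q) (snd q) y + (snd w - fst w * y) * lag_y (fst q) (snd q) y"
    by (subst dF_linear_fibre[OF slope_neq_0]) (simp add: euler_identity lag_def lag_y_def)
  finally show "dF (q, a *\<^sub>R (1, y)) (0, w) = fst w * (lag (fst q) (snd q) y - y * lag_y (fst q) (snd q) y) + snd w * lag_y (fst q) (snd q) y"
    by (simp add: algebra_simps)
  have "dF (q, a *\<^sub>R (1, y)) (w, 0) = a * dF (q, (1, y)) (w, 0)"
    by (rule dF_base_homogeneous[OF slope_neq_0 assms])
  then show "dF (q, a *\<^sub>R (1, y)) (w, 0) = a * (fst w * lag_t (fst q) (snd q) y + snd w * lag_x (fst q) (snd q) y)"
    using dF_slope_coords[of "fst q" "snd q" y "fst w" "snd w" 0] by (cases w) (simp add: zero_prod_def)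
qed

lemma F_at_slope: "0 < a \<Longrightarrow> F q (a *\<^sub>R (1, y)) = a * lag (fst q) (snd q) y"
  by (subst homogeneous) (simp_all add: lag_def)

context
  fixes x v :: "real \<Rightarrow> real"
  assumes curve: "lagrangian_curve x v"
begin

abbreviation speed :: "real \<Rightarrow> real" where "speed t \<equiv> lag t (x t) (v t)"

lemma curve_derivatives:
  "(x has_real_derivative v t) (at t)"
  "((\<lambda>t. lag_y t (x t) (v t)) has_real_derivative lag_x t (x t) (v t)) (at t)"
  "((\<lambda>t. speed t - v t * lag_y t (x t) (v t)) has_real_derivative lag_t t (x t) (v t)) (at t)"
  using curve unfolding lagrangian_curve_def by auto

text \<open>\<open>S\<close> is the arc length of the graph of \<open>x\<close> as a function of time, and \<open>T\<close> is its inverse.\<close>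

lemma curve_arclength:
  obtains S T :: "real \<Rightarrow> real"
  where "S 0 = 0" "\<And>t. (S has_real_derivative speed t) (at t)" "\<And>t. T (S t) = t" "\<And>s. S (T s) = s"
    "strict_mono S" "\<And>s. (T has_real_derivative 1 / speed (T s)) (at s)"
proof -
  define l where "l t = speed t" for t
  obtain R where R: "\<And>t. \<bar>v t\<bar> \<le> R" using curve unfolding lagrangian_curve_def by blast
  obtain c where c: "0 < c" "\<And>t. c \<le> l t"
    using positive_lower_bound[OF continuous_on_lag(1) lag_pos lag_periodic(1), of R] R unfolding l_def by blast
  have cx: "continuous_on UNIV x"
    by (intro continuous_at_imp_continuous_on ballI DERIV_isCont[OF curve_derivatives(1)])
  have cv: "continuous_on UNIV v" using curve unfolding lagrangian_curve_def by blast
  have "continuous_on UNIV (\<lambda>t. (t, x t, v t))" by (intro continuous_intros cx cv)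
  from continuous_on_compose2[OF continuous_on_lag(1) this]
  have cl: "isCont l t" for t by (simp add: l_def[abs_def] continuous_on_eq_continuous_at)
  have "\<exists>G. \<forall>t :: real. -\<infinity> < ereal t \<longrightarrow> ereal t < \<infinity> \<longrightarrow> (G has_vector_derivative l t) (at t)"
    by (rule einterval_antiderivative) (auto intro: cl)
  then obtain G where G: "\<And>t. (G has_real_derivative l t) (at t)"
    by (auto simp: has_real_derivative_iff_has_vector_derivative)
  define S where "S t = G t - G 0" for t
  have dS: "(S has_real_derivative l t) (at t)" for t
    unfolding S_def[abs_def] by (auto intro!: derivative_eq_intros G)
  have grow: "c * (b - a) \<le> S b - S a" if "a \<le> b" for a b
  proof -
    have "S a - c * a \<le> S b - c * b"
    proof (rule DERIV_nonneg_imp_nondecreasing[OF that, of "\<lambda>t. S t - c * t"])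
      fix t show "\<exists>y. ((\<lambda>t. S t - c * t) has_real_derivative y) (at t) \<and> 0 \<le> y"
        using c(2)[of t] by (intro exI[of _ "l t - c"]) (auto intro!: derivative_eq_intros dS)
    qed
    then show ?thesis by (simp add: algebra_simps)
  qed
  have sm: "strict_mono S"
  proof (rule strict_monoI)
    fix a b :: real assume "a < b"
    then show "S a < S b" using grow[of a b] c(1) by (smt (verit) mult_pos_pos)
  qed
  have contS: "continuous_on UNIV S"
    by (intro continuous_at_imp_continuous_on ballI DERIV_isCont[OF dS])
  have S0: "S 0 = 0" by (simp add: S_def)
  have surj: "\<exists>t. S t = s" for s
  proof -
    define b where "b = \<bar>s\<bar> / c"
    have b: "0 \<le> b" "c * b = \<bar>s\<bar>" using c(1) by (auto simp: b_def)
    have "S (- b) \<le> s" "s \<le> S b"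
      using grow[of "-b" 0] grow[of 0 b] b S0 by auto
    then show ?thesis
      using IVT'[of S "-b" s b] b continuous_on_subset[OF contS] by auto
  qed
  have inj: "inj S" by (rule strict_mono_imp_inj_on[OF sm])
  define T where "T = inv S"
  have TS: "T (S t) = t" for t using inj by (simp add: T_def)
  have ST: "S (T s) = s" for s unfolding T_def by (rule f_inv_into_f) (metis surj rangeI)
  have contT: "isCont T s" for s
  proof -
    have "isCont T (S (T s))"
      by (rule isCont_inverse_function[of 1]) (auto simp: TS intro: DERIV_isCont[OF dS])
    then show ?thesis by (simp add: ST)
  qed
  have "(T has_real_derivative inverse (l (T s))) (at s)" for s
    by (rule DERIV_inverse_function[where f = S and a = "s - 1" and b = "s + 1"])
      (use dS ST contT c(1) c(2)[of "T s"] in auto)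
  then have dT: "(T has_real_derivative 1 / l (T s)) (at s)" for s by (simp add: inverse_eq_divide)
  show thesis by (rule that[OF S0 dS[unfolded l_def] TS ST sm dT[unfolded l_def]])
qed

text \<open>
  A solution of the Euler-Lagrange equation of the energy through a vector with positive time component
  is the trajectory \<open>x\<close> run at unit speed: as long as the time component stays positive, Gronwall's
  inequality identifies the two, and this identification keeps the time component positive.
\<close>

lemma geodesic_follows_curve:
  assumes S: "S 0 = 0" "\<And>t. (S has_real_derivative speed t) (at t)"
    and T: "\<And>t. T (S t) = t" "\<And>s. S (T s) = s"
      "\<And>s. (T has_real_derivative 1 / speed (T s)) (at s)"
    and unit: "\<And>s. F (\<gamma> s) (\<gamma>' s) = 1" and el: "euler_lagrange (energy F) \<gamma> \<gamma>'"
    and init: "\<gamma> 0 = (0, x 0)" "\<gamma>' 0 = (1 / speed 0) *\<^sub>R (1, v 0)"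
    and s: "0 \<le> s"
  shows "\<gamma> s = (T s, x (T s)) \<and> \<gamma>' s = (1 / speed (T s)) *\<^sub>R (1, v (T s))"
proof -
  have vd: "(\<gamma> has_vector_derivative \<gamma>' s) (at s)"
    and mom: "((\<lambda>r. dF (\<gamma> r, \<gamma>' r) (0, w)) has_real_derivative dF (\<gamma> s, \<gamma>' s) (w, 0)) (at s)" for s w
    using el unfolding unit_speed_euler_lagrange[OF unit] by blast+
  have cg': "continuous_on UNIV \<gamma>'" by (rule geodesic_velocity_continuous[OF unit el])
  define t where "t s = fst (\<gamma> s)" for s
  define X where "X s = snd (\<gamma> s)" for s
  define \<tau> where "\<tau> s = fst (\<gamma>' s)" for s
  define Y where "Y s = snd (\<gamma>' s) / \<tau> s" for s
  have ct: "continuous_on UNIV \<tau>" unfolding \<tau>_def by (rule continuous_on_fst[OF cg'])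
  have dt: "(t has_real_derivative \<tau> s) (at s)" for s
    unfolding t_def[abs_def] \<tau>_def has_real_derivative_iff_has_vector_derivative
    using bounded_linear.has_vector_derivative[OF bounded_linear_fst vd] by simp
  have dX: "(X has_real_derivative snd (\<gamma>' s)) (at s)" for s
    unfolding X_def[abs_def] has_real_derivative_iff_has_vector_derivative
    using bounded_linear.has_vector_derivative[OF bounded_linear_snd vd] by simp
  have slope: "\<gamma>' s = \<tau> s *\<^sub>R (1, Y s)" if "0 < \<tau> s" for s
    using that by (simp add: prod_eq_iff \<tau>_def Y_def)
  have lag1: "\<tau> s * lag (t s) (X s) (Y s) = 1" if "0 < \<tau> s" for s
    using F_at_slope[OF that, of "\<gamma> s" "Y s"] unit[of s] slope[OF that] by (simp add: t_def X_def)
  obtain R0 where R0: "\<And>t. \<bar>v t\<bar> \<le> R0" using curve unfolding lagrangian_curve_def by blast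
  have step: "\<gamma> s = (T s, x (T s)) \<and> \<gamma>' s = (1 / speed (T s)) *\<^sub>R (1, v (T s))"
    if s: "0 \<le> s" and pos: "\<And>r. r \<in> {0..s} \<Longrightarrow> 0 < \<tau> r" for s
  proof -
    have "continuous_on {0..s} (\<lambda>r. snd (\<gamma>' r) / \<tau> r)"
      using pos by (intro continuous_intros continuous_on_subset[OF cg'] continuous_on_subset[OF ct]) fastforce+
    then have "compact (Y ` {0..s})" unfolding Y_def[abs_def] by (rule compact_continuous_image) simp
    then obtain R1 where R1: "\<And>r. r \<in> {0..s} \<Longrightarrow> \<bar>Y r\<bar> \<le> R1"
      using compact_imp_bounded bounded_real by (metis image_eqI)
    have "compact (\<tau> ` {0..s})" by (intro compact_continuous_image continuous_on_subset[OF ct]) auto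
    then obtain T1 where T1: "\<And>r. r \<in> {0..s} \<Longrightarrow> \<bar>\<tau> r\<bar> \<le> T1"
      using compact_imp_bounded bounded_real by (metis image_eqI)
    define R where "R = max R0 R1"
    obtain K where K: "\<And>a T \<tau> t X1 Y1 X2 Y2. \<lbrakk>0 \<le> a;
      \<forall>s\<in>{0..a}. 0 \<le> \<tau> s \<and> \<tau> s \<le> T \<and> \<bar>Y1 s\<bar> \<le> R \<and> \<bar>Y2 s\<bar> \<le> R;
      trajectory_on a \<tau> t X1 Y1; trajectory_on a \<tau> t X2 Y2\<rbrakk> \<Longrightarrow>
      separation t X1 Y1 X2 Y2 a \<le> exp (K * T * a) * separation t X1 Y1 X2 Y2 0"
      using trajectory_stability[of R] by metis
    have t0: "t 0 = 0" "X 0 = x 0" using init by (auto simp: t_def X_def)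
    have "Y 0 = v 0" using init lag_pos[of 0 "x 0" "v 0"] by (simp add: Y_def \<tau>_def)
    have agree: "X r = x (t r) \<and> Y r = v (t r)" if r: "r \<in> {0..s}" for r
    proof -
      define sep where "sep = separation t X Y (\<lambda>r. x (t r)) (\<lambda>r. v (t r))"
      have "sep r \<le> exp (K * T1 * r) * sep 0" unfolding sep_def
      proof (rule K[of r \<tau> T1 Y "\<lambda>r. v (t r)" t X "\<lambda>r. x (t r)"])
        show "\<forall>z\<in>{0..r}. 0 \<le> \<tau> z \<and> \<tau> z \<le> T1 \<and> \<bar>Y z\<bar> \<le> R \<and> \<bar>v (t z)\<bar> \<le> R"
        proof
          fix z assume "z \<in> {0..r}"
          then have z: "z \<in> {0..s}" using r by auto
          show "0 \<le> \<tau> z \<and> \<tau> z \<le> T1 \<and> \<bar>Y z\<bar> \<le> R \<and> \<bar>v (t z)\<bar> \<le> R"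
            using pos[OF z] T1[OF z] R1[OF z] R0[of "t z"] by (auto simp: R_def)
        qed
        have "((\<lambda>r. x (t r)) has_real_derivative \<tau> z * v (t z)) (at z)" for z
          using DERIV_chain2[OF curve_derivatives(1) dt, of z] by (simp add: mult.commute)
        moreover have "((\<lambda>r. lag_y (t r) (x (t r)) (v (t r))) has_real_derivative \<tau> z * lag_x (t z) (x (t z)) (v (t z))) (at z)" for z
          using DERIV_chain2[OF curve_derivatives(2) dt, of z] by (simp add: mult.commute)
        ultimately show "trajectory_on r \<tau> t (\<lambda>r. x (t r)) (\<lambda>r. v (t r))"
          by (simp add: trajectory_on_def)
        show "trajectory_on r \<tau> t X Y" unfolding trajectory_on_def
        proof
          fix z assume "z \<in> {0..r}"
          then have z: "z \<in> {0..s}" using r by auto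
          have q: "(X has_real_derivative \<tau> z * Y z) (at z)" using dX[of z] pos[OF z] by (simp add: Y_def)
        have m1: "((\<lambda>r. dF (\<gamma> r, \<gamma>' r) (0, (0, 1))) has_real_derivative \<tau> z * lag_x (t z) (X z) (Y z)) (at z)"
          using mom[of "(0, 1)" z] unfolding slope[OF pos[OF z]] dF_at_slope(2)[OF pos[OF z]]
          by (simp add: t_def X_def)
        have ev: "\<forall>\<^sub>F r in nhds z. dF (\<gamma> r, \<gamma>' r) (0, (0, 1)) = lag_y (t r) (X r) (Y r)"
        proof -
          have "\<forall>\<^sub>F r in nhds z. 0 < \<tau> r"
            using open_Collect_less[OF continuous_on_const ct, of 0] pos[OF z] eventually_nhds by blast
          then show ?thesis
            by eventually_elim (simp only: slope dF_at_slope t_def X_def fst_conv snd_conv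
                mult_zero_left mult_1_left add_0_left)
        qed
        have p: "((\<lambda>r. lag_y (t r) (X r) (Y r)) has_real_derivative \<tau> z * lag_x (t z) (X z) (Y z)) (at z)"
          by (rule DERIV_cong_ev[OF refl ev refl, THEN iffD1, OF m1])
          then show "(X has_real_derivative \<tau> z * Y z) (at z) \<and>
              ((\<lambda>r. lag_y (t r) (X r) (Y r)) has_real_derivative \<tau> z * lag_x (t z) (X z) (Y z)) (at z)"
            using q by blast
        qed
      qed (use r in auto)
      also have "\<dots> = 0" by (simp add: sep_def separation_def t0 \<open>Y 0 = v 0\<close>)
      finally have "sep r \<le> 0" .
      then have z0: "X r = x (t r)" "lag_y (t r) (X r) (Y r) = lag_y (t r) (x (t r)) (v (t r))"
        by (auto simp: sep_def separation_def sum_power2_le_zero_iff)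
      obtain C where "\<And>t x1 x2 y1 y2. \<bar>y1\<bar> \<le> R \<and> \<bar>y2\<bar> \<le> R \<longrightarrow>
         \<bar>y1 - y2\<bar> \<le> C * (\<bar>x1 - x2\<bar> + \<bar>lag_y t x1 y1 - lag_y t x2 y2\<bar>)"
        using slope_estimate[of R] by blast
      from this[of "Y r" "v (t r)" "X r" "x (t r)" "t r"] show ?thesis
        using z0 R1[OF r] R0[of "t r"] by (auto simp: R_def)
    qed
    have tau: "\<tau> r = 1 / speed (t r)" if "r \<in> {0..s}" for r
      using lag1[OF pos[OF that]] agree[OF that] lag_pos[of "t r" "x (t r)" "v (t r)"] by (simp add: field_simps)
    have "S (t s) - s = S (t 0) - 0"
    proof (cases "s = 0")
      case False
      have d: "((\<lambda>r. S (t r) - r) has_real_derivative 0) (at r)" if r: "r \<in> {0..s}" for r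
      proof -
        have "((\<lambda>r. S (t r) - r) has_real_derivative speed (t r) * \<tau> r - 1) (at r)"
          by (intro derivative_intros DERIV_chain2[OF S(2) dt])
        then show ?thesis using tau[OF r] lag_pos[of "t r" "x (t r)" "v (t r)"] by simp
      qed
      show ?thesis
      proof (rule DERIV_isconst2[of 0 s "\<lambda>r. S (t r) - r"])
        show "continuous_on {0..s} (\<lambda>r. S (t r) - r)"
          by (intro continuous_at_imp_continuous_on ballI DERIV_isCont[OF d])
      qed (use d s False in auto)
    qed simp
    then have "S (t s) = s" using t0 S(1) by simp
    then have ts: "t s = T s" using T(1) by metis
    have s': "s \<in> {0..s}" using s by simp
    have "\<gamma> s = (t s, X s)" by (simp add: t_def X_def)
    moreover have "\<gamma>' s = \<tau> s *\<^sub>R (1, Y s)" by (rule slope[OF pos[OF s']])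
    ultimately show ?thesis using tau[OF s'] agree[OF s'] ts by simp
  qed
  have "0 < \<tau> s" if "0 \<le> s" for s
  proof (rule ccontr)
    assume "\<not> 0 < \<tau> s"
    \<comment> \<open>the first time at which positivity fails; before it, the velocity equals that of the trajectory, and by continuity also at this time\<close>
    define Z where "Z = {0..} \<inter> {r. \<tau> r \<le> 0}"
    have Z: "closed Z" "Z \<noteq> {}" "bdd_below Z"
      using \<open>\<not> 0 < \<tau> s\<close> that ct unfolding Z_def
      by (auto intro!: closed_Collect_le continuous_intros simp: not_less)
    define a where "a = Inf Z"
    have aZ: "a \<in> Z" unfolding a_def by (rule closed_contains_Inf[OF Z(2,3,1)])
    have below: "0 < \<tau> r" if "0 \<le> r" "r < a" for r
    proof (rule ccontr)
      assume "\<not> 0 < \<tau> r"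
      then have "r \<in> Z" using that by (simp add: Z_def)
      then have "a \<le> r" unfolding a_def by (rule cInf_lower[OF _ Z(3)])
      then show False using that by simp
    qed
    have "0 < \<tau> 0" using init lag_pos[of 0 "x 0" "v 0"] by (simp add: \<tau>_def)
    then have "0 < a" using aZ by (auto simp: Z_def less_le)
    define \<theta> where "\<theta> r = 1 / speed (T r)" for r
    have c\<theta>: "continuous_on UNIV \<theta>"
    proof -
      have c1: "continuous_on UNIV T" by (intro continuous_at_imp_continuous_on ballI DERIV_isCont[OF T(3)])
      have c2: "continuous_on UNIV x" by (intro continuous_at_imp_continuous_on ballI DERIV_isCont[OF curve_derivatives(1)])
      have c3: "continuous_on UNIV v" using curve unfolding lagrangian_curve_def by blast
      have "continuous_on UNIV (\<lambda>r. (T r, x (T r), v (T r)))"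
        by (intro continuous_intros c1 continuous_on_compose2[OF c2 c1] continuous_on_compose2[OF c3 c1]) auto
      from continuous_on_compose2[OF continuous_on_lag(1) this]
      have "continuous_on UNIV (\<lambda>r. speed (T r))" by simp
      then show ?thesis unfolding \<theta>_def[abs_def]
        using lag_pos by (intro continuous_intros) (auto simp: less_imp_neq[symmetric])
    qed
    have "closed {r. \<tau> r = \<theta> r}" by (intro closed_Collect_eq ct c\<theta>)
    moreover have "{0..<a} \<subseteq> {r. \<tau> r = \<theta> r}"
      using step below by (auto simp: \<theta>_def \<tau>_def)
    ultimately have "closure {0..<a} \<subseteq> {r. \<tau> r = \<theta> r}" by (rule closure_minimal[rotated])
    then have "\<tau> a = \<theta> a" using \<open>0 < a\<close> by (auto simp: subset_iff)
    then show False using aZ lag_pos[of "T a" "x (T a)" "v (T a)"] by (auto simp: Z_def \<theta>_def zero_less_divide_iff not_less)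
  qed
  then show ?thesis using step[OF s] by auto
qed

text \<open>The two components of the geodesic equation are the two laws in the notion of a Lagrangian curve.\<close>

lemma curve_is_geodesic:
  assumes T: "\<And>s. (T has_real_derivative 1 / speed (T s)) (at s)"
  defines "\<gamma> \<equiv> \<lambda>s. (T s, x (T s))"
    and "\<gamma>' \<equiv> \<lambda>s. (1 / speed (T s)) *\<^sub>R (1, v (T s))"
  shows "\<And>s. F (\<gamma> s) (\<gamma>' s) = 1" "euler_lagrange (energy F) \<gamma> \<gamma>'"
proof -
  define \<tau> where "\<tau> s = 1 / speed (T s)" for s
  have tau: "0 < \<tau> s" for s using lag_pos by (simp add: \<tau>_def)
  have g': "\<gamma>' s = \<tau> s *\<^sub>R (1, v (T s))" for s by (simp add: \<gamma>'_def \<tau>_def)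
  show unit: "F (\<gamma> s) (\<gamma>' s) = 1" for s
    unfolding g' F_at_slope[OF tau] using lag_pos[of "T s" "x (T s)" "v (T s)"] by (simp add: \<tau>_def \<gamma>_def)
  have dT: "(T has_real_derivative \<tau> s) (at s)" for s using T by (simp add: \<tau>_def)
  note ch = DERIV_chain2[OF curve_derivatives(1) dT] DERIV_chain2[OF curve_derivatives(2) dT] DERIV_chain2[OF curve_derivatives(3) dT]
  show "euler_lagrange (energy F) \<gamma> \<gamma>'"
    unfolding unit_speed_euler_lagrange[OF unit]
  proof (intro allI conjI)
    fix s
    show "(\<gamma> has_vector_derivative \<gamma>' s) (at s)"
      unfolding g' \<gamma>_def
      using has_vector_derivative_Pair[OF dT[unfolded has_real_derivative_iff_has_vector_derivative] ch(1)[unfolded has_real_derivative_iff_has_vector_derivative], of s]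
      by (simp add: mult.commute)
    fix w
    have "((\<lambda>r. fst w * (speed (T r) - v (T r) * lag_y (T r) (x (T r)) (v (T r))) + snd w * lag_y (T r) (x (T r)) (v (T r)))
       has_real_derivative fst w * (lag_t (T s) (x (T s)) (v (T s)) * \<tau> s) + snd w * (lag_x (T s) (x (T s)) (v (T s)) * \<tau> s)) (at s)"
      by (intro DERIV_add DERIV_cmult ch)
    then show "((\<lambda>r. dF (\<gamma> r, \<gamma>' r) (0, w)) has_real_derivative dF (\<gamma> s, \<gamma>' s) (w, 0)) (at s)"
      unfolding g' dF_at_slope[OF tau] by (simp add: \<gamma>_def algebra_simps)
  qed
qed

lemma geodesic_flow_curve:
  assumes S: "S 0 = 0" "\<And>t. (S has_real_derivative speed t) (at t)"
    and T: "\<And>t. T (S t) = t" "\<And>s. S (T s) = s"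
      "\<And>s. (T has_real_derivative 1 / speed (T s)) (at s)"
    and s: "0 \<le> s"
  shows "geodesic_flow F s ((0, x 0), (1 / speed 0) *\<^sub>R (1, v 0))
    = ((T s, x (T s)), (1 / speed (T s)) *\<^sub>R (1, v (T s)))"
  unfolding geodesic_flow_def
proof (rule the_equality)
  have T0: "T 0 = 0" using T(1)[of 0] S(1) by simp
  show "\<exists>\<gamma> \<gamma>'. euler_lagrange (energy F) \<gamma> \<gamma>' \<and> (\<forall>r. (\<gamma> r, \<gamma>' r) \<in> unit_tangent F) \<and>
      (\<gamma> 0, \<gamma>' 0) = ((0, x 0), (1 / speed 0) *\<^sub>R (1, v 0)) \<and>
      ((T s, x (T s)), (1 / speed (T s)) *\<^sub>R (1, v (T s))) = (\<gamma> s, \<gamma>' s)"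
    using curve_is_geodesic[OF T(3)] T0
    by (intro exI[of _ "\<lambda>s. (T s, x (T s))"] exI[of _ "\<lambda>s. (1 / speed (T s)) *\<^sub>R (1, v (T s))"])
      (auto simp: unit_tangent_def)
next
  fix z assume "\<exists>\<gamma> \<gamma>'. euler_lagrange (energy F) \<gamma> \<gamma>' \<and> (\<forall>r. (\<gamma> r, \<gamma>' r) \<in> unit_tangent F) \<and>
      (\<gamma> 0, \<gamma>' 0) = ((0, x 0), (1 / speed 0) *\<^sub>R (1, v 0)) \<and> z = (\<gamma> s, \<gamma>' s)"
  then obtain \<gamma> \<gamma>' where el: "euler_lagrange (energy F) \<gamma> \<gamma>'" and unit: "\<And>r. F (\<gamma> r) (\<gamma>' r) = 1"
    and init: "\<gamma> 0 = (0, x 0)" "\<gamma>' 0 = (1 / speed 0) *\<^sub>R (1, v 0)" and z: "z = (\<gamma> s, \<gamma>' s)"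
    by (auto simp: unit_tangent_def)
  show "z = ((T s, x (T s)), (1 / speed (T s)) *\<^sub>R (1, v (T s)))"
    using geodesic_follows_curve[OF S T unit el init s] z by simp
qed

text \<open>The time coordinate of the geodesic increases strictly, and its first positive integer value is \<open>1\<close>.\<close>

lemma return_map_curve: "return_map F (V0_chart F (x 0, v 0)) = V0_chart F (x 1, v 1)"
proof -
  obtain S T where S: "S 0 = 0" "\<And>t. (S has_real_derivative speed t) (at t)"
    and T: "\<And>t. T (S t) = t" "\<And>s. S (T s) = s"
      "\<And>s. (T has_real_derivative 1 / speed (T s)) (at s)" and sm: "strict_mono S"
    using curve_arclength by metis
  define p where "p = V0_chart F (x 0, v 0)"
  have p: "p = ((0, x 0), (1 / speed 0) *\<^sub>R (1, v 0))"
    by (simp add: p_def V0_chart_def lag_def)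
  note flow = geodesic_flow_curve[OF S T, folded p]
  have full: "geodesic_flow F s p \<in> V0_full F \<longleftrightarrow> T s \<in> \<int>" if "0 < s" for s
    using flow[of s] that lag_pos[of "T s" "x (T s)" "v (T s)"] curve_is_geodesic(1)[OF T(3), of s]
    by (auto simp: V0_full_def unit_tangent_def)
  have S1: "0 < S 1" using strict_monoD[OF sm, of 0 1] S(1) by simp
  have rt: "return_time F p = S 1"
    unfolding return_time_def
  proof (rule Least_equality)
    show "0 < S 1 \<and> geodesic_flow F (S 1) p \<in> V0_full F" using full[of "S 1"] S1 T(1) by simp
    fix s assume s: "0 < s \<and> geodesic_flow F s p \<in> V0_full F"
    then have "T s \<in> \<int>" using full by blast
    moreover have "0 < T s"
    proof (rule ccontr)
      assume "\<not> 0 < T s"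
      then have "S (T s) \<le> S 0" using sm by (simp add: strict_mono_less_eq)
      then show False using s S(1) T(2) by simp
    qed
    ultimately have "1 \<le> T s" by (auto elim!: Ints_cases)
    then have "S 1 \<le> S (T s)" using sm by (simp add: strict_mono_less_eq)
    then show "S 1 \<le> s" using T(2) by simp
  qed
  have "geodesic_flow F (S 1) p = ((1, x 1), (1 / lag 1 (x 1) (v 1)) *\<^sub>R (1, v 1))"
    using flow[of "S 1"] S1 T(1) by simp
  moreover have "lag 1 (x 1) (v 1) = lag 0 (x 1) (v 1)"
    using lag_periodic(1)[of 0 1 "x 1" 0 "v 1"] by simp
  ultimately have "return_map F p = ((0, x 1), (1 / lag 0 (x 1) (v 1)) *\<^sub>R (1, v 1))"
    by (simp add: return_map_def rt Let_def)
  then show ?thesis by (simp add: p_def V0_chart_def lag_def)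
qed

end

end

section \<open>Legendre duality\<close>

text \<open>At the midpoint the graph lies on or above the tangent and strictly below the chord.\<close>

lemma strictly_convex_above_tangent:
  assumes "strictly_convex h" "(h has_real_derivative d) (at a)" "a \<noteq> b"
  shows "h a + d * (b - a) < h b"
proof -
  have "convex_on UNIV h"
  proof (rule convex_onI)
    fix t x y :: real assume "0 < t" "t < 1"
    show "h ((1 - t) *\<^sub>R x + t *\<^sub>R y) \<le> (1 - t) * h x + t * h y"
    proof (cases "x = y")
      case False
      then have "h ((1 - t) * x + t * y) < (1 - t) * h x + t * h y"
        using assms(1) \<open>0 < t\<close> \<open>t < 1\<close> unfolding strictly_convex_def by blast
      then show ?thesis by simp
    qed (simp add: algebra_simps)
  qed simp
  then have "d * ((a + b) / 2 - a) \<le> h ((a + b) / 2) - h a"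
    by (rule convex_on_imp_above_tangent) (use assms(2) in auto)
  moreover have "h ((1 - 1/2) * a + 1/2 * b) < (1 - 1/2) * h a + 1/2 * h b"
    using assms(1,3) unfolding strictly_convex_def by (smt (verit) divide_less_eq_1_pos zero_less_divide_1_iff)
  moreover have "(1 - 1/2) * a + 1/2 * b = (a + b) / 2" "d * ((a + b) / 2 - a) = d * (b - a) / 2"
    by (simp_all add: field_simps)
  ultimately show ?thesis by (simp add: field_simps)
qed

lemma cyl_eq_iff: "cyl p = cyl q \<longleftrightarrow> (\<exists>k::int. p = q + (of_int k, 0))"
proof -
  have "cis (2 * pi * a) = cis (2 * pi * b) \<longleftrightarrow> (\<exists>k::int. a = b + of_int k)" for a b
  proof -
    have "cis (2 * pi * a) = cis (2 * pi * b) \<longleftrightarrow> (\<exists>k::int. 2 * pi * a = 2 * pi * b + 2 * pi * of_int k)"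
      using sin_cos_eq_iff[of "2 * pi * a" "2 * pi * b"] by (auto simp: complex_eq_iff)
    also have "\<dots> \<longleftrightarrow> (\<exists>k::int. a = b + of_int k)"
      by (simp flip: distrib_left)
    finally show ?thesis .
  qed
  then show ?thesis by (auto simp: cyl_def prod_eq_iff)
qed

lemma has_vector_derivative_within_Un:
  assumes "(c has_vector_derivative d) (at x within S)" "(c has_vector_derivative d) (at x within T)"
  shows "(c has_vector_derivative d) (at x within (S \<union> T))"
  using assms unfolding has_vector_derivative_def has_derivative_iff_norm
  by (auto intro: Lim_within_Un[THEN iffD2])

locale tonelli_hamiltonian =
  fixes H :: "real \<Rightarrow> real \<Rightarrow> real \<Rightarrow> real" and M Dp Dm :: real
  assumes smooth: "smooth_on UNIV (\<lambda>(t, x, y). H t x y)"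
    and periodic: "\<And>t x y. H (t + 1) x y = H t x y" "\<And>t x y. H t (x + 1) y = H t x y"
    and convex: "\<And>t x. strictly_convex (H t x)"
    and ends: "\<And>t x y. y > M \<Longrightarrow> H t x y = y\<^sup>2 / 2 + Dp" "\<And>t x y. y < - M \<Longrightarrow> H t x y = y\<^sup>2 / 2 + Dm"
begin

definition dH where "dH t x y = frechet_derivative (\<lambda>(t, x, y). H t x y) (at (t, x, y))"
definition Ht where "Ht t x y = dH t x y (1, 0, 0)"
definition Hx where "Hx t x y = dH t x y (0, 1, 0)"
definition Hy where "Hy t x y = dH t x y (0, 0, 1)"

lemma dH_coords: "dH t x y (a, b, c) = a * Ht t x y + b * Hx t x y + c * Hy t x y"
proof -
  have lin: "linear (dH t x y)" unfolding dH_def by (rule smooth_on_linear[OF smooth]) simp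
  have "(a, b, c) = a *\<^sub>R (1, 0, 0) + b *\<^sub>R (0, 1, 0) + c *\<^sub>R (0, 0, 1 :: real)" by simp
  then have "dH t x y (a, b, c) = dH t x y (a *\<^sub>R (1, 0, 0) + b *\<^sub>R (0, 1, 0) + c *\<^sub>R (0, 0, 1))" by simp
  also have "\<dots> = a * Ht t x y + b * Hx t x y + c * Hy t x y"
    unfolding linear_add[OF lin] linear_scale[OF lin] by (simp add: Ht_def Hx_def Hy_def)
  finally show ?thesis .
qed

lemma H_has_derivative:
  "((\<lambda>(t, x, y). H t x y) has_derivative (\<lambda>(a, b, c). a * Ht t x y + b * Hx t x y + c * Hy t x y)) (at (t, x, y))"
  using smooth_on_has_derivative[OF smooth, of "(t, x, y)"] unfolding dH_def[symmetric]
  by (simp add: dH_coords[symmetric] case_prod_unfold)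

lemma H_chain:
  assumes "(t has_real_derivative t') (at s)" "(x has_real_derivative x') (at s)" "(y has_real_derivative y') (at s)"
  shows "((\<lambda>s. H (t s) (x s) (y s)) has_real_derivative
    t' * Ht (t s) (x s) (y s) + x' * Hx (t s) (x s) (y s) + y' * Hy (t s) (x s) (y s)) (at s)"
proof -
  have "((\<lambda>s. (t s, x s, y s)) has_derivative (\<lambda>h. (t' * h, x' * h, y' * h))) (at s)"
    using assms unfolding has_field_derivative_def by (intro has_derivative_Pair) auto
  from has_derivative_compose[OF this H_has_derivative]
  have "((\<lambda>s. H (t s) (x s) (y s)) has_derivative (\<lambda>h. t' * h * Ht (t s) (x s) (y s) + x' * h * Hx (t s) (x s) (y s) + y' * h * Hy (t s) (x s) (y s))) (at s)"
    by simp
  then show ?thesis by (rule has_derivative_imp_has_field_derivative) (simp add: algebra_simps)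
qed

lemma H_partial:
  "(H t x has_real_derivative Hy t x y) (at y)"
  "((\<lambda>x. H t x y) has_real_derivative Hx t x y) (at x)"
  using H_chain[of "\<lambda>_. t" 0 y "\<lambda>_. x" 0 "\<lambda>s. s" 1] H_chain[of "\<lambda>_. t" 0 x "\<lambda>s. s" 1 "\<lambda>_. y" 0] by auto

lemma continuous_on_H_partials:
  "continuous_on UNIV (\<lambda>(t, x, y). Hy t x y)" "continuous_on UNIV (\<lambda>(t, x, y). Hx t x y)"
  using smooth_on_imp_continuous_on[OF smooth_on_frechet_derivative[OF smooth]]
  by (simp_all add: Hy_def Hx_def dH_def case_prod_unfold)

lemma H_periodic_int: "H (t + of_int m) (x + of_int n) y = H t x y"
proof -
  have 1: "H (t + of_int m) x y = H t x y" for t x y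
  proof (induction m rule: int_induct[of _ 0])
    case (step1 i) then show ?case using periodic(1)[of "t + of_int i" x y] by (simp add: algebra_simps)
  next
    case (step2 i) then show ?case using periodic(1)[of "t + of_int (i - 1)" x y] by (simp add: algebra_simps)
  qed simp
  have "H t (x + of_int n) y = H t x y" for t x y
  proof (induction n rule: int_induct[of _ 0])
    case (step1 i) then show ?case using periodic(2)[of t "x + of_int i" y] by (simp add: algebra_simps)
  next
    case (step2 i) then show ?case using periodic(2)[of t "x + of_int (i - 1)" y] by (simp add: algebra_simps)
  qed simp
  then show ?thesis using 1 by simp
qed

lemma partials_periodic:
  fixes m n :: int
  shows "Hy (t + of_int m) (x + of_int n) y = Hy t x y" "Hx (t + of_int m) (x + of_int n) y = Hx t x y"
proof -
  have "((\<lambda>y. H (t + of_int m) (x + of_int n) y) has_real_derivative Hy (t + of_int m) (x + of_int n) y) (at y)"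
    by (rule H_partial)
  then show "Hy (t + of_int m) (x + of_int n) y = Hy t x y"
    unfolding H_periodic_int using H_partial(1) DERIV_unique by blast
  have "((\<lambda>x. H (t + of_int m) (x + of_int n) y) has_real_derivative Hx (t + of_int m) (x + of_int n) y) (at x)"
  proof -
    have "((\<lambda>x. x + of_int n) has_real_derivative 1) (at x)" by (auto intro!: derivative_eq_intros)
    from H_chain[of "\<lambda>_. t + of_int m" 0 x, OF _ this, of "\<lambda>_. y" 0] show ?thesis by simp
  qed
  then show "Hx (t + of_int m) (x + of_int n) y = Hx t x y"
    unfolding H_periodic_int using H_partial(2) DERIV_unique by blast
qed

lemma above_tangent: "a \<noteq> b \<Longrightarrow> H t x a + Hy t x a * (b - a) < H t x b"
  by (rule strictly_convex_above_tangent[OF convex H_partial(1)])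

lemma Hy_strict_mono: "a < b \<Longrightarrow> Hy t x a < Hy t x b"
  using above_tangent[of a b t x] above_tangent[of b a t x]
  by (smt (verit, best) mult_le_cancel_right right_diff_distrib minus_mult_right)

lemma Hy_inj: "Hy t x a = Hy t x b \<Longrightarrow> a = b"
  using Hy_strict_mono[of a b t x] Hy_strict_mono[of b a t x] by (cases a b rule: linorder_cases) auto

lemma Hy_surj: "\<exists>y. Hy t x y = v"
proof -
  \<comment> \<open>at \<open>\<plusminus> b\<close> the Hamiltonian is quadratic, where \<open>\<partial>\<^sub>yH = y\<close>\<close>
  define b where "b = \<bar>v\<bar> + \<bar>M\<bar> + 1"
  have e: "Hy t x y = y" if "\<bar>M\<bar> < \<bar>y\<bar>" for y
  proof -
    have *: "H t x z = z\<^sup>2 / 2 + (if 0 < z then Dp else Dm)" if "\<bar>M\<bar> < \<bar>z\<bar>" for z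
      using ends[of z t x] that by (cases "0 < z") auto
    have "((\<lambda>z. z\<^sup>2 / 2 + (if 0 < y then Dp else Dm)) has_real_derivative y) (at y)"
      by (auto intro!: derivative_eq_intros)
    then have "(H t x has_real_derivative y) (at y)"
      by (rule has_field_derivative_transform_within_open[where S = "if 0 < y then {\<bar>M\<bar><..} else {..<- \<bar>M\<bar>}"])
        (use * that in \<open>auto split: if_splits\<close>)
    then show ?thesis using H_partial(1) DERIV_unique by blast
  qed
  have "continuous_on UNIV (\<lambda>y. (t, x, y))" by (intro continuous_intros)
  from continuous_on_compose2[OF continuous_on_H_partials(1) this]
  have "continuous_on UNIV (Hy t x)" by simp
  moreover have "Hy t x (- b) \<le> v" "v \<le> Hy t x b" using e[of b] e[of "- b"] by (auto simp: b_def)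
  ultimately show ?thesis
    using IVT'[of "Hy t x" "- b" v b] continuous_on_subset[of UNIV "Hy t x" "{-b..b}"] by (auto simp: b_def)
qed

lemma legendre_at: "legendre H t x (Hy t x y) = Hy t x y * y - H t x y"
proof -
  have "deriv (H t x) y = Hy t x y" for y using H_partial(1) by (rule DERIV_imp_deriv)
  then have "(THE z. deriv (H t x) z = Hy t x y) = y" using Hy_inj by (intro the_equality) auto
  then show ?thesis by (simp add: legendre_def)
qed

lemma fenchel: "v * y - H t x y \<le> legendre H t x v"
proof -
  obtain z where z: "Hy t x z = v" using Hy_surj by blast
  have "H t x z + v * (y - z) \<le> H t x y" using above_tangent[of z y t x] z by (cases "y = z") auto
  then show ?thesis using legendre_at[of t x z] z by (simp add: algebra_simps)
qed

text \<open>
  Envelope principle: the gap in the Fenchel inequality for fixed \<open>y\<close> is minimal where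
  equality holds, so its derivative vanishes there. Differentiability of the Legendre transform thus replaces
  the implicit function theorem, which would require a nondegenerate Hessian of \<open>H\<close>.
\<close>

lemma legendre_derivative:
  assumes U: "open U" "(t, x, Hy t x y) \<in> U"
    and eq: "\<And>t x v. (t, x, v) \<in> U \<Longrightarrow> G t x v = legendre H t x v"
    and D: "((\<lambda>(t, x, v). G t x v) has_derivative (\<lambda>(a, b, c). a * Gt + b * Gx + c * Gv)) (at (t, x, Hy t x y))"
  shows "Gt = - Ht t x y" "Gx = - Hx t x y" "Gv = y"
proof -
  define v where "v = Hy t x y"
  define gap where "gap p = (case p of (t, x, v) \<Rightarrow> G t x v) + (case p of (t, x, v) \<Rightarrow> H t x y - v * y)" for p
  have "((\<lambda>p. (fst p, fst (snd p), y)) has_derivative (\<lambda>h. (fst h, fst (snd h), 0))) (at (t, x, v))"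
    by (auto intro!: derivative_eq_intros)
  then have "((\<lambda>p. (\<lambda>(t, x, y). H t x y) (fst p, fst (snd p), y)) has_derivative
      (\<lambda>h. (\<lambda>(a, b, c). a * Ht t x y + b * Hx t x y + c * Hy t x y) (fst h, fst (snd h), 0))) (at (t, x, v))"
    by (rule has_derivative_compose) (use H_has_derivative[of t x y] in simp)
  then have "(gap has_derivative (\<lambda>h. (case h of (a, b, c) \<Rightarrow> a * Gt + b * Gx + c * Gv)
      + (fst h * Ht t x y + fst (snd h) * Hx t x y - snd (snd h) * y))) (at (t, x, v))"
    unfolding gap_def[abs_def] v_def case_prod_unfold
    by (intro has_derivative_add D[unfolded case_prod_unfold] has_derivative_diff) (auto intro!: derivative_eq_intros)
  moreover have "gap (t, x, v) = 0" using legendre_at[of t x y] eq U(2) by (simp add: gap_def v_def)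
  moreover have "0 \<le> gap p" if "p \<in> U" for p
    using that eq fenchel[of "snd (snd p)" y "fst p" "fst (snd p)"] by (cases p) (auto simp: gap_def)
  ultimately have "(\<lambda>h. (case h of (a, b, c) \<Rightarrow> a * Gt + b * Gx + c * Gv)
      + (fst h * Ht t x y + fst (snd h) * Hx t x y - snd (snd h) * y)) = (\<lambda>h. 0)"
    by (intro differential_zero_maxmin[OF U(2)[folded v_def] U(1), of gap]) auto
  from fun_cong[OF this, of "(1, 0, 0)"] fun_cong[OF this, of "(0, 1, 0)"] fun_cong[OF this, of "(0, 0, 1)"]
  show "Gt = - Ht t x y" "Gx = - Hx t x y" "Gv = y" by auto
qed

section \<open>Hamiltonian trajectories\<close>

lemma hamiltonian_curve_iff:
  "hamiltonian_curve H c \<longleftrightarrow> (\<forall>t\<in>{0..1}. (c has_vector_derivative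
      (Hy t (fst (c t)) (snd (c t)), - Hx t (fst (c t)) (snd (c t)))) (at t within {0..1}))"
  unfolding hamiltonian_curve_def using DERIV_imp_deriv[OF H_partial(1)] DERIV_imp_deriv[OF H_partial(2)] by simp

definition trajectory :: "(real \<Rightarrow> plane) \<Rightarrow> bool" where
  "trajectory c \<longleftrightarrow> (\<forall>t. (c has_vector_derivative (Hy t (fst (c t)) (snd (c t)), - Hx t (fst (c t)) (snd (c t)))) (at t))"

text \<open>
  Trajectories over unit time, one ending where the next begins, are concatenated. By periodicity in time,
  the equation is the same on every unit interval.
\<close>

lemma trajectory_through:
  assumes fwd: "\<And>p. \<exists>c. hamiltonian_curve H c \<and> c 0 = p" and bwd: "\<And>q. \<exists>c. hamiltonian_curve H c \<and> c 1 = q"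
  shows "\<exists>c. trajectory c \<and> c 0 = p"
proof -
  define E where "E p q \<longleftrightarrow> (\<exists>c. hamiltonian_curve H c \<and> c 0 = p \<and> c 1 = q)" for p q
  have "\<exists>q. E p q" for p using fwd[of p] unfolding E_def by blast
  then obtain nxt where nxt: "\<And>p. E p (nxt p)" by metis
  have "\<exists>p. E p q" for q using bwd[of q] unfolding E_def by blast
  then obtain prv where prv: "\<And>q. E (prv q) q" by metis
  define P where "P n = (if 0 \<le> n then (nxt ^^ nat n) p else (prv ^^ nat (- n)) p)" for n :: int
  have "E (P n) (P (n + 1))" for n
  proof (cases "0 \<le> n")
    case True
    then have "nat (n + 1) = Suc (nat n)" by simp
    then show ?thesis using True nxt by (simp add: P_def)
  next
    case False
    then have "nat (- n) = Suc (nat (- (n + 1)))" by simp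
    moreover have "P (n + 1) = (prv ^^ nat (- (n + 1))) p" using False by (cases "n = -1") (auto simp: P_def)
    ultimately show ?thesis using False prv by (simp add: P_def)
  qed
  then obtain C where C: "\<And>n. hamiltonian_curve H (C n)" "\<And>n. C n 0 = P n" "\<And>n. C n 1 = P (n + 1)"
    unfolding E_def by metis
  define c where "c t = C \<lfloor>t\<rfloor> (t - of_int \<lfloor>t\<rfloor>)" for t
  have c_eq: "c t = C n (t - of_int n)" if "of_int n \<le> t" "t \<le> of_int n + 1" for t n
  proof (cases "t = of_int n + 1")
    case True
    then have "\<lfloor>t\<rfloor> = n + 1" by linarith
    then show ?thesis using True C by (simp add: c_def)
  next
    case False
    then have "\<lfloor>t\<rfloor> = n" using that by linarith
    then show ?thesis by (simp add: c_def)
  qed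
  define V where "V t = (Hy t (fst (c t)) (snd (c t)), - Hx t (fst (c t)) (snd (c t)))" for t
  have W: "(c has_vector_derivative V t) (at t within {of_int n..of_int n + 1})"
    if t: "of_int n \<le> t" "t \<le> of_int n + 1" for t n
  proof -
    define s where "s = t - of_int n"
    have s: "s \<in> {0..1}" using t by (simp add: s_def)
    have "(C n has_vector_derivative (Hy s (fst (C n s)) (snd (C n s)), - Hx s (fst (C n s)) (snd (C n s)))) (at s within {0..1})"
      using C(1) s unfolding hamiltonian_curve_iff by blast
    moreover have "C n s = c t" using c_eq[OF t] by (simp add: s_def)
    moreover have "Hy s x y = Hy t x y" "Hx s x y = Hx t x y" for x y
      using partials_periodic[of s n x 0 y] by (simp_all add: s_def)
    ultimately have "(C n has_vector_derivative V t) (at s within {0..1})" by (simp add: V_def)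
    moreover have "(\<lambda>t. t - of_int n) ` {of_int n..of_int n + 1 :: real} = {0..1}"
      by (simp add: image_affinity_atLeastAtMost_diff[of 1, simplified])
    moreover have "((\<lambda>t. t - of_int n) has_vector_derivative 1) (at t within {of_int n..of_int n + 1})"
      by (auto intro!: derivative_eq_intros)
    ultimately have "(C n \<circ> (\<lambda>t. t - of_int n) has_vector_derivative 1 *\<^sub>R V t) (at t within {of_int n..of_int n + 1})"
      by (intro vector_diff_chain_within) (simp_all add: s_def)
    then have D: "(C n \<circ> (\<lambda>t. t - of_int n) has_vector_derivative V t) (at t within {of_int n..of_int n + 1})"
      by simp
    show ?thesis by (rule has_vector_derivative_transform[OF _ _ D]) (use t c_eq in auto)
  qed
  have "(c has_vector_derivative V t) (at t)" for t
  proof (cases "t = of_int \<lfloor>t\<rfloor>")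
    case True
    define n where "n = \<lfloor>t\<rfloor>"
    have t: "t = of_int n" using True by (simp add: n_def)
    have "(c has_vector_derivative V t) (at t within {of_int (n - 1)..of_int (n - 1) + 1} \<union> {of_int n..of_int n + 1})"
      by (intro has_vector_derivative_within_Un W) (auto simp: t)
    moreover have "{of_int (n - 1)..of_int (n - 1) + 1} \<union> {of_int n..of_int n + 1} = {t - 1..t + 1}"
      by (auto simp: t)
    ultimately have "(c has_vector_derivative V t) (at t within {t - 1..t + 1})" by (simp only:)
    moreover have "at t within {t - 1..t + 1} = at t" by (rule at_within_interior) simp
    ultimately show ?thesis by (simp only:)
  next
    case False
    then have t: "of_int \<lfloor>t\<rfloor> < t" "t < of_int \<lfloor>t\<rfloor> + 1" by linarith+
    then have "at t within {of_int \<lfloor>t\<rfloor>..of_int \<lfloor>t\<rfloor> + 1} = at t"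
      by (intro at_within_interior) simp
    then show ?thesis using W[of "\<lfloor>t\<rfloor>" t] t by (simp only: less_imp_le)
  qed
  then have "trajectory c" by (simp add: trajectory_def V_def)
  moreover have "c 0 = p" using C(2)[of 0] by (simp add: c_def P_def)
  ultimately show ?thesis by blast
qed

lemma trajectory_components:
  assumes "trajectory c"
  shows "((\<lambda>t. fst (c t)) has_real_derivative Hy t (fst (c t)) (snd (c t))) (at t)"
    "((\<lambda>t. snd (c t)) has_real_derivative - Hx t (fst (c t)) (snd (c t))) (at t)"
  using bounded_linear.has_vector_derivative[OF bounded_linear_fst, of c] bounded_linear.has_vector_derivative[OF bounded_linear_snd, of c]
    assms unfolding trajectory_def has_real_derivative_iff_has_vector_derivative by fastforce+

text \<open>The set of times at which the momentum has its value at \<open>t0\<close> is closed, and it is open since the force vanishes on \<open>W\<close>.\<close>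

lemma momentum_conserved:
  assumes c: "trajectory c" and W: "open W" "\<And>t x y. y \<in> W \<Longrightarrow> Hx t x y = 0" and in0: "snd (c t0) \<in> W"
  shows "snd (c t) = snd (c t0)"
proof -
  define p where "p t = snd (c t)" for t
  have dp: "(p has_real_derivative - Hx t (fst (c t)) (p t)) (at t)" for t
    unfolding p_def[abs_def] by (rule trajectory_components(2)[OF c])
  have cp: "continuous_on UNIV p" by (intro continuous_at_imp_continuous_on ballI DERIV_isCont[OF dp])
  define Z where "Z = {t. p t = p t0}"
  have "closed Z" unfolding Z_def by (intro closed_Collect_eq cp continuous_on_const)
  moreover have "open Z" unfolding open_dist
  proof
    fix z assume "z \<in> Z"
    \<comment> \<open>near a time with momentum in \<open>W\<close> the momentum is locally constant\<close>
    have "open (p -` W)" using open_vimage[OF W(1) cp] .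
    moreover have "z \<in> p -` W" using \<open>z \<in> Z\<close> in0 by (simp add: Z_def p_def)
    ultimately obtain e where e: "0 < e" "ball z e \<subseteq> p -` W" unfolding open_contains_ball by blast
    have "\<exists>k. \<forall>t\<in>ball z e. p t = k"
    proof (rule has_field_derivative_zero_constant)
      fix t assume "t \<in> ball z e"
      then have "p t \<in> W" using e by blast
      then have "(p has_real_derivative 0) (at t)" using dp[of t] W(2) by simp
      then show "(p has_real_derivative 0) (at t within ball z e)" by (rule has_field_derivative_at_within)
    qed simp
    then obtain k where k: "\<And>t. t \<in> ball z e \<Longrightarrow> p t = k" by blast
    have "p t = p t0" if "t \<in> ball z e" for t
      using k[OF that] k[of z] e(1) \<open>z \<in> Z\<close> by (simp add: Z_def)
    then show "\<exists>e>0. \<forall>y. dist y z < e \<longrightarrow> y \<in> Z" using e(1) by (auto simp: Z_def dist_commute)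
  qed
  moreover have "t0 \<in> Z" by (simp add: Z_def)
  ultimately have "Z = UNIV" using connected_clopen[of "UNIV :: real set"] by auto
  then show ?thesis by (auto simp: Z_def p_def)
qed

end

section \<open>The return map is the time-one map in Legendre coordinates\<close>

lemma smooth_on_add_const:
  assumes "smooth_on UNIV f"
  shows "smooth_on UNIV (\<lambda>p. f p + e)"
  unfolding smooth_on_def
proof
  have D: "((\<lambda>p. f p + e) has_derivative frechet_derivative f (at p)) (at p)" for p
    using smooth_on_has_derivative[OF assms, of p] by (auto intro!: derivative_eq_intros)
  fix k show "Ck_on k UNIV (\<lambda>p. f p + e)"
  proof (cases k)
    case 0
    then show ?thesis using smooth_on_imp_continuous_on[OF assms] by (auto intro!: continuous_intros)
  next
    case (Suc n)
    have "Ck_on (Suc n) UNIV f" using assms by (simp only: smooth_on_def)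
    then show ?thesis using D unfolding Suc by (auto simp: frechet_derivative_at[OF D, symmetric] differentiable_def)
  qed
qed

text \<open>
  A Finsler metric whose Lagrangian is the Legendre transform of \<open>H\<close> up to slope \<open>D + 1\<close> and is independent of
  \<open>(t, x)\<close> from slope \<open>D\<close> on. The two ranges overlap, so every slope is interior to one
  of them and derivatives can be computed there.
\<close>

locale island_torus = finsler_torus F + ham: tonelli_hamiltonian H M Dp Dm
  for F :: "plane \<Rightarrow> plane \<Rightarrow> real" and H M Dp Dm +
  fixes f :: "plane \<Rightarrow> plane" and D :: real
  assumes twist: "twist_map f" and time_one: "time_one_map H f"
    and legendre_ends: "\<And>t x v. v > D \<Longrightarrow> legendre H t x v = v\<^sup>2 / 2 - Dp"
      "\<And>t x v. v < - D \<Longrightarrow> legendre H t x v = v\<^sup>2 / 2 - Dm"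
    and lag_inner: "\<And>t x v. \<bar>v\<bar> < D + 1 \<Longrightarrow> lag t x v = legendre H t x v"
    and lag_outer: "\<And>t x v. D < \<bar>v\<bar> \<Longrightarrow> lag t x v = lag 0 0 v"
begin

text \<open>Legendre duality where \<open>L\<close> is the Legendre transform.\<close>

lemma dual_inner:
  assumes "\<bar>ham.Hy t x y\<bar> < D + 1"
  shows "lag_t t x (ham.Hy t x y) = - ham.Ht t x y" "lag_x t x (ham.Hy t x y) = - ham.Hx t x y"
    "lag_y t x (ham.Hy t x y) = y"
proof -
  define U where "U = {p :: real \<times> real \<times> real. \<bar>snd (snd p)\<bar> < D + 1}"
  have U: "open U" unfolding U_def by (intro open_Collect_less continuous_intros)
  have "(t, x, ham.Hy t x y) \<in> U" using assms by (simp add: U_def)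
  moreover have "lag t x v = legendre H t x v" if "(t, x, v) \<in> U" for t x v
    using that lag_inner by (simp add: U_def)
  ultimately show "lag_t t x (ham.Hy t x y) = - ham.Ht t x y" "lag_x t x (ham.Hy t x y) = - ham.Hx t x y"
    "lag_y t x (ham.Hy t x y) = y"
    using ham.legendre_derivative[OF U _ _ lag_has_derivative] by blast+
qed

text \<open>Legendre duality where the Legendre transform is quadratic.\<close>

lemma dual_outer:
  assumes "D < \<bar>ham.Hy t x y\<bar>"
  shows "ham.Hy t x y = y" "ham.Hx t x y = 0"
proof -
  define v where "v = ham.Hy t x y"
  have quad: "((\<lambda>(t, x, v). v\<^sup>2 / 2 - k) has_derivative (\<lambda>(a, b, c). a * 0 + b * 0 + c * v)) (at (t, x, v))" for k
    unfolding case_prod_unfold by (auto intro!: derivative_eq_intros)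
  have "v = y \<and> 0 = - ham.Hx t x y"
  proof (cases "D < v")
    case True
    have o: "open {(t :: real, x :: real, v). D < v}"
      unfolding case_prod_unfold by (intro open_Collect_less continuous_intros)
    show ?thesis
      using ham.legendre_derivative[OF o _ _ quad[of Dp, unfolded v_def]] True legendre_ends(1) by (simp add: v_def)
  next
    case False
    then have neg: "v < - D" using assms by (auto simp: v_def)
    have o: "open {(t :: real, x :: real, v). v < - D}"
      unfolding case_prod_unfold by (intro open_Collect_less continuous_intros)
    show ?thesis
      using ham.legendre_derivative[OF o _ _ quad[of Dm, unfolded v_def]] neg legendre_ends(2) by (simp add: v_def)
  qed
  then show "ham.Hy t x y = y" "ham.Hx t x y = 0" by (auto simp: v_def)
qed

lemma velocity_outer:
  assumes "D < \<bar>y\<bar>"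
  shows "ham.Hy t x y = y"
proof -
  obtain z where "ham.Hy t x z = y" using ham.Hy_surj by blast
  then show ?thesis using dual_outer(1)[of t x z] assms by auto
qed

lemma force_outer: "D < \<bar>y\<bar> \<Longrightarrow> ham.Hx t x y = 0"
  using velocity_outer dual_outer(2) by simp

lemma velocity_inner: "\<bar>y\<bar> \<le> D \<Longrightarrow> \<bar>ham.Hy t x y\<bar> \<le> D"
  using dual_outer(1)[of t x y] by linarith

lemma lag_outer_derivatives:
  assumes "D < \<bar>v\<bar>"
  shows "lag_x t x v = 0" "lag_t t x v = 0" "lag_y t x v = lag_y 0 0 v"
proof -
  have o: "open {(t :: real, x :: real, v). D < \<bar>v\<bar>}"
    unfolding case_prod_unfold by (intro open_Collect_less continuous_intros)
  have "((\<lambda>p :: real \<times> real \<times> real. (0, 0, snd (snd p))) has_derivative (\<lambda>h. (0, 0, snd (snd h)))) (at (t, x, v))"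
    by (auto intro!: derivative_eq_intros)
  then have "((\<lambda>p. (\<lambda>(t, x, y). lag t x y) (0, 0, snd (snd p))) has_derivative
      (\<lambda>h. (\<lambda>(a, b, c). a * lag_t 0 0 v + b * lag_x 0 0 v + c * lag_y 0 0 v) (0, 0, snd (snd h)))) (at (t, x, v))"
    by (rule has_derivative_compose) (use lag_has_derivative[of 0 0 v] in simp)
  then have "((\<lambda>p. lag 0 0 (snd (snd p))) has_derivative (\<lambda>h. snd (snd h) * lag_y 0 0 v)) (at (t, x, v))"
    by simp
  then have "((\<lambda>(t, x, y). lag t x y) has_derivative (\<lambda>h. snd (snd h) * lag_y 0 0 v)) (at (t, x, v))"
  proof (rule has_derivative_transform_within_open[OF _ o])
    fix p :: "real \<times> real \<times> real" assume "p \<in> {(t, x, v). D < \<bar>v\<bar>}"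
    then show "lag 0 0 (snd (snd p)) = (case p of (t, x, v) \<Rightarrow> lag t x v)"
      using lag_outer[of "snd (snd p)" "fst p" "fst (snd p)"] by (simp add: case_prod_unfold)
  qed (use assms in simp)
  from has_derivative_unique[OF lag_has_derivative this]
  have *: "(\<lambda>(a, b, c). a * lag_t t x v + b * lag_x t x v + c * lag_y t x v) = (\<lambda>h. snd (snd h) * lag_y 0 0 v)" .
  show "lag_x t x v = 0" "lag_t t x v = 0" "lag_y t x v = lag_y 0 0 v"
    using fun_cong[OF *, of "(1, 0, 0)"] fun_cong[OF *, of "(0, 1, 0)"] fun_cong[OF *, of "(0, 0, 1)"] by auto
qed

lemma trajectory_momentum:
  assumes "ham.trajectory c" "D < \<bar>snd (c s)\<bar>"
  shows "snd (c t) = snd (c s)"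
proof (rule ham.momentum_conserved[OF assms(1)])
  show "open {y. D < \<bar>y\<bar>}" by (intro open_Collect_less continuous_intros)
qed (use assms(2) force_outer in auto)

text \<open>
  Beyond slope \<open>D\<close> the Lagrangian was changed, but there both the old and the new one are free of \<open>t\<close>
  and \<open>x\<close>, so the trajectories are the same straight lines.
\<close>

lemma trajectory_is_lagrangian_curve:
  assumes c: "ham.trajectory c"
  shows "lagrangian_curve (\<lambda>t. fst (c t)) (\<lambda>t. ham.Hy t (fst (c t)) (snd (c t)))"
    and "\<bar>ham.Hy t (fst (c t)) (snd (c t))\<bar> \<le> max D \<bar>snd (c 0)\<bar>"
proof -
  define x p v where "x t = fst (c t)" and "p t = snd (c t)" and "v t = ham.Hy t (fst (c t)) (snd (c t))" for t
  have dx: "(x has_real_derivative v t) (at t)" for t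
    unfolding x_def[abs_def] v_def by (rule ham.trajectory_components(1)[OF c])
  have dp: "(p has_real_derivative - ham.Hx t (x t) (p t)) (at t)" for t
    unfolding p_def[abs_def] x_def by (rule ham.trajectory_components(2)[OF c])
  have cx: "continuous_on UNIV x" and cp: "continuous_on UNIV p"
    by (intro continuous_at_imp_continuous_on ballI DERIV_isCont[OF dx] DERIV_isCont[OF dp])+
  have "continuous_on UNIV (\<lambda>t. (t, x t, p t))" by (intro continuous_intros cx cp)
  from continuous_on_compose2[OF ham.continuous_on_H_partials(1) this]
  have cv: "continuous_on UNIV v" by (simp add: v_def[abs_def] x_def p_def case_prod_unfold)
  have bound: "\<bar>v t\<bar> \<le> max D \<bar>p 0\<bar>" for t
  proof (cases "\<bar>p t\<bar> \<le> D")
    case True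
    then show ?thesis using velocity_inner[of "p t" t "x t"] by (simp add: v_def x_def p_def)
  next
    case False
    then have "p 0 = p t" "v t = p t"
      using trajectory_momentum[OF c, of t 0] velocity_outer[of "p t" t "x t"] by (auto simp: p_def v_def x_def)
    then show ?thesis by simp
  qed
  then show "\<bar>ham.Hy t (fst (c t)) (snd (c t))\<bar> \<le> max D \<bar>snd (c 0)\<bar>" by (simp add: v_def p_def)
  have "(x has_real_derivative v t) (at t) \<and>
          ((\<lambda>t. lag_y t (x t) (v t)) has_real_derivative lag_x t (x t) (v t)) (at t) \<and>
          ((\<lambda>t. lag t (x t) (v t) - v t * lag_y t (x t) (v t)) has_real_derivative lag_t t (x t) (v t)) (at t)" for t
  proof (cases "\<exists>s. D < \<bar>p s\<bar>")
    case True
    then obtain s where s: "D < \<bar>p s\<bar>" by blast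
    then have pp: "p t = p s" for t using trajectory_momentum[OF c, of s t] by (simp add: p_def)
    have vv: "v t = p s" for t using velocity_outer[OF s, of t "x t"] pp[of t] by (simp add: v_def p_def x_def)
    have "lag_y t (x t) (v t) = lag_y 0 0 (p s)" "lag t (x t) (v t) = lag 0 0 (p s)"
      "lag_x t (x t) (v t) = 0" "lag_t t (x t) (v t) = 0" for t
      unfolding vv by (rule lag_outer_derivatives[OF s] lag_outer[OF s])+
    note const = this
    show ?thesis using dx[of t] unfolding const unfolding vv by simp
  next
    case False
    then have inner: "\<bar>ham.Hy t (x t) (p t)\<bar> < D + 1" for t
      using velocity_inner[of "p t" t "x t"] by (force simp: not_less)
    have ly: "lag_y t (x t) (v t) = p t" and lx: "lag_x t (x t) (v t) = - ham.Hx t (x t) (p t)"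
      and lt: "lag_t t (x t) (v t) = - ham.Ht t (x t) (p t)" for t
      using dual_inner[OF inner, of t] by (simp_all add: v_def x_def p_def)
    have en: "lag t (x t) (v t) - v t * lag_y t (x t) (v t) = - H t (x t) (p t)" for t
      using lag_inner[OF inner, of t] ham.legendre_at[of t "x t" "p t"] ly[of t] by (simp add: v_def x_def p_def)
    have "((\<lambda>t. H t (x t) (p t)) has_real_derivative
        1 * ham.Ht t (x t) (p t) + v t * ham.Hx t (x t) (p t) + - ham.Hx t (x t) (p t) * ham.Hy t (x t) (p t)) (at t)"
      by (intro ham.H_chain dx dp) auto
    then have "((\<lambda>t. - H t (x t) (p t)) has_real_derivative - ham.Ht t (x t) (p t)) (at t)"
      by (auto intro!: derivative_eq_intros simp: v_def x_def p_def)
    then show ?thesis using dx[of t] dp[of t] unfolding en unfolding ly lx lt by simp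
  qed
  then show "lagrangian_curve (\<lambda>t. fst (c t)) (\<lambda>t. ham.Hy t (fst (c t)) (snd (c t)))"
    using cv bound unfolding lagrangian_curve_def x_def v_def by blast
qed

lemma hamiltonian_curve_from: "\<exists>c. hamiltonian_curve H c \<and> c 0 = p"
  using time_one[unfolded time_one_map_def, rule_format, of p] by (rule conjunct1)

lemma hamiltonian_curve_end: "hamiltonian_curve H c \<Longrightarrow> cyl (c 1) = cyl (f (c 0))"
  using time_one[unfolded time_one_map_def, rule_format, THEN conjunct2, rule_format, of c "c 0"] by simp

text \<open>
  Since \<open>f\<close> is surjective, every point is also the end of a Hamiltonian curve over unit time, up to an integer
  translation, under which the equation is invariant.
\<close>

lemma trajectory_exists: "\<exists>c. ham.trajectory c \<and> c 0 = p"
proof (rule ham.trajectory_through)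
  show "\<exists>c. hamiltonian_curve H c \<and> c 0 = p" for p by (rule hamiltonian_curve_from)
  fix q
  have "bij f" using twist unfolding twist_map_def by (elim conjE)
  then have "surj f" by (rule bij_is_surj)
  then obtain p where p: "f p = q" by (metis surjD)
  obtain c where c: "hamiltonian_curve H c" "c 0 = p" using hamiltonian_curve_from[of p] by (elim exE conjE)
  then have "cyl (c 1) = cyl q" using hamiltonian_curve_end[OF c(1)] p by simp
  then obtain k :: int where k: "c 1 = q + (of_int k, 0)" unfolding cyl_eq_iff by blast
  have "hamiltonian_curve H (\<lambda>t. c t - (of_int k, 0))"
    unfolding ham.hamiltonian_curve_iff
  proof
    fix t :: real assume "t \<in> {0..1}"
    then have "(c has_vector_derivative (ham.Hy t (fst (c t)) (snd (c t)), - ham.Hx t (fst (c t)) (snd (c t)))) (at t within {0..1})"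
      using c(1) unfolding ham.hamiltonian_curve_iff by blast
    then show "((\<lambda>t. c t - (of_int k, 0)) has_vector_derivative
      (ham.Hy t (fst (c t - (of_int k, 0))) (snd (c t - (of_int k, 0))),
       - ham.Hx t (fst (c t - (of_int k, 0))) (snd (c t - (of_int k, 0))))) (at t within {0..1})"
      using ham.partials_periodic[of t 0 "fst (c t)" "- k" "snd (c t)"]
      by (auto intro!: derivative_eq_intros)
  qed
  then show "\<exists>c. hamiltonian_curve H c \<and> c 1 = q" using k by (intro exI[of _ "\<lambda>t. c t - (of_int k, 0)"]) auto
qed

text \<open>
  One trajectory is chosen through each point. By the time-one condition, its position at time \<open>1\<close> is
  independent of the choice up to an integer translation.
\<close>

definition flow where "flow p = (SOME c. ham.trajectory c \<and> c 0 = p)"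

lemma flow: "ham.trajectory (flow p)" "flow p 0 = p"
  unfolding flow_def
  by (rule someI_ex[OF trajectory_exists[of p], THEN conjunct1],
      rule someI_ex[OF trajectory_exists[of p], THEN conjunct2])

definition \<phi> where "\<phi> p = flow p 1"

definition leg :: "plane \<Rightarrow> plane" where
  "leg p = (fst p, ham.Hy 0 (fst p) (snd p))"

lemma return_map_conjugate: "return_map F (V0_chart F (leg p)) = V0_chart F (leg (\<phi> p))"
proof -
  have "ham.Hy 1 (fst (\<phi> p)) (snd (\<phi> p)) = ham.Hy 0 (fst (\<phi> p)) (snd (\<phi> p))"
    using ham.partials_periodic(1)[of 0 1 "fst (\<phi> p)" 0 "snd (\<phi> p)"] by simp
  then show ?thesis
    using return_map_curve[OF trajectory_is_lagrangian_curve(1)[OF flow(1)], of p] flow(2)[of p]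
    by (simp add: leg_def \<phi>_def)
qed

lemma \<phi>_inner: "\<bar>snd p\<bar> \<le> D \<Longrightarrow> \<bar>snd (\<phi> p)\<bar> \<le> D"
proof (rule ccontr)
  assume p: "\<bar>snd p\<bar> \<le> D" and "\<not> \<bar>snd (\<phi> p)\<bar> \<le> D"
  then have "D < \<bar>snd (flow p 1)\<bar>" by (simp add: \<phi>_def)
  from trajectory_momentum[OF flow(1) this, of 0] this p show False by (simp add: flow(2))
qed

lemma \<phi>_outer:
  assumes "D < \<bar>snd p\<bar>"
  shows "\<phi> p = (fst p + snd p, snd p)"
proof -
  have mom: "snd (flow p t) = snd p" for t
    using trajectory_momentum[OF flow(1), of p 0 t] assms flow(2)[of p] by simp
  have "((\<lambda>t. fst (flow p t)) has_real_derivative snd p) (at t)" for t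
    using ham.trajectory_components(1)[OF flow(1), of p t] velocity_outer[OF assms] mom by simp
  then have "((\<lambda>t. fst (flow p t) - t * snd p) has_real_derivative 0) (at t)" for t
    by (auto intro!: derivative_eq_intros)
  then have "fst (flow p 1) - 1 * snd p = fst (flow p 0) - 0 * snd p"
    by (intro DERIV_isconst_all) auto
  then show ?thesis using mom[of 1] flow(2)[of p] by (simp add: \<phi>_def prod_eq_iff)
qed

lemma cyl_\<phi>: "cyl (\<phi> p) = cyl (f p)"
proof -
  have "hamiltonian_curve H (flow p)"
    unfolding ham.hamiltonian_curve_iff using flow(1)[of p] unfolding ham.trajectory_def
    by - (rule ballI, rule has_vector_derivative_at_within, rule spec)
  from hamiltonian_curve_end[OF this] show ?thesis by (simp add: \<phi>_def flow(2))
qed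

lemma continuous_on_leg: "continuous_on UNIV leg"
proof -
  have "continuous_on UNIV (\<lambda>p. (0 :: real, fst p, snd p :: real))" by (intro continuous_intros)
  from continuous_on_compose2[OF ham.continuous_on_H_partials(1) this]
  show ?thesis unfolding leg_def[abs_def] by (intro continuous_intros) (simp add: case_prod_unfold)
qed

abbreviation vel where "vel p t \<equiv> ham.Hy t (fst (flow p t)) (snd (flow p t))"

text \<open>
  Nothing is known a priori about the dependence of the chosen trajectory on its initial point; its
  continuity follows from stability of Lagrangian trajectories.
\<close>

lemma continuous_on_fst_\<phi>: "continuous_on UNIV (\<lambda>p. fst (\<phi> p))"
proof (intro continuous_at_imp_continuous_on ballI)
  fix p :: "plane"
  define R where "R = max D (\<bar>snd p\<bar> + 1)"
  obtain K where K: "\<And>a T \<tau> t X1 Y1 X2 Y2. \<lbrakk>0 \<le> a;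
      \<forall>s\<in>{0..a}. 0 \<le> \<tau> s \<and> \<tau> s \<le> T \<and> \<bar>Y1 s\<bar> \<le> R \<and> \<bar>Y2 s\<bar> \<le> R;
      trajectory_on a \<tau> t X1 Y1; trajectory_on a \<tau> t X2 Y2\<rbrakk> \<Longrightarrow>
      separation t X1 Y1 X2 Y2 a \<le> exp (K * T * a) * separation t X1 Y1 X2 Y2 0"
    using trajectory_stability[of R] by metis
  define m where "m q = lag_y 0 (fst (leg q)) (snd (leg q))" for q
  define E where "E q = sqrt (exp K * ((fst q - fst p)\<^sup>2 + (m q - m p)\<^sup>2))" for q
  have tr: "trajectory_on 1 (\<lambda>_. 1) (\<lambda>s. s) (\<lambda>t. fst (flow q t)) (\<lambda>t. vel q t)" for q
    unfolding trajectory_on_def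
    using trajectory_is_lagrangian_curve(1)[OF flow(1), of q] by (simp add: lagrangian_curve_def)
  have bd: "\<bar>fst (\<phi> q) - fst (\<phi> p)\<bar> \<le> E q" if "\<bar>snd q\<bar> < \<bar>snd p\<bar> + 1" for q
  proof -
    define sep where "sep = separation (\<lambda>s. s) (\<lambda>t. fst (flow q t)) (\<lambda>t. vel q t)
      (\<lambda>t. fst (flow p t)) (\<lambda>t. vel p t)"
    have "(fst (flow q 1) - fst (flow p 1))\<^sup>2 \<le> sep 1" by (simp add: sep_def separation_def)
    also have "\<dots> \<le> exp (K * 1 * 1) * sep 0" unfolding sep_def
    proof (rule K[OF _ _ tr tr])
      have "\<bar>vel q t\<bar> \<le> R" "\<bar>vel p t\<bar> \<le> R" for t
        using trajectory_is_lagrangian_curve(2)[OF flow(1), where p1 = q and t = t]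
          trajectory_is_lagrangian_curve(2)[OF flow(1), where p1 = p and t = t] that
        by (auto simp: R_def flow(2) max_def split: if_splits)
      then show "\<forall>s\<in>{0..1}. 0 \<le> (1::real) \<and> (1::real) \<le> 1 \<and> \<bar>vel q s\<bar> \<le> R \<and> \<bar>vel p s\<bar> \<le> R"
        by simp
    qed simp
    finally have "(fst (\<phi> q) - fst (\<phi> p))\<^sup>2 \<le> exp K * ((fst q - fst p)\<^sup>2 + (m q - m p)\<^sup>2)"
      using flow(2) by (simp add: \<phi>_def m_def leg_def sep_def separation_def)
    then have "sqrt ((fst (\<phi> q) - fst (\<phi> p))\<^sup>2) \<le> E q" unfolding E_def by (rule real_sqrt_le_mono)
    then show ?thesis by simp
  qed
  have cm: "continuous_on UNIV m"
  proof -
    have "continuous_on UNIV (\<lambda>q. (0 :: real, fst (leg q), snd (leg q)))"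
      by (intro continuous_intros continuous_on_leg)
    from continuous_on_compose2[OF continuous_on_lag(2) this]
    show ?thesis by (simp add: m_def[abs_def] lag_y_def case_prod_unfold)
  qed
  have "continuous_on UNIV E" unfolding E_def[abs_def] by (intro continuous_intros cm)
  then have "isCont E p" by (metis continuous_on_eq_continuous_at UNIV_I open_UNIV)
  then have "(E \<longlongrightarrow> E p) (at p)" unfolding isCont_def .
  then have E0: "(E \<longlongrightarrow> 0) (at p)" by (simp add: E_def)
  have "\<forall>\<^sub>F q in at p. \<bar>snd q\<bar> < \<bar>snd p\<bar> + 1"
  proof -
    have "open {q :: plane. \<bar>snd q\<bar> < \<bar>snd p\<bar> + 1}"
      by (intro open_Collect_less continuous_intros)
    from eventually_at_in_open'[OF this, of p] show ?thesis by simp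
  qed
  then have "\<forall>\<^sub>F q in at p. norm (fst (\<phi> q) - fst (\<phi> p)) \<le> E q"
    by eventually_elim (use bd in simp)
  then have "((\<lambda>q. fst (\<phi> q) - fst (\<phi> p)) \<longlongrightarrow> 0) (at p)" using E0 by (rule Lim_null_comparison)
  then show "isCont (\<lambda>q. fst (\<phi> q)) p" unfolding isCont_def by (rule LIM_zero_cancel)
qed

text \<open>
  The two lifts of the same cylinder map differ by an integer translation, which is locally constant
  because both are continuous.
\<close>

lemma \<phi>_eq: "\<exists>k::int. \<forall>p. \<phi> p = f p + (of_int k, 0)"
proof -
  have f: "smooth_on UNIV f" using twist unfolding twist_map_def by (elim conjE)
  have ex: "\<exists>k::int. \<phi> p = f p + (of_int k, 0)" for p using cyl_\<phi>[of p] unfolding cyl_eq_iff .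
  define d where "d p = fst (\<phi> p) - fst (f p)" for p
  have dI: "\<exists>k::int. d p = of_int k" for p using ex[of p] by (auto simp: d_def)
  have "continuous_on UNIV d" unfolding d_def[abs_def]
    by (intro continuous_intros continuous_on_fst_\<phi> smooth_on_imp_continuous_on[OF f])
  moreover have "\<exists>e>0. \<forall>q. q \<in> UNIV \<and> d q \<noteq> d p \<longrightarrow> e \<le> norm (d q - d p)" for p
  proof (intro exI[of _ 1] conjI allI impI)
    fix q assume q: "q \<in> UNIV \<and> d q \<noteq> d p"
    obtain a b :: int where ab: "d q = of_int a" "d p = of_int b" using dI by blast
    then have "1 \<le> \<bar>a - b\<bar>" using q by auto
    then have "1 \<le> \<bar>real_of_int (a - b)\<bar>" by linarith
    then show "1 \<le> norm (d q - d p)" by (simp add: ab)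
  qed simp
  ultimately have "d constant_on UNIV" by (intro continuous_discrete_range_constant) auto
  then obtain l where l: "\<And>p. d p = l" unfolding constant_on_def by auto
  obtain k :: int where k: "l = of_int k" using dI l by metis
  have "\<phi> p = f p + (of_int k, 0)" for p
    using ex[of p] l[of p] k by (auto simp: d_def prod_eq_iff)
  then show ?thesis by blast
qed

lemma area_map_f: "periodic_area_map f"
proof (rule periodic_area_map.intro)
  note tw = twist[unfolded twist_map_def]
  fix x y show "f (x + 1, y) = f (x, y) + (1, 0)" by (rule tw[THEN conjunct1, rule_format])
next
  show "smooth_on UNIV f" using twist unfolding twist_map_def by (elim conjE)
next
  note tw = twist[unfolded twist_map_def]
  fix p show "jacobian f p = 1"
    by (rule tw[THEN conjunct2, THEN conjunct2, THEN conjunct2, THEN conjunct2, THEN conjunct1, rule_format])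
qed

sublocale \<phi>: periodic_area_map \<phi>
proof -
  obtain k :: int where k: "\<And>p. \<phi> p = f p + (of_int k, 0)" using \<phi>_eq by blast
  then have e: "\<phi> = (\<lambda>p. f p + (of_int k, 0))" by auto
  interpret f: periodic_area_map f by (rule area_map_f)
  have D: "(\<phi> has_derivative frechet_derivative f (at p)) (at p)" for p
    unfolding e using smooth_on_has_derivative[OF f.smooth, of p] by (auto intro!: derivative_eq_intros)
  show "periodic_area_map \<phi>"
  proof (rule periodic_area_map.intro)
    show "smooth_on UNIV \<phi>" unfolding e by (rule smooth_on_add_const[OF f.smooth])
    show "jacobian \<phi> p = 1" for p
      using f.jac[of p] unfolding jacobian_def frechet_derivative_at[OF D, symmetric] .
    show "\<phi> (x + 1, y) = \<phi> (x, y) + (1, 0)" for x y using f.periodic[of x y] by (simp add: k)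
  qed
qed

text \<open>The iterates of \<open>\<phi>\<close> and \<open>f\<close> differ by the translations by \<open>n k\<close>.\<close>

lemma max_lyapunov_f: "max_lyapunov (\<lambda>_. inner) UNIV f p = growth_exponent \<phi> p"
proof -
  interpret f: periodic_area_map f by (rule area_map_f)
  obtain k :: int where k: "\<And>p. \<phi> p = f p + (of_int k, 0)" using \<phi>_eq by blast
  have it: "(\<phi> ^^ n) p = (f ^^ n) p + (of_int (int n * k), 0)" for n p
  proof (induction n)
    case (Suc n)
    have "(\<phi> ^^ Suc n) p = f ((f ^^ n) p + (of_int (int n * k), 0)) + (of_int k, 0)"
      by (simp only: funpow.simps comp_apply k Suc)
    also have "f ((f ^^ n) p + (of_int (int n * k), 0)) = (f ^^ Suc n) p + (of_int (int n * k), 0)"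
      using f.periodic_int[of "fst ((f ^^ n) p)" "int n * k" "snd ((f ^^ n) p)"]
      by (cases "(f ^^ n) p") simp
    finally show ?case by (simp add: algebra_simps prod_eq_iff)
  qed (simp add: zero_prod_def[symmetric])
  have "frechet_derivative (\<phi> ^^ n) (at p) = frechet_derivative (f ^^ n) (at p)" for n
  proof -
    have "((\<lambda>p. (f ^^ n) p + (of_int (int n * k), 0)) has_derivative frechet_derivative (f ^^ n) (at p)) (at p)"
      using f.iterate_has_derivative[of n p] by (auto intro!: derivative_eq_intros)
    then have "(\<phi> ^^ n has_derivative frechet_derivative (f ^^ n) (at p)) (at p)"
      by (rule has_derivative_transform_within_open[of _ _ _ _ UNIV]) (simp_all only: it open_UNIV UNIV_I)
    then show ?thesis by (rule frechet_derivative_at[symmetric])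
  qed
  then have "growth_exponent \<phi> p = growth_exponent f p" by (simp only: growth_exponent_def)
  then show ?thesis using f.max_lyapunov_flat by simp
qed

end

section \<open>Lyapunov exponents in a parametrization\<close>

text \<open>\<open>Q\<close> extends the inverse of \<open>\<Psi>\<close> to ambient space, so that derivatives within \<open>S\<close> can be computed in the chart.\<close>

locale parametrized_surface =
  fixes S :: "'a::euclidean_space set" and \<Psi> :: "plane \<Rightarrow> 'a" and A :: "plane \<Rightarrow> plane \<Rightarrow> 'a"
    and Q :: "'a \<Rightarrow> plane"
  assumes param: "\<And>p. (\<Psi> has_derivative A p) (at p)" and in_S: "\<And>p. \<Psi> p \<in> S"
    and right_inverse: "\<And>z. z \<in> S \<Longrightarrow> \<Psi> (Q z) = z" and left_inverse: "\<And>p. Q (\<Psi> p) = p"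
    and Q_differentiable: "\<And>p. Q differentiable (at (\<Psi> p))"
begin

abbreviation dQ where "dQ p \<equiv> frechet_derivative Q (at (\<Psi> p))"

lemma linear_A: "linear (A p)"
  by (rule has_derivative_linear[OF param])

lemma Q_has_derivative: "(Q has_derivative dQ p) (at (\<Psi> p))"
  using Q_differentiable frechet_derivative_works by blast

lemma Q_A: "dQ p (A p u) = u"
proof -
  have "((\<lambda>q. Q (\<Psi> q)) has_derivative (\<lambda>u. dQ p (A p u))) (at p)"
    by (rule has_derivative_compose[OF param Q_has_derivative])
  then have "((\<lambda>q. q) has_derivative (\<lambda>u. dQ p (A p u))) (at p)"
    by (simp only: left_inverse)
  from fun_cong[OF has_derivative_unique[OF this has_derivative_ident], of u] show ?thesis .
qed

lemma A_neq_0: "u \<noteq> 0 \<Longrightarrow> A p u \<noteq> 0"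
  using Q_A[of p u] Q_A[of p 0] linear_0[OF linear_A, of p] by auto

lemma tangent_space_eq: "tangent_space S (\<Psi> p) = range (A p)"
proof (intro equalityI subsetI)
  fix w assume "w \<in> tangent_space S (\<Psi> p)"
  then obtain c where c: "\<And>s. c s \<in> S" "c 0 = \<Psi> p" "(c has_derivative (\<lambda>h. h *\<^sub>R w)) (at 0)"
    unfolding tangent_space_def has_vector_derivative_def by blast
  define u where "u = dQ p w"
  have "((\<lambda>s. Q (c s)) has_derivative (\<lambda>h. dQ p (h *\<^sub>R w))) (at 0)"
    by (rule has_derivative_compose[OF c(3)]) (simp add: c(2) Q_has_derivative)
  then have "((\<lambda>s. \<Psi> (Q (c s))) has_derivative (\<lambda>h. A p (dQ p (h *\<^sub>R w)))) (at 0)"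
    by (rule has_derivative_compose) (simp add: c(2) left_inverse param)
  then have "(c has_derivative (\<lambda>h. A p (dQ p (h *\<^sub>R w)))) (at 0)"
    by (simp add: right_inverse c(1))
  from fun_cong[OF has_derivative_unique[OF this c(3)], of 1] have "A p u = w" by (simp add: u_def)
  then show "w \<in> range (A p)" by blast
next
  fix w assume "w \<in> range (A p)"
  then obtain u where w: "w = A p u" by blast
  have "((\<lambda>s::real. p + s *\<^sub>R u) has_derivative (\<lambda>h. h *\<^sub>R u)) (at 0)"
    by (auto intro!: derivative_eq_intros)
  then have "((\<lambda>s. \<Psi> (p + s *\<^sub>R u)) has_derivative (\<lambda>h. A p (h *\<^sub>R u))) (at 0)"
    by (rule has_derivative_compose) (simp add: param)
  then show "w \<in> tangent_space S (\<Psi> p)"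
    unfolding tangent_space_def has_vector_derivative_def w
    by (auto intro!: exI[of _ "\<lambda>s. \<Psi> (p + s *\<^sub>R u)"] in_S simp: linear_scale[OF linear_A])
qed

text \<open>
  The derivative of \<open>R\<close> within \<open>S\<close> is determined on tangent vectors only. Composition with \<open>\<Psi>\<close>, whose domain is
  the whole plane, turns this into uniqueness of an ordinary derivative.
\<close>

lemma frechet_derivative_conjugate:
  assumes R: "\<And>q. R (\<Psi> q) = \<Psi> (h q)" and h: "(h has_derivative T) (at p)"
  shows "frechet_derivative R (at (\<Psi> p) within S) (A p u) = A (h p) (T u)"
proof -
  have "((\<lambda>z. h (Q z)) has_derivative (\<lambda>w. T (dQ p w))) (at (\<Psi> p))"
    by (rule has_derivative_compose[OF Q_has_derivative]) (simp add: left_inverse h)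
  then have "((\<lambda>z. \<Psi> (h (Q z))) has_derivative (\<lambda>w. A (h p) (T (dQ p w)))) (at (\<Psi> p))"
    by (rule has_derivative_compose) (simp add: left_inverse param)
  then have "((\<lambda>z. \<Psi> (h (Q z))) has_derivative (\<lambda>w. A (h p) (T (dQ p w)))) (at (\<Psi> p) within S)"
    by (rule has_derivative_at_withinI)
  then have "(R has_derivative (\<lambda>w. A (h p) (T (dQ p w)))) (at (\<Psi> p) within S)"
  proof (rule has_derivative_transform[rotated 2])
    fix z assume "z \<in> S" then show "R z = \<Psi> (h (Q z))" using R[of "Q z"] right_inverse by simp
  qed (rule in_S)
  then have "R differentiable (at (\<Psi> p) within S)" unfolding differentiable_def by blast
  then have D: "(R has_derivative frechet_derivative R (at (\<Psi> p) within S)) (at (\<Psi> p) within S)"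
    by (simp add: frechet_derivative_works)
  have "(R has_derivative frechet_derivative R (at (\<Psi> p) within S)) (at (\<Psi> p) within range \<Psi>)"
    by (rule has_derivative_subset[OF D]) (use in_S in auto)
  from diff_chain_within[OF param this]
  have "(R \<circ> \<Psi> has_derivative frechet_derivative R (at (\<Psi> p) within S) \<circ> A p) (at p)" .
  moreover have "R \<circ> \<Psi> = (\<lambda>q. \<Psi> (h q))" by (simp add: fun_eq_iff R)
  moreover have "((\<lambda>q. \<Psi> (h q)) has_derivative (\<lambda>u. A (h p) (T u))) (at p)"
    by (rule has_derivative_compose[OF h param])
  ultimately have "frechet_derivative R (at (\<Psi> p) within S) \<circ> A p = (\<lambda>u. A (h p) (T u))"
    using has_derivative_unique by metis
  from fun_cong[OF this, of u] show ?thesis by simp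
qed

end

context island_torus
begin

lemma lag0_has_derivative:
  "((\<lambda>p. lag 0 (fst p) (snd p)) has_derivative
     (\<lambda>h. fst h * lag_x 0 (fst p) (snd p) + snd h * lag_y 0 (fst p) (snd p))) (at p)"
proof -
  have "((\<lambda>p. (0 :: real, fst p, snd p)) has_derivative (\<lambda>h. (0, fst h, snd h))) (at p)"
    by (auto intro!: derivative_eq_intros)
  then have "((\<lambda>p. (\<lambda>(t, x, y). lag t x y) (0, fst p, snd p)) has_derivative
     (\<lambda>h. (\<lambda>(a, b, c). a * lag_t 0 (fst p) (snd p) + b * lag_x 0 (fst p) (snd p) + c * lag_y 0 (fst p) (snd p)) (0, fst h, snd h))) (at p)"
    by (rule has_derivative_compose) (rule lag_has_derivative)
  then show ?thesis by (simp add: case_prod_unfold)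
qed

definition dchart :: "plane \<Rightarrow> plane \<Rightarrow> plane \<times> plane" where
  "dchart p h = ((0, fst h), (1 / lag 0 (fst p) (snd p)) *\<^sub>R (0, snd h)
     - ((fst h * lag_x 0 (fst p) (snd p) + snd h * lag_y 0 (fst p) (snd p)) / (lag 0 (fst p) (snd p))\<^sup>2) *\<^sub>R (1, snd p))"

lemma V0_chart_eq: "V0_chart F p = ((0, fst p), (1 / lag 0 (fst p) (snd p)) *\<^sub>R (1, snd p))"
  by (simp add: V0_chart_def lag_def case_prod_unfold)

lemma V0_chart_has_derivative: "(V0_chart F has_derivative dchart p) (at p)"
proof -
  have n: "lag 0 (fst p) (snd p) \<noteq> 0" using lag_pos[of 0 "fst p" "snd p"] by simp
  have "((\<lambda>p. ((0, fst p), (1 / lag 0 (fst p) (snd p)) *\<^sub>R (1, snd p))) has_derivative dchart p) (at p)"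
    unfolding dchart_def[abs_def]
    by (auto intro!: derivative_eq_intros lag0_has_derivative n simp: fun_eq_iff power2_eq_square divide_simps algebra_simps)
  then show ?thesis by (simp add: V0_chart_eq[abs_def])
qed

definition dHy where
  "dHy p = frechet_derivative (\<lambda>(t, x, y). ham.Hy t x y) (at (0, p))"

lemma smooth_Hy: "smooth_on UNIV (\<lambda>(t, x, y). ham.Hy t x y)"
  using smooth_on_frechet_derivative[OF ham.smooth, of "(0, 0, 1)"]
  by (simp add: ham.Hy_def ham.dH_def case_prod_unfold)

lemma leg_has_derivative: "(leg has_derivative (\<lambda>h. (fst h, dHy p (0, h)))) (at p)"
proof -
  have "((\<lambda>p. (0 :: real, p)) has_derivative (\<lambda>h. (0, h))) (at p)"
    by (auto intro!: derivative_eq_intros)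
  then have "((\<lambda>p. (\<lambda>(t, x, y). ham.Hy t x y) (0, p)) has_derivative (\<lambda>h. dHy p (0, h))) (at p)"
    unfolding dHy_def by (rule has_derivative_compose) (rule smooth_on_has_derivative[OF smooth_Hy], simp)
  then have "((\<lambda>p. (fst p, (\<lambda>(t, x, y). ham.Hy t x y) (0, p))) has_derivative (\<lambda>h. (fst h, dHy p (0, h)))) (at p)"
    by (intro has_derivative_Pair) (auto intro!: derivative_eq_intros)
  then show ?thesis by (simp add: leg_def[abs_def] case_prod_unfold)
qed

text \<open>
  The inverse Legendre transformation at time \<open>0\<close>. The Lagrangian of \<open>F\<close> gives it for moderate slopes only,
  since it differs from the Legendre transform of \<open>H\<close> beyond slope \<open>D + 1\<close>.
\<close>

definition momentum :: "real \<Rightarrow> real \<Rightarrow> real" where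
  "momentum x v = (if \<bar>v\<bar> < D + 1 then lag_y 0 x v else v)"

lemma momentum_outer:
  assumes "D < \<bar>v\<bar>"
  shows "momentum x v = v"
proof (cases "\<bar>v\<bar> < D + 1")
  case True
  have "ham.Hy 0 x v = v" by (rule velocity_outer[OF assms])
  then show ?thesis using dual_inner(3)[of 0 x v] True by (simp add: momentum_def)
qed (simp add: momentum_def)

lemma momentum_velocity: "momentum x (ham.Hy 0 x y) = y"
proof (cases "\<bar>ham.Hy 0 x y\<bar> < D + 1")
  case True
  then show ?thesis using dual_inner(3) by (simp add: momentum_def)
next
  case False
  then show ?thesis using dual_outer(1)[of 0 x y] by (simp add: momentum_def)
qed

lemma velocity_momentum: "ham.Hy 0 x (momentum x v) = v"
proof -
  obtain y where "ham.Hy 0 x y = v" using ham.Hy_surj by blast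
  then show ?thesis using momentum_velocity[of x y] by simp
qed

lemma momentum_differentiable: "(\<lambda>p. momentum (fst p) (snd p)) differentiable (at p)"
proof (cases "\<bar>snd p\<bar> < D + 1")
  case True
  have "((\<lambda>p. ((0 :: real, fst p), (1 :: real, snd p))) has_derivative (\<lambda>h. ((0, fst h), (0, snd h)))) (at p)"
    by (auto intro!: derivative_eq_intros)
  from has_derivative_compose[OF this, of "\<lambda>P. dF P (0, (0, 1))", OF dF_has_derivative]
  have "((\<lambda>p. lag_y 0 (fst p) (snd p)) has_derivative (\<lambda>h. ddF ((0, fst p), (1, snd p)) (0, (0, 1)) ((0, fst h), (0, snd h)))) (at p)"
    by (simp add: lag_y_def)
  then have "((\<lambda>p. momentum (fst p) (snd p)) has_derivative (\<lambda>h. ddF ((0, fst p), (1, snd p)) (0, (0, 1)) ((0, fst h), (0, snd h)))) (at p)"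
  proof (rule has_derivative_transform_within_open)
    show "open {p :: plane. \<bar>snd p\<bar> < D + 1}" by (intro open_Collect_less continuous_intros)
  qed (use True in \<open>simp_all add: momentum_def\<close>)
  then show ?thesis unfolding differentiable_def by blast
next
  case False
  have "(snd has_derivative snd) (at p)" by (auto intro!: derivative_eq_intros)
  then have "((\<lambda>p. momentum (fst p) (snd p)) has_derivative snd) (at p)"
  proof (rule has_derivative_transform_within_open)
    show "open {p :: plane. D < \<bar>snd p\<bar>}" by (intro open_Collect_less continuous_intros)
  qed (use False momentum_outer in simp_all)
  then show ?thesis unfolding differentiable_def by blast
qed

definition \<Psi> :: "plane \<Rightarrow> plane \<times> plane" where
  "\<Psi> p = V0_chart F (leg p)"

definition d\<Psi> where "d\<Psi> p h = dchart (leg p) (fst h, dHy p (0, h))"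

definition unleg :: "plane \<Rightarrow> plane" where
  "unleg u = (fst u, momentum (fst u) (snd u))"

definition base_slope :: "plane \<times> plane \<Rightarrow> plane" where
  "base_slope z = (snd (fst z), snd (snd z) / fst (snd z))"

lemma unleg_leg [simp]: "unleg (leg p) = p"
  by (simp add: unleg_def leg_def momentum_velocity)

lemma leg_unleg [simp]: "leg (unleg u) = u"
  by (simp add: unleg_def leg_def velocity_momentum)

lemma base_slope_chart [simp]: "base_slope (V0_chart F u) = u"
  using lag_pos[of 0 "fst u" "snd u"] by (simp add: V0_chart_eq base_slope_def)

lemma V0_iff: "z \<in> V0 F \<longleftrightarrow> fst (fst z) = 0 \<and> 0 < fst (snd z) \<and>
    fst (snd z) * lag 0 (snd (fst z)) (snd (snd z) / fst (snd z)) = 1"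
proof -
  have "F q v = fst v * lag (fst q) (snd q) (snd v / fst v)" if "0 < fst v" for q v
    using F_at_slope[OF that, of q "snd v / fst v"] that by simp
  then show ?thesis by (cases z) (auto simp: V0_def unit_tangent_def)
qed

lemma chart_in_V0: "V0_chart F u \<in> V0 F"
  using lag_pos[of 0 "fst u" "snd u"] by (simp add: V0_iff V0_chart_eq)

lemma chart_base_slope: "z \<in> V0 F \<Longrightarrow> V0_chart F (base_slope z) = z"
  unfolding V0_iff base_slope_def V0_chart_eq using lag_pos[of 0 "snd (fst z)" "snd (snd z) / fst (snd z)"]
  by (auto simp: prod_eq_iff field_simps)

lemma base_slope_differentiable:
  assumes "fst (snd z) \<noteq> 0"
  shows "base_slope differentiable (at z)"
proof -
  have "\<exists>D. ((\<lambda>z. (snd (fst z), snd (snd z) / fst (snd z))) has_derivative D) (at z)"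
    using assms by (intro exI) (rule derivative_eq_intros refl | assumption)+
  then show ?thesis by (simp add: base_slope_def[abs_def] differentiable_def)
qed

lemma unleg_differentiable: "unleg differentiable (at u)"
proof -
  obtain m where m: "((\<lambda>p. momentum (fst p) (snd p)) has_derivative m) (at u)"
    using momentum_differentiable unfolding differentiable_def by blast
  have "((\<lambda>u. (fst u, momentum (fst u) (snd u))) has_derivative (\<lambda>h. (fst h, m h))) (at u)"
    by (rule has_derivative_Pair[OF _ m]) (auto intro!: derivative_eq_intros)
  then show ?thesis unfolding unleg_def[abs_def] differentiable_def by blast
qed

sublocale poincare: parametrized_surface "V0 F" \<Psi> d\<Psi> "\<lambda>z. unleg (base_slope z)"
proof (rule parametrized_surface.intro)
  fix p
  show "(\<Psi> has_derivative d\<Psi> p) (at p)"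
    unfolding \<Psi>_def[abs_def] d\<Psi>_def[abs_def]
    by (rule has_derivative_compose[OF leg_has_derivative V0_chart_has_derivative])
  show "\<Psi> p \<in> V0 F" by (simp add: \<Psi>_def chart_in_V0)
  show "unleg (base_slope (\<Psi> p)) = p" by (simp add: \<Psi>_def)
  have "unleg differentiable (at (base_slope (\<Psi> p)))" by (rule unleg_differentiable)
  moreover have "base_slope differentiable (at (\<Psi> p))"
    by (intro base_slope_differentiable) (use chart_in_V0[of "leg p"] in \<open>simp add: V0_iff \<Psi>_def\<close>)
  ultimately have "(unleg \<circ> base_slope) differentiable (at (\<Psi> p))"
    by (intro differentiable_chain_at)
  then show "(\<lambda>z. unleg (base_slope z)) differentiable (at (\<Psi> p))" by (simp add: comp_def)
next
  fix z assume "z \<in> V0 F"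
  then show "\<Psi> (unleg (base_slope z)) = z" by (simp add: \<Psi>_def chart_base_slope)
qed

end

context island_torus
begin

section \<open>Lyapunov exponents of the return map\<close>

lemma return_map_iterate: "(return_map F ^^ n) (\<Psi> p) = \<Psi> ((\<phi> ^^ n) p)"
  by (induction n) (simp_all add: \<Psi>_def return_map_conjugate)

lemma continuous_on_lag0:
  "continuous_on UNIV (\<lambda>p. lag 0 (fst p) (snd p))" "continuous_on UNIV (\<lambda>p. dF ((0, fst p), (1, snd p)) w)"
  "continuous_on UNIV (\<lambda>p. lag_yy 0 (fst p) (snd p))"
proof -
  have c: "continuous_on UNIV (\<lambda>p. (0 :: real, fst p :: real, snd p :: real))" by (intro continuous_intros)
  show "continuous_on UNIV (\<lambda>p. lag 0 (fst p) (snd p))"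
    using continuous_on_compose2[OF continuous_on_lag(1) c] by (simp add: case_prod_unfold)
  show "continuous_on UNIV (\<lambda>p. dF ((0, fst p), (1, snd p)) w)"
    using continuous_on_compose2[OF continuous_on_lag(2) c] by (simp add: case_prod_unfold)
  show "continuous_on UNIV (\<lambda>p. lag_yy 0 (fst p) (snd p))"
    using continuous_on_compose2[OF continuous_on_lag(3) c] by (simp add: case_prod_unfold lag_yy_def)
qed

lemma continuous_on_d\<Psi>: "continuous_on UNIV (\<lambda>p. d\<Psi> p h)"
proof -
  have "continuous_on UNIV (\<lambda>p. frechet_derivative (\<lambda>(t, x, y). ham.Hy t x y) (at (0, p)) (0, h))"
    by (rule continuous_on_frechet_derivative_apply[OF smooth_Hy]) (auto intro!: continuous_intros)
  then have cH: "continuous_on UNIV (\<lambda>p. dHy p (0, h))" by (simp add: dHy_def)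
  have ne: "lag 0 (fst u) (snd u) \<noteq> 0" for u using lag_pos[of 0 "fst u" "snd u"] by simp
  note c = continuous_on_compose2[OF _ continuous_on_leg subset_UNIV]
  have cn: "continuous_on UNIV (\<lambda>p. lag 0 (fst (leg p)) (snd (leg p)))"
    by (rule c[OF continuous_on_lag0(1)])
  have cx: "continuous_on UNIV (\<lambda>p. lag_x 0 (fst (leg p)) (snd (leg p)))"
    unfolding lag_x_def by (rule c[OF continuous_on_lag0(2)])
  have cy: "continuous_on UNIV (\<lambda>p. lag_y 0 (fst (leg p)) (snd (leg p)))"
    unfolding lag_y_def by (rule c[OF continuous_on_lag0(2)])
  show ?thesis unfolding d\<Psi>_def dchart_def fst_conv snd_conv
    by (intro continuous_intros cH cn cx cy continuous_on_leg ballI) (simp_all add: ne)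
qed

lemma continuous_on_\<Psi>: "continuous_on UNIV \<Psi>"
  by (intro continuous_at_imp_continuous_on ballI has_derivative_continuous[OF poincare.param])

lemma \<Psi>_periodic: "\<Psi> (p + (of_int k, 0)) = \<Psi> p + ((0, of_int k), 0)" for k :: int
proof -
  have "leg (p + (of_int k, 0)) = leg p + (of_int k, 0)"
    using ham.partials_periodic(1)[of 0 0 "fst p" k "snd p"] by (simp add: leg_def)
  moreover have "lag 0 (x + of_int k) y = lag 0 x y" for x y using lag_periodic(1)[of 0 0 x k y] by simp
  ultimately show ?thesis by (simp add: \<Psi>_def V0_chart_eq prod_eq_iff)
qed

lemma d\<Psi>_periodic: "d\<Psi> (p + (of_int k, 0)) = d\<Psi> p" for k :: int
proof -
  have "((\<lambda>p. p + (of_int k, 0)) has_derivative (\<lambda>h. h)) (at p)"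
    by (auto intro!: derivative_eq_intros)
  from has_derivative_compose[OF this poincare.param]
  have "((\<lambda>p. \<Psi> (p + (of_int k, 0))) has_derivative d\<Psi> (p + (of_int k, 0))) (at p)" .
  then have "((\<lambda>p. \<Psi> p + ((0, of_int k), 0)) has_derivative d\<Psi> (p + (of_int k, 0))) (at p)"
    by (simp only: \<Psi>_periodic)
  moreover have "((\<lambda>p. \<Psi> p + ((0, of_int k), 0)) has_derivative d\<Psi> p) (at p)"
    by (auto intro!: derivative_eq_intros poincare.param)
  ultimately show ?thesis by (rule has_derivative_unique)
qed

text \<open>
  Compactness of a fundamental domain of the strip \<open>|p| \<le> R\<close> and of the unit circle of directions, together
  with homogeneity in the direction.
\<close>

lemma frame_bounds:
  assumes g: "riemannian_metric_unit_tangent F g"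
  obtains c C where "0 < c" "0 < C"
    "\<And>p u. \<bar>snd p\<bar> \<le> R \<Longrightarrow> c * norm u \<le> sqrt (g (\<Psi> p) (d\<Psi> p u) (d\<Psi> p u))"
    "\<And>p u. \<bar>snd p\<bar> \<le> R \<Longrightarrow> sqrt (g (\<Psi> p) (d\<Psi> p u) (d\<Psi> p u)) \<le> C * norm u"
proof -
  obtain U where U: "unit_tangent F \<subseteq> U" "\<And>\<xi> \<eta>. smooth_on U (\<lambda>p. g p \<xi> \<eta>)"
    using g unfolding riemannian_metric_unit_tangent_def by blast
  have bil: "bilinear (g p)" and pos: "\<xi> \<noteq> 0 \<Longrightarrow> 0 < g p \<xi> \<xi>" if "p \<in> unit_tangent F" for p \<xi>
    using g that unfolding riemannian_metric_unit_tangent_def by blast+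
  have gper: "g (q + (of_int m, of_int n), v) = g (q, v)" if "(q, v) \<in> unit_tangent F" for q v and m n :: int
    using g that unfolding riemannian_metric_unit_tangent_def by blast
  have unit: "\<Psi> p \<in> unit_tangent F" for p using poincare.in_S[of p] by (auto simp: V0_def)
  have lin: "linear (g (\<Psi> p) \<xi>)" "linear (\<lambda>\<xi>. g (\<Psi> p) \<xi> \<eta>)" for p \<xi> \<eta>
    using bil[OF unit[of p]] unfolding bilinear_def by blast+
  define G where "G z = g (\<Psi> (fst z)) (d\<Psi> (fst z) (snd z)) (d\<Psi> (fst z) (snd z))" for z
  have cA: "continuous_on UNIV (\<lambda>z. d\<Psi> (fst z) (snd z))"
    by (rule continuous_on_linear_apply)
      (auto intro!: continuous_intros poincare.linear_A continuous_on_compose2[OF continuous_on_d\<Psi>])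
  have cg: "continuous_on UNIV (\<lambda>z. g (\<Psi> (fst z)) \<xi> \<eta>)" for \<xi> \<eta>
    by (rule continuous_on_compose2[OF smooth_on_imp_continuous_on[OF U(2)]])
      (use unit U(1) in \<open>auto intro!: continuous_intros continuous_on_compose2[OF continuous_on_\<Psi>]\<close>)
  have cg2: "continuous_on UNIV (\<lambda>z. g (\<Psi> (fst z)) \<xi> (d\<Psi> (fst z) (snd z)))" for \<xi>
    by (rule continuous_on_linear_apply[where T = "\<lambda>z. g (\<Psi> (fst z)) \<xi>", OF lin(1) cg cA])
  have cG: "continuous_on UNIV G" unfolding G_def[abs_def]
    by (rule continuous_on_linear_apply[where T = "\<lambda>z \<xi>. g (\<Psi> (fst z)) \<xi> (d\<Psi> (fst z) (snd z))", OF lin(2) cg2 cA])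
  have Gpos: "0 < G (p, u)" if "u \<noteq> 0" for p u
    unfolding G_def fst_conv snd_conv by (rule pos[OF unit poincare.A_neq_0[OF that]])
  define J where "J = ({0..1 :: real} \<times> {-R..R}) \<times> sphere (0 :: plane) 1"
  have J: "compact J" unfolding J_def by (intro compact_Times) auto
  have cGJ: "continuous_on J G" by (rule continuous_on_subset[OF cG]) simp
  from compact_imp_bounded[OF compact_continuous_image[OF cGJ J]]
  obtain b where b: "\<And>z. z \<in> J \<Longrightarrow> \<bar>G z\<bar> \<le> b" unfolding bounded_real by blast
  have "continuous_on J (\<lambda>z. 1 / G z)"
  proof (intro continuous_intros cGJ ballI)
    fix z assume "z \<in> J"
    then have "snd z \<noteq> 0" by (auto simp: J_def)
    then show "G z \<noteq> 0" using Gpos[of "snd z" "fst z"] by simp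
  qed
  from compact_imp_bounded[OF compact_continuous_image[OF this J]]
  obtain a where a: "\<And>z. z \<in> J \<Longrightarrow> \<bar>1 / G z\<bar> \<le> a" unfolding bounded_real by blast
  define a' b' where "a' = \<bar>a\<bar> + 1" and "b' = \<bar>b\<bar> + 1"
  have ab: "0 < a'" "0 < b'" by (auto simp: a'_def b'_def)
  have G1: "1 / a' \<le> G z \<and> G z \<le> b'" if "z \<in> J" for z
  proof -
    have "snd z \<noteq> 0" using that by (auto simp: J_def)
    then have p: "0 < G z" using Gpos[of "snd z" "fst z"] by simp
    have "1 / G z \<le> a'" "G z \<le> b'" using a[OF that] b[OF that] p by (auto simp: a'_def b'_def)
    then show ?thesis using p ab by (simp add: field_simps)
  qed
  have red: "G (p, u) = G ((frac (fst p), snd p), u)" for p u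
  proof -
    define q where "q = (frac (fst p), snd p)"
    have p: "p = q + (of_int \<lfloor>fst p\<rfloor>, 0)" by (simp add: q_def frac_def prod_eq_iff)
    have "g (\<Psi> q + ((0, of_int \<lfloor>fst p\<rfloor>), 0)) = g (\<Psi> q)"
      using gper[of "fst (\<Psi> q)" "snd (\<Psi> q)" 0 "\<lfloor>fst p\<rfloor>"] unit[of q] by (cases "\<Psi> q") simp
    then have "g (\<Psi> p) = g (\<Psi> q)" by (subst p) (simp only: \<Psi>_periodic)
    moreover have "d\<Psi> p = d\<Psi> q" by (subst p) (rule d\<Psi>_periodic)
    ultimately show ?thesis by (simp add: G_def q_def)
  qed
  have scale: "G (p, r *\<^sub>R u) = r\<^sup>2 * G (p, u)" for p r u
  proof -
    have "d\<Psi> p (r *\<^sub>R u) = r *\<^sub>R d\<Psi> p u" by (rule linear_scale[OF poincare.linear_A])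
    then show ?thesis
      using bilinear_lmul[OF bil[OF unit[of p]]] bilinear_rmul[OF bil[OF unit[of p]]]
      by (simp add: G_def power2_eq_square)
  qed
  have main: "sqrt (1 / a') * norm u \<le> sqrt (G (p, u)) \<and> sqrt (G (p, u)) \<le> sqrt b' * norm u"
    if p: "\<bar>snd p\<bar> \<le> R" for p u
  proof (cases "u = 0")
    case True
    have "G (p, u) = 0" using scale[of p 0 0] True by simp
    then show ?thesis using True by simp
  next
    case False
    define e where "e = (1 / norm u) *\<^sub>R u"
    define q where "q = (frac (fst p), snd p)"
    have "(q, e) \<in> J" using False p frac_lt_1[of "fst p"] frac_ge_0[of "fst p"]
      by (auto simp: J_def e_def q_def abs_le_iff less_imp_le)
    then have ge: "1 / a' \<le> G (q, e)" "G (q, e) \<le> b'" using G1 by auto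
    have "G (p, u) = (norm u)\<^sup>2 * G (q, e)"
      using scale[of q "norm u" e] red[of p u] False by (simp add: e_def q_def)
    then have "sqrt (G (p, u)) = norm u * sqrt (G (q, e))" by (simp add: real_sqrt_mult)
    moreover have "sqrt (1 / a') \<le> sqrt (G (q, e))" "sqrt (G (q, e)) \<le> sqrt b'"
      using ge by (simp_all only: real_sqrt_le_iff)
    ultimately show ?thesis by (simp add: mult.commute[of _ "norm u"] mult_left_mono)
  qed
  show thesis
  proof (rule that[of "sqrt (1 / a')" "sqrt b'"])
    show "0 < sqrt (1 / a')" "0 < sqrt b'" using ab by simp_all
  qed (use main in \<open>auto simp: G_def\<close>)
qed

lemma orbit_bound: "\<bar>snd ((\<phi> ^^ n) p)\<bar> \<le> max D \<bar>snd p\<bar>"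
proof (induction n)
  case (Suc n)
  then show ?case
    using \<phi>_inner[of "(\<phi> ^^ n) p"] \<phi>_outer[of "(\<phi> ^^ n) p"] by (cases "\<bar>snd ((\<phi> ^^ n) p)\<bar> \<le> D") auto
qed simp

text \<open>
  Every orbit of \<open>\<phi>\<close> stays in a strip, on which the frame \<open>d\<Psi>\<close> is uniformly comparable to an orthonormal one.
\<close>

lemma max_lyapunov_return_map:
  assumes g: "riemannian_metric_unit_tangent F g"
  shows "max_lyapunov g (V0 F) (return_map F) (\<Psi> p) = growth_exponent \<phi> p"
proof -
  obtain c C where c: "0 < c" "0 < C"
    and lo: "\<And>q u. \<bar>snd q\<bar> \<le> max D \<bar>snd p\<bar> \<Longrightarrow> c * norm u \<le> sqrt (g (\<Psi> q) (d\<Psi> q u) (d\<Psi> q u))"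
    and up: "\<And>q u. \<bar>snd q\<bar> \<le> max D \<bar>snd p\<bar> \<Longrightarrow> sqrt (g (\<Psi> q) (d\<Psi> q u) (d\<Psi> q u)) \<le> C * norm u"
    using frame_bounds[OF g, of "max D \<bar>snd p\<bar>"] by metis
  have p: "\<bar>snd p\<bar> \<le> max D \<bar>snd p\<bar>" by simp
  have D: "frechet_derivative (return_map F ^^ n) (at (\<Psi> p) within V0 F) (d\<Psi> p u)
      = d\<Psi> ((\<phi> ^^ n) p) (frechet_derivative (\<phi> ^^ n) (at p) u)" for n u
    by (rule poincare.frechet_derivative_conjugate[OF return_map_iterate \<phi>.iterate_has_derivative])
  note bd = deriv_norm_bounds[OF poincare.tangent_space_eq poincare.linear_A \<phi>.linear_frechet_iterate D c(1),
      where g = g and C = C, OF lo[OF p] up[OF p], unfolded return_map_iterate, OF lo[OF orbit_bound] up[OF orbit_bound]]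
  show ?thesis by (rule \<phi>.max_lyapunov_eq_growth_exponent[OF c(1) bd c(2)])
qed

lemma growth_exponent_outer: "D < \<bar>snd p\<bar> \<Longrightarrow> growth_exponent \<phi> p = 0"
proof (rule \<phi>.growth_exponent_shear[where U = "{q. D < \<bar>snd q\<bar>}" and k = 0])
  show "open {q :: plane. D < \<bar>snd q\<bar>}" by (intro open_Collect_less continuous_intros)
qed (auto simp: \<phi>_outer)

lemma growth_exponent_bounded:
  obtains C where "0 \<le> C" "\<And>p. growth_exponent \<phi> p \<le> ereal C"
proof -
  obtain C where C: "0 \<le> C" "\<And>p. (\<forall>n. \<bar>snd ((\<phi> ^^ n) p)\<bar> \<le> D) \<Longrightarrow> growth_exponent \<phi> p \<le> ereal C"
    using \<phi>.growth_exponent_le[of D] by blast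
  have "growth_exponent \<phi> p \<le> ereal C" for p
  proof (cases "\<bar>snd p\<bar> \<le> D")
    case True
    then show ?thesis using orbit_bound[of _ p] by (intro C(2)) (simp add: max_def)
  next
    case False
    then show ?thesis using growth_exponent_outer[of p] C(1) by simp
  qed
  then show thesis using that C(1) by blast
qed

text \<open>The exponents are finite, so passing to real numbers loses nothing.\<close>

definition \<Lambda> where "\<Lambda> p = real_of_ereal (growth_exponent \<phi> p)"

lemma \<Lambda>_ereal: "ereal (\<Lambda> p) = growth_exponent \<phi> p"
proof -
  obtain C where "growth_exponent \<phi> p \<le> ereal C" using growth_exponent_bounded by metis
  then have "\<bar>growth_exponent \<phi> p\<bar> \<noteq> \<infinity>" using \<phi>.growth_exponent_nonneg[of p] by auto
  then show ?thesis by (simp add: \<Lambda>_def ereal_real)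
qed

lemma \<Lambda>_nonneg: "0 \<le> \<Lambda> p"
  using \<phi>.growth_exponent_nonneg[of p] unfolding \<Lambda>_ereal[symmetric] by simp

lemma borel_measurable_\<Lambda>: "\<Lambda> \<in> borel_measurable borel"
  unfolding \<Lambda>_def[abs_def]
  by (rule borel_measurable_real_of_ereal[OF \<phi>.borel_measurable_growth_exponent])

end

section \<open>Positivity of the metric entropy\<close>

context island_torus
begin

text \<open>
  The form \<open>d\<lambda>\<close> is \<open>dx \<and> dp\<close> on the section, with \<open>p = lag_y\<close> the momentum, so its density in
  position and slope is the second derivative \<open>lag_yy\<close>.
\<close>

lemma area_form_chart:
  "ext_deriv (liouville F) (V0_chart F u) (frechet_derivative (V0_chart F) (at u) (1, 0))
     (frechet_derivative (V0_chart F) (at u) (0, 1)) = - lag_yy 0 (fst u) (snd u)"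
proof -
  define z where "z = V0_chart F u"
  define \<xi> \<eta> where "\<xi> = dchart u (1, 0)" and "\<eta> = dchart u (0, 1)"
  have fr: "frechet_derivative (V0_chart F) (at u) = dchart u"
    by (rule frechet_derivative_at[OF V0_chart_has_derivative, symmetric])
  have lio: "liouville F q w = frechet_derivative (energy F (fst q)) (at (snd q)) (1, 0) * fst (fst w)
      + frechet_derivative (energy F (fst q)) (at (snd q)) (0, 1) * snd (fst w)" for q w
  proof -
    have B: "(Basis :: plane set) = {(1, 0), (0, 1)}" by (auto simp: Basis_prod_def)
    show ?thesis unfolding liouville_def by (subst B) (simp add: inner_prod_def)
  qed
  \<comment> \<open>\<open>\<eta>\<close> is vertical, so only one of the two terms of the exterior derivative contributes\<close>
  have l\<eta>: "liouville F q \<eta> = 0" for q by (simp add: lio \<eta>_def dchart_def)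
  have l\<xi>: "liouville F q \<xi> = total q * dF q (0, (0, 1))" if "snd q \<noteq> 0" for q
    using energy_frechet_derivative(1)[OF that, of "fst q" "(0, 1)"] by (simp add: lio \<xi>_def dchart_def)
  have slope: "snd (V0_chart F w) = (1 / lag 0 (fst w) (snd w)) *\<^sub>R (1, snd w)" for w by (simp add: V0_chart_eq)
  have n: "0 < 1 / lag 0 (fst w) (snd w)" for w using lag_pos[of 0 "fst w" "snd w"] by simp
  have z0: "snd z \<noteq> 0" using n[of u] unfolding z_def slope by (simp add: prod_eq_iff)
  define P where "P q = total q * dF q (0, (0, 1))" for q
  define P' where "P' w = total z * ddF z (0, (0, 1)) w + dF z w * dF z (0, (0, 1))" for w
  have dP: "(P has_derivative P') (at z)"
    unfolding P_def[abs_def] P'_def[abs_def]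
    by (intro has_derivative_mult total_has_derivative dF_has_derivative z0)
  have "((\<lambda>q. liouville F q \<xi>) has_derivative P') (at z)"
  proof (rule has_derivative_transform_within_open[OF dP, of "{q. snd q \<noteq> 0}"])
    show "open {q :: plane \<times> plane. snd q \<noteq> 0}" by (intro open_Collect_neq continuous_intros)
  qed (use z0 l\<xi> in \<open>auto simp: P_def\<close>)
  then have f\<xi>: "frechet_derivative (\<lambda>q. liouville F q \<xi>) (at z) = P'"
    by (rule frechet_derivative_at[symmetric])
  have "P (V0_chart F w) = lag_y 0 (fst w) (snd w)" for w
  proof -
    have "F (0, fst w) ((1 / lag 0 (fst w) (snd w)) *\<^sub>R (1, snd w)) = 1"
      unfolding F_at_slope[OF n] using lag_pos[of 0 "fst w" "snd w"] by simp
    then show ?thesis unfolding P_def V0_chart_eq fst_conv snd_conv dF_at_slope(1)[OF n] by simp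
  qed
  note P_chart = this
  \<comment> \<open>the derivative of the momentum \<open>P\<close> along \<open>\<eta>\<close> is computed on the line \<open>x = const\<close> in the chart\<close>
  have "((\<lambda>s::real. u + s *\<^sub>R (0, 1)) has_derivative (\<lambda>s. s *\<^sub>R (0, 1))) (at 0)"
    by (auto intro!: derivative_eq_intros)
  then have "((\<lambda>s::real. V0_chart F (u + s *\<^sub>R (0, 1))) has_derivative (\<lambda>s. dchart u (s *\<^sub>R (0, 1)))) (at 0)"
    by (rule has_derivative_compose) (simp add: V0_chart_has_derivative zero_prod_def[symmetric])
  then have "((\<lambda>s::real. P (V0_chart F (u + s *\<^sub>R (0, 1)))) has_derivative (\<lambda>s. P' (dchart u (s *\<^sub>R (0, 1))))) (at 0)"
    by (rule has_derivative_compose) (use dP in \<open>simp add: z_def zero_prod_def[symmetric]\<close>)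
  then have D1: "((\<lambda>s. lag_y 0 (fst u) (snd u + s)) has_derivative (\<lambda>s. P' (dchart u (s *\<^sub>R (0, 1))))) (at 0)"
    unfolding P_chart by simp
  have "((\<lambda>s. snd u + s) has_real_derivative 1) (at 0)" by (auto intro!: derivative_eq_intros)
  from DERIV_chain2[OF _ this, of "lag_y 0 (fst u)"] lag_y_has_derivative_y[of 0 "fst u" "snd u"]
  have "((\<lambda>s. lag_y 0 (fst u) (snd u + s)) has_real_derivative lag_yy 0 (fst u) (snd u)) (at 0)" by simp
  then have "((\<lambda>s. lag_y 0 (fst u) (snd u + s)) has_derivative (\<lambda>s. lag_yy 0 (fst u) (snd u) * s)) (at 0)"
    unfolding has_field_derivative_def .
  from fun_cong[OF has_derivative_unique[OF D1 this], of 1]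
  have "P' \<eta> = lag_yy 0 (fst u) (snd u)" by (simp add: \<eta>_def)
  moreover have "frechet_derivative (\<lambda>q. liouville F q \<eta>) (at z) \<xi> = 0"
    unfolding l\<eta> by (simp add: frechet_derivative_const)
  ultimately show ?thesis unfolding ext_deriv_def fr \<xi>_def[symmetric] \<eta>_def[symmetric] z_def[symmetric] f\<xi> by simp
qed

lemma V0_measure_eq:
  "V0_measure F = distr (density (restrict_space lborel ({0..<1} \<times> UNIV)) (\<lambda>u. ennreal (lag_yy 0 (fst u) (snd u))))
     borel (V0_chart F)"
  unfolding V0_measure_def area_measure_def area_form_chart
  using lag_yy_pos by (simp add: abs_of_pos)

lemma continuous_on_unleg: "continuous_on UNIV unleg"
  by (intro continuous_at_imp_continuous_on ballI differentiable_imp_continuous_within unleg_differentiable)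

lemma borel_measurable_base_slope: "base_slope \<in> borel_measurable borel"
proof -
  have [measurable]: "(\<lambda>z :: plane \<times> plane. snd (fst z)) \<in> borel_measurable borel"
     "(\<lambda>z :: plane \<times> plane. snd (snd z)) \<in> borel_measurable borel"
     "(\<lambda>z :: plane \<times> plane. fst (snd z)) \<in> borel_measurable borel"
    by (intro borel_measurable_continuous_onI continuous_intros)+
  show ?thesis unfolding base_slope_def[abs_def] by (intro borel_measurable_Pair borel_measurable_divide) measurable
qed

lemma V0_borel: "V0 F \<in> sets borel"
proof -
  note [measurable] = borel_measurable_base_slope
  have [measurable]: "(\<lambda>u. lag 0 (fst u) (snd u)) \<in> borel_measurable borel"
    by (rule borel_measurable_continuous_onI[OF continuous_on_lag0(1)])
  have [measurable]: "(\<lambda>z :: plane \<times> plane. fst (snd z)) \<in> borel_measurable borel"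
    "(\<lambda>z :: plane \<times> plane. fst (fst z)) \<in> borel_measurable borel"
    by (intro borel_measurable_continuous_onI continuous_intros)+
  have [measurable]: "(\<lambda>z. lag 0 (fst (base_slope z)) (snd (base_slope z))) \<in> borel_measurable borel"
    by (rule measurable_compose[OF borel_measurable_base_slope]) measurable
  have "V0 F = {z \<in> space borel. fst (fst z) = 0 \<and> 0 < fst (snd z) \<and>
      fst (snd z) * lag 0 (fst (base_slope z)) (snd (base_slope z)) = 1}"
    using V0_iff by (auto simp: base_slope_def)
  also have "\<dots> \<in> sets borel" by measurable
  finally show ?thesis .
qed

text \<open>The integrand of the entropy in the coordinates \<open>(x, y)\<close> of the section.\<close>

definition entropy_density :: "plane \<Rightarrow> real" where
  "entropy_density u = indicator ({0..<1} \<times> UNIV) u * (lag_yy 0 (fst u) (snd u) * \<Lambda> (unleg u))"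

lemma fundamental_domain_borel: "{0..<1 :: real} \<times> (UNIV :: real set) \<in> sets lborel"
  by (simp add: borel_Times)

lemma metric_entropy_eq:
  assumes g: "riemannian_metric_unit_tangent F g"
  shows "metric_entropy (V0_measure F) g (V0 F) (return_map F) = (\<integral>u. entropy_density u \<partial>lborel)"
proof -
  define U where "U = {0..<1 :: real} \<times> (UNIV :: real set)"
  define w where "w u = lag_yy 0 (fst u) (snd u)" for u
  define N where "N = restrict_space lborel U"
  define J where "J z = indicator (V0 F) z *\<^sub>R \<Lambda> (unleg (base_slope z))" for z
  have U: "U \<in> sets lborel" unfolding U_def by (rule fundamental_domain_borel)
  have wm: "w \<in> borel_measurable borel"
    unfolding w_def[abs_def] by (rule borel_measurable_continuous_onI[OF continuous_on_lag0(3)])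
  have wN: "w \<in> borel_measurable N" unfolding N_def by (rule measurable_restrict_space1) (use wm in simp)
  have chm: "V0_chart F \<in> borel_measurable borel"
    by (intro borel_measurable_continuous_onI continuous_at_imp_continuous_on ballI
        has_derivative_continuous[OF V0_chart_has_derivative])
  have \<Lambda>u: "(\<lambda>u. \<Lambda> (unleg u)) \<in> borel_measurable borel"
    by (rule measurable_compose[OF borel_measurable_continuous_onI[OF continuous_on_unleg] borel_measurable_\<Lambda>])
  have Jm: "J \<in> borel_measurable borel"
    unfolding J_def[abs_def]
    by (intro borel_measurable_scaleR borel_measurable_indicator V0_borel
        measurable_compose[OF borel_measurable_base_slope \<Lambda>u])
  have chN: "V0_chart F \<in> measurable (density N (\<lambda>u. ennreal (w u))) borel"
    unfolding N_def measurable_density_eq1 by (rule measurable_restrict_space1) (use chm in simp)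
  have "indicator (V0 F) z *\<^sub>R real_of_ereal (max_lyapunov g (V0 F) (return_map F) z) = J z" for z
  proof (cases "z \<in> V0 F")
    case True
    then have "max_lyapunov g (V0 F) (return_map F) z = growth_exponent \<phi> (unleg (base_slope z))"
      using max_lyapunov_return_map[OF g, of "unleg (base_slope z)"] poincare.right_inverse by simp
    then show ?thesis by (simp add: J_def \<Lambda>_def)
  qed (simp add: J_def)
  then have "metric_entropy (V0_measure F) g (V0 F) (return_map F) = (\<integral>z. J z \<partial>V0_measure F)"
    by (simp add: metric_entropy_def set_lebesgue_integral_def)
  also have "\<dots> = (\<integral>u. J (V0_chart F u) \<partial>density N (\<lambda>u. ennreal (w u)))"
    unfolding V0_measure_eq U_def[symmetric] N_def[symmetric] w_def[symmetric]
    by (rule integral_distr[OF chN Jm])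
  also have "\<dots> = (\<integral>u. \<Lambda> (unleg u) \<partial>density N (\<lambda>u. ennreal (w u)))"
    by (simp add: J_def chart_in_V0)
  also have "\<dots> = (\<integral>u. w u *\<^sub>R \<Lambda> (unleg u) \<partial>N)"
  proof (rule integral_density)
    show "(\<lambda>u. \<Lambda> (unleg u)) \<in> borel_measurable N"
      unfolding N_def by (rule measurable_restrict_space1) (use \<Lambda>u in simp)
    show "AE u in N. 0 \<le> w u" using lag_yy_pos by (simp add: w_def less_imp_le)
  qed (rule wN)
  also have "\<dots> = (\<integral>u. indicator U u *\<^sub>R (w u *\<^sub>R \<Lambda> (unleg u)) \<partial>lborel)"
    unfolding N_def by (rule integral_restrict_space) (use U in simp)
  finally show ?thesis by (simp add: entropy_density_def[abs_def] U_def w_def)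
qed

lemma entropy_density_nonneg: "0 \<le> entropy_density u"
  unfolding entropy_density_def using lag_yy_pos[of 0 "fst u" "snd u"] \<Lambda>_nonneg by simp

lemma \<Lambda>_outer: "D < \<bar>snd u\<bar> \<Longrightarrow> \<Lambda> (unleg u) = 0"
  using growth_exponent_outer[of "unleg u"] momentum_outer[of "snd u" "fst u"] by (simp add: \<Lambda>_def unleg_def)

text \<open>The integrand is bounded and vanishes outside a compact set, since the exponent is \<open>0\<close> beyond slope \<open>D\<close>.\<close>

lemma integrable_entropy_density: "integrable lborel entropy_density"
proof -
  obtain C where C: "0 \<le> C" "\<And>p. growth_exponent \<phi> p \<le> ereal C" using growth_exponent_bounded by metis
  then have \<Lambda>C: "\<Lambda> p \<le> C" for p using C(2)[of p] unfolding \<Lambda>_ereal[symmetric] by simp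
  define K where "K = {0..1 :: real} \<times> {-D..D}"
  have K: "compact K" unfolding K_def by (intro compact_Times) auto
  have "continuous_on K (\<lambda>u. lag_yy 0 (fst u) (snd u))" by (rule continuous_on_subset[OF continuous_on_lag0(3)]) simp
  from compact_imp_bounded[OF compact_continuous_image[OF this K]]
  obtain b where b: "\<And>u. u \<in> K \<Longrightarrow> \<bar>lag_yy 0 (fst u) (snd u)\<bar> \<le> b" unfolding bounded_real by blast
  have meas: "entropy_density \<in> borel_measurable lborel"
  proof -
    have "(\<lambda>u. \<Lambda> (unleg u)) \<in> borel_measurable borel"
      by (rule measurable_compose[OF borel_measurable_continuous_onI[OF continuous_on_unleg] borel_measurable_\<Lambda>])
    then show ?thesis unfolding entropy_density_def[abs_def]
      using fundamental_domain_borel borel_measurable_continuous_onI[OF continuous_on_lag0(3)]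
      by (intro borel_measurable_times borel_measurable_indicator) simp_all
  qed
  have "integrable lborel (\<lambda>u. indicator K u *\<^sub>R (b * C))"
    using emeasure_compact_finite[OF K] compact_imp_closed[OF K]
    by (intro integrable_scaleR_left) (auto intro!: integrable_real_indicator)
  then show ?thesis
  proof (rule Bochner_Integration.integrable_bound[OF _ meas], intro AE_I2)
    fix u
    show "norm (entropy_density u) \<le> norm (indicator K u *\<^sub>R (b * C))"
    proof (cases "u \<in> {0..<1} \<times> UNIV \<and> \<bar>snd u\<bar> \<le> D")
      case True
      then have uK: "u \<in> K" by (auto simp: K_def abs_le_iff)
      have y: "0 \<le> lag_yy 0 (fst u) (snd u)" "lag_yy 0 (fst u) (snd u) \<le> b"
        using lag_yy_pos[of 0 "fst u" "snd u"] b[OF uK] by auto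
      have "entropy_density u = lag_yy 0 (fst u) (snd u) * \<Lambda> (unleg u)" using True by (simp add: entropy_density_def)
      also have "\<dots> \<le> b * C" using y \<Lambda>C \<Lambda>_nonneg by (intro mult_mono) auto
      finally show ?thesis using entropy_density_nonneg[of u] uK by simp
    next
      case False
      then have "entropy_density u = 0" using \<Lambda>_outer[of u] by (auto simp: entropy_density_def)
      then show ?thesis by simp
    qed
  qed
qed

text \<open>The integrand is nonnegative, and positive on the open set that corresponds to the island.\<close>

lemma metric_entropy_pos:
  assumes g: "riemannian_metric_unit_tangent F g" and island: "stochastic_island f I"
  shows "0 < metric_entropy (V0_measure F) g (V0 F) (return_map F)"
proof -
  define N where "N = cyl -` I"
  have ex: "max_lyapunov (\<lambda>_. inner) UNIV f p > 0" if "p \<in> N" for p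
    using island that unfolding stochastic_island_def N_def by blast
  then have pos: "0 < \<Lambda> p" if "p \<in> N" for p
    using ex[OF that] unfolding max_lyapunov_f \<Lambda>_ereal[symmetric] by simp
  have "openin (top_of_set (range cyl)) I" using island unfolding stochastic_island_def by blast
  then obtain T where T: "open T" "I = range cyl \<inter> T" unfolding openin_open by blast
  have "continuous_on UNIV cyl" unfolding cyl_def[abs_def] by (intro continuous_intros)
  then have "open (cyl -` T)" using T(1) by (simp add: open_vimage)
  moreover have "N = cyl -` T" by (auto simp: N_def T(2))
  ultimately have N: "open N" by simp
  have "emeasure lborel (N \<inter> {0..<1} \<times> UNIV) > 0"
    using island unfolding stochastic_island_def N_def by blast
  then have "N \<inter> {0..<1} \<times> UNIV \<noteq> {}" by (metis emeasure_empty less_irrefl)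
  then obtain x y where xy: "(x, y) \<in> N" "0 \<le> x" "x < 1" by auto
  obtain e where e: "0 < e" "ball (x, y) e \<subseteq> N" using N xy(1) unfolding open_contains_ball by blast
  \<comment> \<open>a shift by \<open>d\<close> moves the point off the boundary \<open>x = 0\<close> of the fundamental domain without leaving \<open>N\<close>\<close>
  define d where "d = min (e / 2) ((1 - x) / 2)"
  have d: "0 < d" "d < e" "x + d < 1" using e xy by (auto simp: d_def min_def field_simps)
  then have q: "(x + d, y) \<in> N" using e(2) by (auto simp: subset_iff dist_prod_def dist_real_def)
  define W where "W = {u :: plane. 0 < fst u} \<inter> {u. fst u < 1} \<inter> unleg -` N"
  have W: "open W" unfolding W_def
    by (intro open_Int open_Collect_less continuous_intros open_vimage[OF N continuous_on_unleg])
  have "leg (x + d, y) \<in> W" using q d xy by (simp add: W_def leg_def[of "(x + d, y)", THEN arg_cong, of fst, simplified])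
  then have "W \<noteq> {}" by blast
  have dpos: "0 < entropy_density u" if "u \<in> W" for u
  proof -
    have "u \<in> {0..<1} \<times> UNIV" using that by (cases u) (auto simp: W_def)
    moreover have "0 < \<Lambda> (unleg u)" using that by (intro pos) (simp add: W_def)
    ultimately show ?thesis using lag_yy_pos[of 0 "fst u" "snd u"] by (simp add: entropy_density_def)
  qed
  have "0 \<le> (\<integral>u. entropy_density u \<partial>lborel)" by (intro integral_nonneg_AE AE_I2 entropy_density_nonneg)
  moreover have "(\<integral>u. entropy_density u \<partial>lborel) \<noteq> 0"
  proof
    assume "(\<integral>u. entropy_density u \<partial>lborel) = 0"
    then have "AE u in lborel. entropy_density u = 0"
      using integral_nonneg_eq_0_iff_AE[OF integrable_entropy_density] entropy_density_nonneg by simp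
    then have "AE u in lborel. u \<notin> W" by (rule AE_mp) (use dpos in \<open>auto intro!: AE_I2 simp: less_le\<close>)
    then have "W \<in> null_sets lborel" using W by (simp add: AE_iff_null_sets)
    then have "negligible W" by (simp add: negligible_iff_null_sets null_sets_completionI)
    then show False using open_not_negligible[OF W \<open>W \<noteq> {}\<close>] by blast
  qed
  ultimately show ?thesis unfolding metric_entropy_eq[OF g] by linarith
qed

end

theorem proposition3p7:
  fixes f :: "real \<times> real \<Rightarrow> real \<times> real"
    and I :: "(complex \<times> real) set"
    and H Lhat L :: "real \<Rightarrow> real \<Rightarrow> real \<Rightarrow> real"
    and K M D Dp Dm A B :: real
    and hp hm :: "real \<Rightarrow> real"
    and F :: "real \<times> real \<Rightarrow> real \<times> real \<Rightarrow> real"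
    and g :: "(real \<times> real) \<times> (real \<times> real) \<Rightarrow> (real \<times> real) \<times> (real \<times> real)
              \<Rightarrow> (real \<times> real) \<times> (real \<times> real) \<Rightarrow> real"
  assumes f_twist: "twist_map f"
    and f_shear: "K > 0" "\<And>x y. \<bar>y\<bar> > K \<Longrightarrow> cyl (f (x, y)) = cyl (x + y, y)"
    and f_island: "stochastic_island f I"
    and H_smooth: "smooth_on UNIV (\<lambda>(t, x, y). H t x y)"
    and H_periodic: "\<And>t x y. H (t + 1) x y = H t x y" "\<And>t x y. H t (x + 1) y = H t x y"
    and H_convex: "\<And>t x. strictly_convex (H t x)"
    and H_time_one: "time_one_map H f"
    and H_ends: "\<And>t x y. y > M \<Longrightarrow> H t x y = y\<^sup>2 / 2 + Dp"
                "\<And>t x y. y < - M \<Longrightarrow> H t x y = y\<^sup>2 / 2 + Dm"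
    and Lhat_def: "Lhat = legendre H"
    and D: "D > 0"
           "\<And>t x y. y > D \<Longrightarrow> Lhat t x y = y\<^sup>2 / 2 - Dp"
           "\<And>t x y. y < - D \<Longrightarrow> Lhat t x y = y\<^sup>2 / 2 - Dm"
    and AB: "A > 0" "B > 0"
    and hp: "smooth_on UNIV hp" "\<And>y. deriv (deriv hp) y > 0"
            "\<And>y. y < D + 1 \<Longrightarrow> hp y = y\<^sup>2 / 2 - Dp"
            "\<And>y. y > D + 2 \<Longrightarrow> hp y = sqrt (A + B * y\<^sup>2)"
    and hm: "smooth_on UNIV hm" "\<And>y. deriv (deriv hm) y > 0"
            "\<And>y. y > - D - 1 \<Longrightarrow> hm y = y\<^sup>2 / 2 - Dm"
            "\<And>y. y < - D - 2 \<Longrightarrow> hm y = sqrt (A + B * y\<^sup>2)"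
    and L_def: "L = glued_lagrangian D Lhat hm hp"
    and F_def: "F = finsler_of A B L"
    and F_finsler: "finsler_metric F"
    and g: "riemannian_metric_unit_tangent F g"
  shows "metric_entropy (V0_measure F) g (V0 F) (return_map F) > 0"
proof -
  interpret finsler_torus F by (rule finsler_torus.intro[OF F_finsler])
  have lag: "lag t x y = glued_lagrangian D (legendre H) hm hp t x y" for t x y
    unfolding lag_def by (subst F_def) (simp add: finsler_of_def L_def Lhat_def)
  interpret island_torus F H M Dp Dm f D
  proof (intro island_torus.intro tonelli_hamiltonian.intro island_torus_axioms.intro finsler_torus.intro F_finsler
      H_smooth H_periodic H_convex H_ends f_twist H_time_one)
    show "legendre H t x v = v\<^sup>2 / 2 - Dp" if "D < v" for t x v using D(2)[OF that] by (simp add: Lhat_def)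
    show "legendre H t x v = v\<^sup>2 / 2 - Dm" if "v < - D" for t x v using D(3)[OF that] by (simp add: Lhat_def)
    show "lag t x v = legendre H t x v" if "\<bar>v\<bar> < D + 1" for t x v
      using that D(2)[of v t x] D(3)[of v t x] hp(3)[of v] hm(3)[of v]
      by (auto simp: lag glued_lagrangian_def Lhat_def)
    show "lag t x v = lag 0 0 v" if "D < \<bar>v\<bar>" for t x v
      using that D(1) by (auto simp: lag glued_lagrangian_def)
  qed
  show ?thesis by (rule metric_entropy_pos[OF g f_island])
qed

end
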